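(* The constant $\kappa=\mathbb E\big[2/|C_0(\boldsymbol M_\infty)|\big]$ satisfies $$\kappa=\sum_{k=1}^{\infty}2^{-4k+1}\sum_{C\in M^{(1),k}}\left(\sum_{\ell_0,\ell_2,\dots,\ell_{2k-2}\ge0}\ \prod_{F\in\mathcal F_e(C)}\mathrm{Cat}_{\ell_{I(F)}}2^{-2\ell_{I(F)}}\right)\cdot\left(\sum_{\ell_1,\ell_3,\dots,\ell_{2k-3}\ge0}\ \prod_{F\in\mathcal F_o(C)}\mathrm{Cat}_{\ell_{I(F)}}2^{-2\ell_{I(F)}}\right),$$ where $\ell_I=\sum_{i\in I}\ell_i$ for a set $I$ of indices, and where for $k=1$ the second factor (empty family of indices and $\mathcal F_o(C)=\emptyset$) equals $1$.
   Context: Infinite noodle: let $\boldsymbol w^a_\infty,\boldsymbol w^b_\infty\in\{L,R\}^{\mathbb Z}$ be two independent random words with i.i.d. uniform letters in $\{L,R\}$. Almost surely there is a unique non-crossing partition of $\mathbb Z$ into pairs (no two pairs $\{i,k\},\{j,\ell\}$ with $i<j<k<\ell$) such that, for all $i$, $i$ is the smaller element of its pair iff $\boldsymbol w^a_\infty(i)=L$ (upper matching), and similarly for $\boldsymbol w^b_\infty$ (lower matching). The infinite noodle $\boldsymbol M_\infty$ is the (multi-)graph on $\mathbb Z$ with edges the pairs of both matchings. $|C_0(\boldsymbol M_\infty)|\in\mathbb N\cup\{\infty\}$ is the number of points in the component of $0$; convention $2/\infty=0$. Meanders: a meandric system of size $k$ is an ordered pair (upper, lower) of non-crossing perfect matchings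 of $\{0,\dots,2k-1\}$; it is a meander if the multigraph on $\{0,\dots,2k-1\}$ formed by the pairs of both matchings is connected. $M^{(1),k}$ is the set of meanders of size $k$. Faces: draw the pairs of the upper (lower) matching of a meander $C$ as non-crossing arcs above (below) the real axis. The set $\mathcal F(C)$ of faces is the set of bounded connected components of the complement of the union of these arcs and the real axis. For a face $F$, $I(F)$ is the set of indices $i\in\{0,\dots,2k-2\}$ such that $F$ is incident to the segment $[i;i+1]$. (Equivalently, faces correspond to the arcs: the face of an arc $\{a<b\}$ has $I(F)=\{i: a\le i<b$ and there is no other arc $\{c<d\}$ of the same matching with $a<c\le i<d<b\}$.) For each face $F$, the set $I(F)$ consists only of even numbers or only of odd numbers; $\mathcal F_e(C)$ and $\mathcal F_o(C)$ are the sets of faces for which $I(F)$ consists of even, respectively odd, numbers. $\mathrm{Cat}_n=\frac1{n+1}\binom{2n}n$. *)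

theory Defs
  imports "HOL-Probability.Probability" "HOL-Library.Disjoint_Sets"
begin

text \<open>A matching is represented by the set of its pairs, each pair being a two-element set.\<close>

definition noncrossing :: "'a::linorder set set \<Rightarrow> bool" where
  "noncrossing P \<longleftrightarrow> \<not> (\<exists>i j k l. i < j \<and> j < k \<and> k < l \<and> {i, k} \<in> P \<and> {j, l} \<in> P)"

definition noncrossing_matching :: "'a::linorder set \<Rightarrow> 'a set set \<Rightarrow> bool" where
  "noncrossing_matching V P \<longleftrightarrow> partition_on V P \<and> (\<forall>p\<in>P. card p = 2) \<and> noncrossing P"

text \<open>The component of a vertex in the multigraph with edge set \<open>E\<close>. Multiplicities of edges
  do not affect components, so the multigraph formed by two matchings \<open>U\<close> and \<open>D\<close> is
  represented by \<open>U \<union> D\<close>.\<close>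

definition component :: "'a set set \<Rightarrow> 'a \<Rightarrow> 'a set" where
  "component E x = {y. (x, y) \<in> {(u, v). {u, v} \<in> E}\<^sup>*}"

datatype letter = L | R

definition word_law :: "(int \<Rightarrow> letter) measure" where
  "word_law = PiM UNIV (\<lambda>_. measure_pmf (pmf_of_set {L, R}))"

definition noodle_law :: "((int \<Rightarrow> letter) \<times> (int \<Rightarrow> letter)) measure" where
  "noodle_law = word_law \<Otimes>\<^sub>M word_law"

definition matches_word :: "(int \<Rightarrow> letter) \<Rightarrow> int set set \<Rightarrow> bool" where
  "matches_word w P \<longleftrightarrow>
     noncrossing_matching UNIV P \<and> (\<forall>p\<in>P. \<forall>i\<in>p. i = Min p \<longleftrightarrow> w i = L)"

text \<open>Almost every word has exactly one such matching. On the exceptional null set the value is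
  fixed to be the empty set of pairs: leaving it to an unconstrained \<open>THE\<close> could destroy
  measurability, since \<open>noodle_law\<close> is not a complete measure.\<close>

definition word_matching :: "(int \<Rightarrow> letter) \<Rightarrow> int set set" where
  "word_matching w = (if \<exists>!P. matches_word w P then THE P. matches_word w P else {})"

definition noodle_component :: "(int \<Rightarrow> letter) \<times> (int \<Rightarrow> letter) \<Rightarrow> int set" where
  "noodle_component w = component (word_matching (fst w) \<union> word_matching (snd w)) 0"

definition kappa :: real where
  "kappa = (LINT w|noodle_law.
     (if finite (noodle_component w) then 2 / real (card (noodle_component w)) else 0))"

definition meandric_systems :: "nat \<Rightarrow> (nat set set \<times> nat set set) set" where
  "meandric_systems k =
     {(U, D). noncrossing_matching {0..<2*k} U \<and> noncrossing_matching {0..<2*k} D}"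

definition meanders :: "nat \<Rightarrow> (nat set set \<times> nat set set) set" where
  "meanders k = {(U, D) \<in> meandric_systems k.
     \<forall>x\<in>{0..<2*k}. \<forall>y\<in>{0..<2*k}. y \<in> component (U \<union> D) x}"

text \<open>Arcs are drawn as half circles orthogonal to the real axis; those of a non-crossing matching
  are pairwise disjoint.\<close>

definition arc_circle :: "nat set \<Rightarrow> complex set" where
  "arc_circle p = sphere (complex_of_real ((real (Min p) + real (Max p)) / 2))
                         ((real (Max p) - real (Min p)) / 2)"

definition drawing :: "nat set set \<times> nat set set \<Rightarrow> complex set" where
  "drawing C = \<real> \<union> (\<Union>p\<in>fst C. arc_circle p \<inter> {z. Im z \<ge> 0})
                 \<union> (\<Union>p\<in>snd C. arc_circle p \<inter> {z. Im z \<le> 0})"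

definition faces :: "nat set set \<times> nat set set \<Rightarrow> complex set set" where
  "faces C = {F \<in> components (- drawing C). bounded F}"

definition face_indices :: "nat \<Rightarrow> complex set \<Rightarrow> nat set" where
  "face_indices k F =
     {i \<in> {0..2*k-2}. closed_segment (of_nat i) (of_nat (i + 1)) \<subseteq> frontier F}"

definition even_faces :: "nat \<Rightarrow> nat set set \<times> nat set set \<Rightarrow> complex set set" where
  "even_faces k C = {F \<in> faces C. \<forall>i\<in>face_indices k F. even i}"

definition odd_faces :: "nat \<Rightarrow> nat set set \<times> nat set set \<Rightarrow> complex set set" where
  "odd_faces k C = {F \<in> faces C. \<forall>i\<in>face_indices k F. odd i}"

definition catalan :: "nat \<Rightarrow> real" where
  "catalan n = 1 / (real n + 1) * real ((2 * n) choose n)"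

definition face_weight :: "nat \<Rightarrow> (nat \<Rightarrow> nat) \<Rightarrow> complex set \<Rightarrow> real" where
  "face_weight k l F = (let n = (\<Sum>i\<in>face_indices k F. l i) in catalan n * 2 powi (- 2 * int n))"

end

(* Each site of a finite component of the noodle sends mass 2/|C| to the leftmost site of its component.
   By shift invariance (mass transport) kappa is then 2 times the probability that the component of 0 is
   finite with leftmost point 0. Such a component, read off in increasing order, is a meander of some
   size k. Both the rank and the position of a site change parity along every arc, so consecutive
   sites are separated by even gaps 2 l_0, ..., 2 l_(2k-2). Given the meander and the gaps, the event
   splits over the arcs: the two end letters of an arc are prescribed and the letters in the gaps of
   its face form a Dyck word, which has probability 1/4 Cat_n 2^(-2n) with n the sum of the l_i. The
   blocks of sites used by different arcs are disjoint, hence independent. As a face touches only even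
   or only odd gaps, the sum over the gaps factorizes. *)
theory Submission
  imports Defs
begin


section \<open>Faces and arcs\<close>

text \<open>Two gaps separate this picture from the definitions. Faces are given topologically, as
  bounded components of the complement of a drawing, whereas the probabilistic argument only sees
  arcs; so each arc gets an explicit region cut out by quadratic inequalities, and these regions are
  shown to be exactly the faces. On the probabilistic side, a finite component is a feature of two
  infinite matchings, and it is compared with events on finitely many letters off the set of words
  without a matching. That this set is null is the recurrence of the simple random walk, obtained
  from the fact that \<open>catalan n / 4 ^ Suc n\<close> sums to 1/2. All summation takes place in
  \<open>ennreal\<close>, so interchanging sums and integrals needs no convergence argument.\<close>

lemma noncrossing_matchingE:
  assumes "noncrossing_matching V P" "p \<in> P"
  obtains a b where "a < b" "p = {a, b}" "a \<in> V" "b \<in> V" "Min p = a" "Max p = b"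
proof -
  have "card p = 2" "p \<subseteq> V"
    using assms by (auto simp: noncrossing_matching_def partition_on_def)
  then obtain x y where xy: "p = {x, y}" "x \<noteq> y" by (meson card_2_iff)
  show ?thesis
  proof (cases "x < y")
    case True
    show ?thesis
      by (rule that[of x y]) (use xy True \<open>p \<subseteq> V\<close> in auto)
  next
    case False
    then have "y < x" using xy by auto
    show ?thesis
      by (rule that[of y x]) (use xy \<open>y < x\<close> \<open>p \<subseteq> V\<close> in auto)
  qed
qed

lemma noncrossing_matching_unique:
  assumes "noncrossing_matching V P" "p \<in> P" "q \<in> P" "x \<in> p" "x \<in> q"
  shows "p = q"
  using assms unfolding noncrossing_matching_def partition_on_def disjoint_def by blast

text \<open>Disjoint pairs have four distinct endpoints, and the non-crossing condition, applied in
  both orders, rules out the two interleavings.\<close>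

lemma noncrossing_matching_laminar:
  assumes "noncrossing_matching V P" "p \<in> P" "q \<in> P" "p \<noteq> q"
  shows "Max p < Min q \<or> Max q < Min p \<or> (Min p < Min q \<and> Max q < Max p) \<or> (Min q < Min p \<and> Max p < Max q)"
proof -
  obtain a b where p: "a < b" "p = {a, b}" "Min p = a" "Max p = b"
    using noncrossing_matchingE[OF assms(1,2)] by metis
  obtain c d where q: "c < d" "q = {c, d}" "Min q = c" "Max q = d"
    using noncrossing_matchingE[OF assms(1,3)] by metis
  have "a \<noteq> c" "a \<noteq> d" "b \<noteq> c" "b \<noteq> d"
    using noncrossing_matching_unique[OF assms(1-3)] assms(4) p(2) q(2) by auto
  moreover have "\<not> (a < c \<and> c < b \<and> b < d)" "\<not> (c < a \<and> a < d \<and> d < b)"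
    using assms(1-3) p(2) q(2) unfolding noncrossing_matching_def noncrossing_def by metis+
  ultimately show ?thesis using p q by (metis linorder_neqE order_less_trans)
qed

text \<open>The combinatorial description of \<open>I(F)\<close> for the face of an arc;
  \<open>face_indices_arc_region\<close> reduces the topological \<open>face_indices\<close> to
  it.\<close>

definition arc_indices :: "nat set set \<Rightarrow> nat set \<Rightarrow> nat set" where
  "arc_indices U p = {i. Min p \<le> i \<and> i < Max p \<and>
     \<not> (\<exists>q\<in>U. Min p < Min q \<and> Min q \<le> i \<and> i < Max q \<and> Max q < Max p)}"

text \<open>The power of \<open>z\<close> with respect to the circle with diameter \<open>p\<close>: negative inside, zero on the
  circle, positive outside.\<close>

definition arc_power :: "nat set \<Rightarrow> complex \<Rightarrow> real" where
  "arc_power p z = (Re z - real (Min p)) * (Re z - real (Max p)) + (Im z)\<^sup>2"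

text \<open>The face of the arc \<open>p\<close>, with \<open>s = 1\<close> for upper arcs and \<open>s = -1\<close> for lower arcs.\<close>

definition arc_region :: "real \<Rightarrow> nat set set \<Rightarrow> nat set \<Rightarrow> complex set" where
  "arc_region s U p = {z. s * Im z > 0 \<and> arc_power p z < 0 \<and>
     (\<forall>q\<in>U. Min p < Min q \<and> Max q < Max p \<longrightarrow> arc_power q z > 0)}"

lemma mem_arc_circle:
  assumes "Min p \<le> Max p"
  shows "z \<in> arc_circle p \<longleftrightarrow> arc_power p z = 0"
proof -
  define c r where "c = (real (Min p) + real (Max p)) / 2" and "r = (real (Max p) - real (Min p)) / 2"
  have r: "r \<ge> 0" using assms by (simp add: r_def)
  have "z \<in> arc_circle p \<longleftrightarrow> dist (complex_of_real c) z = r"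
    by (simp add: arc_circle_def c_def r_def)
  also have "\<dots> \<longleftrightarrow> sqrt ((Re z - c)\<^sup>2 + (Im z)\<^sup>2) = sqrt (r\<^sup>2)"
    using r by (simp add: dist_norm cmod_def power2_commute)
  also have "\<dots> \<longleftrightarrow> (Re z - c)\<^sup>2 + (Im z)\<^sup>2 = r\<^sup>2" by (rule real_sqrt_eq_iff)
  also have "\<dots> \<longleftrightarrow> arc_power p z = 0"
  proof -
    have "(Re z - c)\<^sup>2 + (Im z)\<^sup>2 - r\<^sup>2 = arc_power p z"
      by (simp add: arc_power_def c_def r_def power2_eq_square field_simps)
    then show ?thesis by linarith
  qed
  finally show ?thesis .
qed

lemma continuous_on_arc_power [continuous_intros]: "continuous_on S (arc_power p)"
  unfolding arc_power_def by (intro continuous_intros)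

lemma arc_power_neg_imp_between:
  assumes "arc_power p z \<le> 0" "Min p \<le> Max p"
  shows "real (Min p) \<le> Re z" "Re z \<le> real (Max p)"
proof -
  have "(Re z - real (Min p)) * (Re z - real (Max p)) \<le> 0"
    using assms(1) unfolding arc_power_def by (smt (verit) zero_le_power2)
  then show "real (Min p) \<le> Re z" "Re z \<le> real (Max p)"
    using assms(2) by (auto simp: mult_le_0_iff)
qed

text \<open>Endpoints are integers, so passing from the diameter of \<open>q\<close> to that of
  \<open>p\<close> lengthens both factors of the product by at least 1. The uniform margin 1 leaves
  room for a curve inside the circle of \<open>p\<close> and outside all nested circles.\<close>

lemma arc_power_nested:
  assumes "arc_power q z \<le> 0" "Min q \<le> Max q" "Min p < Min q" "Max q < Max p"
  shows "arc_power p z \<le> arc_power q z - 1"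
proof -
  define u v where "u = Re z - real (Min q)" and "v = real (Max q) - Re z"
  have uv: "u \<ge> 0" "v \<ge> 0"
    using arc_power_neg_imp_between[OF assms(1,2)] by (auto simp: u_def v_def)
  have "(u + 1) * (v + 1) \<le> (Re z - real (Min p)) * (real (Max p) - Re z)"
    using assms(3,4) uv by (intro mult_mono) (auto simp: u_def v_def)
  moreover have "u * v + 1 \<le> (u + 1) * (v + 1)" using uv by (simp add: algebra_simps)
  ultimately have "u * v + 1 \<le> (Re z - real (Min p)) * (real (Max p) - Re z)" by linarith
  then show ?thesis unfolding arc_power_def u_def v_def by (simp add: algebra_simps)
qed

lemma open_arc_region:
  assumes "finite U"
  shows "open (arc_region s U p)"
proof -
  have eq: "arc_region s U p = {z. s * Im z > 0} \<inter> {z. arc_power p z < 0} \<inter>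
      (\<Inter>q\<in>{q\<in>U. Min p < Min q \<and> Max q < Max p}. {z. arc_power q z > 0})"
    by (auto simp: arc_region_def)
  show ?thesis unfolding eq using assms
    by (intro open_Int open_INT open_Collect_less continuous_intros ballI) auto
qed

lemma closure_arc_region:
  "closure (arc_region s U p) \<subseteq> {z. s * Im z \<ge> 0 \<and> arc_power p z \<le> 0 \<and>
     (\<forall>q\<in>U. Min p < Min q \<and> Max q < Max p \<longrightarrow> arc_power q z \<ge> 0)}" (is "_ \<subseteq> ?R")
proof (rule closure_minimal)
  have eq: "?R = {z. s * Im z \<ge> 0} \<inter> {z. arc_power p z \<le> 0} \<inter>
      (\<Inter>q\<in>{q\<in>U. Min p < Min q \<and> Max q < Max p}. {z. arc_power q z \<ge> 0})"
    by auto
  show "closed ?R" unfolding eq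
    by (intro closed_Int closed_INT closed_Collect_le continuous_intros ballI)
qed (auto simp: arc_region_def less_imp_le)

lemma power2_Im_mono:
  assumes "0 < s * Im z" "s * Im z \<le> s * Im z'" "s = 1 \<or> s = -1"
  shows "(Im z)\<^sup>2 \<le> (Im z')\<^sup>2"
proof -
  have "(s * Im z)\<^sup>2 \<le> (s * Im z')\<^sup>2" using assms by (intro power_mono) auto
  then show ?thesis using assms(3) by (auto simp: power_mult_distrib)
qed

text \<open>Any two points are joined by going vertically away from the axis to a level curve of
  \<open>arc_power p\<close> close to the arc, and then along this curve, which is a graph over an
  interval.\<close>

lemma connected_arc_region:
  assumes s: "s = 1 \<or> s = -1" and U: "noncrossing_matching {0..<2*k} U" and p: "p \<in> U"
  shows "connected (arc_region s U p)"
  unfolding connected_iff_connected_component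
proof (intro ballI)
  let ?R = "arc_region s U p"
  fix z1 z2 assume z: "z1 \<in> ?R" "z2 \<in> ?R"
  \<comment> \<open>The bound 1/2 is below the margin 1 of \<open>arc_power_nested\<close>, so the
    level curve \<open>arc_power p = - e\<close> misses the nested discs; the other two bounds place
    \<open>z1\<close> and \<open>z2\<close> on the curve or between it and the axis.\<close>
  define e where "e = min (1/2) (min (- arc_power p z1) (- arc_power p z2))"
  define y where "y x = - e - (x - real (Min p)) * (x - real (Max p))" for x
  define f where "f x = Complex x (s * sqrt (y x))" for x
  have e: "e > 0" "e \<le> 1/2" "arc_power p z1 \<le> - e" "arc_power p z2 \<le> - e"
    using z by (auto simp: e_def arc_region_def)
  have Im_f: "s * Im (f x) = sqrt (y x)" "(Im (f x))\<^sup>2 = y x" if "y x > 0" for x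
    using s that by (auto simp: f_def power_mult_distrib)
  define c r where "c = (real (Min p) + real (Max p)) / 2" and "r = (real (Max p) - real (Min p)) / 2"
  have y_eq: "y x = r\<^sup>2 - e - (x - c)\<^sup>2" for x
    by (simp add: y_def c_def r_def power2_eq_square field_simps)
  define J where "J = {x. y x > 0}"
  have J_eq: "J = {c - sqrt (r\<^sup>2 - e)<..<c + sqrt (r\<^sup>2 - e)}" 
  proof -
    have "y x > 0 \<longleftrightarrow> \<bar>x - c\<bar> < sqrt (r\<^sup>2 - e)" for x
      unfolding y_eq by (metis diff_gt_0_iff_gt real_sqrt_abs real_sqrt_less_iff)
    then have "J = {x. \<bar>x - c\<bar> < sqrt (r\<^sup>2 - e)}" by (simp add: J_def)
    also have "\<dots> = {c - sqrt (r\<^sup>2 - e)<..<c + sqrt (r\<^sup>2 - e)}"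
      by (intro set_eqI) (simp add: abs_diff_less_iff)
    finally show ?thesis .
  qed
  have K_sub: "f x \<in> ?R" if "x \<in> J" for x
  proof -
    have yx: "y x > 0" using that by (simp add: J_def)
    have pw: "arc_power p (f x) = - e"
      using Im_f[OF yx] by (simp add: arc_power_def f_def y_def)
    have "arc_power q (f x) > 0" if q: "q \<in> U" "Min p < Min q" "Max q < Max p" for q
    proof (rule ccontr)
      assume "\<not> arc_power q (f x) > 0"
      then have le: "arc_power q (f x) \<le> 0" by simp
      have "Min q \<le> Max q" using noncrossing_matchingE[OF U q(1)] by (metis less_imp_le)
      from arc_power_nested[OF le this q(2,3)] have "arc_power p (f x) \<le> arc_power q (f x) - 1" .
      with le show False using pw e by linarith
    qed
    then show ?thesis using pw e Im_f[OF yx] yx by (auto simp: arc_region_def)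
  qed
  have cont: "continuous_on J f"
    unfolding f_def Complex_eq y_def by (intro continuous_intros)
  have K: "connected (f ` J)"
    by (rule connected_continuous_image[OF cont]) (simp add: J_eq)
  have vert: "\<exists>T. connected T \<and> T \<subseteq> ?R \<and> z \<in> T \<and> f (Re z) \<in> T \<and> Re z \<in> J"
    if zR: "z \<in> ?R" and ze: "arc_power p z \<le> - e" for z
  proof (intro exI conjI)
    have Imz: "s * Im z > 0" using zR by (simp add: arc_region_def)
    have yz: "y (Re z) \<ge> (Im z)\<^sup>2" using ze by (simp add: arc_power_def y_def)
    moreover have "(Im z)\<^sup>2 > 0" using Imz by auto
    ultimately have ypos: "y (Re z) > 0" by linarith
    then show "Re z \<in> J" by (simp add: J_def)
    \<comment> \<open>Moving away from the axis at fixed real part increases every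
      \<open>arc_power q\<close>, so no nested disc is entered; since the motion stops at the level
      curve, \<open>arc_power p\<close> stays at most \<open>- e\<close>.\<close>
    show "closed_segment z (f (Re z)) \<subseteq> ?R"
    proof
      fix v assume "v \<in> closed_segment z (f (Re z))"
      then obtain t where t: "0 \<le> t" "t \<le> 1" "v = (1 - t) *\<^sub>R z + t *\<^sub>R f (Re z)"
        by (auto simp: closed_segment_def)
      have Rev: "Re v = Re z" unfolding t(3) by (simp add: f_def left_diff_distrib)
      have le: "s * Im z \<le> sqrt (y (Re z))"
        using s real_le_rsqrt[of "s * Im z" "y (Re z)"] yz by (auto simp: power_mult_distrib)
      have Imv: "s * Im v = (1 - t) * (s * Im z) + t * sqrt (y (Re z))"
        unfolding t(3) Im_f(1)[OF ypos, symmetric] by (simp add: algebra_simps)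
      have "t * (s * Im z) \<le> t * sqrt (y (Re z))" using le t(1) by (rule mult_left_mono)
      then have lo: "s * Im z \<le> s * Im v" unfolding Imv by (simp add: algebra_simps)
      have "(1 - t) * (s * Im z) \<le> (1 - t) * sqrt (y (Re z))"
        using le t(2) by (intro mult_left_mono) auto
      then have hi: "s * Im v \<le> s * Im (f (Re z))"
        unfolding Imv Im_f(1)[OF ypos] by (simp add: algebra_simps)
      have i1: "(Im z)\<^sup>2 \<le> (Im v)\<^sup>2" using power2_Im_mono[OF Imz lo s] .
      have i2: "(Im v)\<^sup>2 \<le> (Im (f (Re z)))\<^sup>2"
        by (rule power2_Im_mono[OF _ hi s]) (use Imz lo in linarith)
      have "arc_power p v \<le> - e" using i2 Im_f(2)[OF ypos] by (simp add: arc_power_def Rev y_def)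
      moreover have "arc_power q v \<ge> arc_power q z" for q
        using i1 by (simp add: arc_power_def Rev)
      ultimately show "v \<in> ?R" using zR e Imz lo unfolding arc_region_def
        by (smt (verit) mem_Collect_eq)
    qed
  qed auto
  obtain T1 where T1: "connected T1" "T1 \<subseteq> ?R" "z1 \<in> T1" "f (Re z1) \<in> T1" "Re z1 \<in> J"
    using vert[OF z(1) e(3)] by blast
  obtain T2 where T2: "connected T2" "T2 \<subseteq> ?R" "z2 \<in> T2" "f (Re z2) \<in> T2" "Re z2 \<in> J"
    using vert[OF z(2) e(4)] by blast
  have "connected (T1 \<union> f ` J)" using T1 K by (intro connected_Un) auto
  then have "connected ((T1 \<union> f ` J) \<union> T2)"
    by (rule connected_Un) (use T2 in auto)
  then show "connected_component ?R z1 z2"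
    unfolding connected_component_def using T1 T2 K_sub
    by (intro exI[of _ "T1 \<union> f ` J \<union> T2"]) auto
qed

text \<open>The axis point is approached vertically. No nested disc interferes, because its diameter
  lies entirely to one side of the segment after \<open>i\<close>.\<close>

lemma segment_in_closure_arc_region:
  assumes s: "s = 1 \<or> s = -1" and i: "i \<in> arc_indices U p" and U: "\<forall>q\<in>U. Min q < Max q"
    and x: "real i < x" "x < real i + 1"
  shows "complex_of_real x \<in> closure (arc_region s U p)"
  unfolding closure_approachable
proof (intro allI impI)
  fix e :: real assume "e > 0"
  have neg: "(x - real (Min p)) * (real (Max p) - x) > 0"
    using i x by (auto simp: arc_indices_def intro!: mult_pos_pos)
  define m where "m = (x - real (Min p)) * (real (Max p) - x)"
  \<comment> \<open>\<open>d\<close> at most 1 gives \<open>d\<^sup>2 \<le> d < m\<close>, which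
    keeps the point inside the circle of \<open>p\<close>; \<open>d < e\<close> keeps it near the
    axis point.\<close>
  define d where "d = min (e / 2) (min 1 (m / 2))"
  have d: "d > 0" "d < e" "d \<le> 1" "d < m"
    using \<open>e > 0\<close> neg unfolding m_def[symmetric] by (auto simp: d_def min_def)
  have "d\<^sup>2 \<le> d" using d by (simp add: power2_eq_square mult_left_le)
  then have d2: "d\<^sup>2 < m" using d by linarith
  let ?z = "Complex x (s * d)"
  have "arc_power p ?z < 0"
    using d2 s by (auto simp: arc_power_def m_def power_mult_distrib algebra_simps)
  moreover have "arc_power q ?z > 0" if q: "q \<in> U" "Min p < Min q" "Max q < Max p" for q
  proof -
    have "\<not> (Min q \<le> i \<and> i < Max q)" using i q by (auto simp: arc_indices_def)
    then have "i + 1 \<le> Min q \<or> Max q \<le> i" by linarith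
    then have "real i + 1 \<le> real (Min q) \<or> real (Max q) \<le> real i" by linarith
    moreover have "real (Min q) < real (Max q)" using U q by auto
    ultimately have "(x - real (Min q)) * (x - real (Max q)) \<ge> 0"
      using x by (auto simp: zero_le_mult_iff)
    moreover have "(s * d)\<^sup>2 > 0" using s d by (auto simp: power_mult_distrib)
    ultimately show ?thesis unfolding arc_power_def complex.sel by linarith
  qed
  moreover have "s * Im ?z > 0" using s d by auto
  ultimately have "?z \<in> arc_region s U p" by (auto simp: arc_region_def)
  moreover have "dist ?z (complex_of_real x) < e"
    using s d by (auto simp: dist_norm cmod_def)
  ultimately show "\<exists>y\<in>arc_region s U p. dist y (complex_of_real x) < e" by blast
qed

lemma face_indices_arc_region:
  assumes s: "s = 1 \<or> s = -1" and U: "noncrossing_matching {0..<2*k} U" and p: "p \<in> U"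
  shows "face_indices k (arc_region s U p) = arc_indices U p"
proof -
  have fin: "finite U"
    using U finite_elements[of "{0..<2*k}" U] by (auto simp: noncrossing_matching_def)
  let ?R = "arc_region s U p"
  have fr: "frontier ?R = closure ?R - ?R"
    using open_arc_region[OF fin] by (simp add: frontier_def interior_open)
  have lt: "\<forall>q\<in>U. Min q < Max q" using noncrossing_matchingE[OF U] by metis
  have pk: "Max p < 2 * k" using noncrossing_matchingE[OF U p] by (metis atLeastLessThan_iff)
  show ?thesis
  proof (intro equalityI subsetI)
    fix i assume i: "i \<in> face_indices k ?R"
    \<comment> \<open>The midpoint differs from every integer endpoint, so the weak inequalities
      valid on the closure translate into the integer inequalities of
      \<open>arc_indices\<close>.\<close>
    let ?x = "complex_of_real (real i + 1/2)"
    have "?x \<in> closed_segment (of_nat i) (of_nat (i+1))"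
      by (auto simp: closed_segment_def scaleR_conv_of_real algebra_simps intro!: exI[of _ "1/2"])
    then have "?x \<in> closure ?R" using i fr by (auto simp: face_indices_def)
    then have x: "arc_power p ?x \<le> 0"
       "\<And>q. q \<in> U \<Longrightarrow> Min p < Min q \<Longrightarrow> Max q < Max p \<Longrightarrow> arc_power q ?x \<ge> 0"
      using closure_arc_region[of s U p] by auto
    have "real (Min p) \<le> real i + 1/2" "real i + 1/2 \<le> real (Max p)"
      using arc_power_neg_imp_between[OF x(1)] lt p by (auto simp: less_imp_le)
    then have "Min p \<le> i" "i < Max p" by linarith+
    moreover have False if q: "q \<in> U" "Min p < Min q" "Min q \<le> i" "i < Max q" "Max q < Max p" for q
    proof -
      have "real (Min q) < real i + 1/2" "real i + 1/2 < real (Max q)" using q by linarith+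
      then have "(real i + 1/2 - real (Min q)) * (real i + 1/2 - real (Max q)) < 0"
        by (simp add: mult_pos_neg)
      then show False using x(2)[OF q(1,2,5)] by (simp add: arc_power_def)
    qed
    ultimately show "i \<in> arc_indices U p" by (auto simp: arc_indices_def)
  next
    fix i assume i: "i \<in> arc_indices U p"
    have "open_segment (of_nat i :: complex) (of_nat (i+1)) \<subseteq> closure ?R"
    proof
      fix z :: complex assume "z \<in> open_segment (of_nat i) (of_nat (i+1))"
      then obtain u where u: "0 < u" "u < 1" "z = (1 - u) *\<^sub>R of_nat i + u *\<^sub>R of_nat (i+1)"
        unfolding in_segment by auto
      have "z = complex_of_real (real i + u)"
        using u(3) by (simp add: scaleR_conv_of_real algebra_simps)
      then show "z \<in> closure ?R"
        using segment_in_closure_arc_region[OF s i lt, of "real i + u"] u by simp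
    qed
    then have "closure (open_segment (of_nat i :: complex) (of_nat (i+1))) \<subseteq> closure ?R"
      by (rule closure_minimal) simp
    then have 1: "closed_segment (of_nat i :: complex) (of_nat (i+1)) \<subseteq> closure ?R"
      by (simp add: closure_open_segment)
    have 2: "z \<notin> ?R" if "z \<in> closed_segment (of_nat i :: complex) (of_nat (i+1))" for z
    proof -
      have "Im z = 0" using that by (auto simp: closed_segment_def)
      then show ?thesis by (simp add: arc_region_def)
    qed
    have "i < Max p" using i by (auto simp: arc_indices_def)
    then show "i \<in> face_indices k ?R" using 1 2 fr pk by (auto simp: face_indices_def)
  qed
qed

text \<open>\<open>S\<close> is described on one side of the axis only, so that the same proof
  serves the upper half plane with \<open>s = 1\<close> and the lower one with
  \<open>s = -1\<close>. The region is open and contains every point of \<open>S\<close> in its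
  closure; being connected and relatively clopen, it is a full component.\<close>

lemma arc_region_in_components:
  assumes s: "s = 1 \<or> s = -1" and U: "noncrossing_matching {0..<2*k} U" and p: "p \<in> U"
    and real: "\<And>z. z \<in> S \<Longrightarrow> Im z \<noteq> 0"
    and S: "\<And>z. s * Im z > 0 \<Longrightarrow> z \<in> S \<longleftrightarrow> (\<forall>q\<in>U. z \<notin> arc_circle q)"
  shows "arc_region s U p \<in> components S" "bounded (arc_region s U p)"
proof -
  let ?R = "arc_region s U p"
  have fin: "finite U"
    using U finite_elements[of "{0..<2*k}" U] by (auto simp: noncrossing_matching_def)
  have lt: "\<And>q. q \<in> U \<Longrightarrow> Min q < Max q" using noncrossing_matchingE[OF U] by metis
  have circ: "\<And>q z. q \<in> U \<Longrightarrow> z \<in> arc_circle q \<longleftrightarrow> arc_power q z = 0"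
    using mem_arc_circle lt by (simp add: less_imp_le)
  have sub: "?R \<subseteq> S"
  proof
    fix z assume z: "z \<in> ?R"
    have "arc_power q z \<noteq> 0" if q: "q \<in> U" for q
    proof
      assume 0: "arc_power q z = 0"
      then have "q \<noteq> p" using z by (auto simp: arc_region_def)
      have bt: "real (Min q) \<le> Re z" "Re z \<le> real (Max q)"
        using arc_power_neg_imp_between[of q z] 0 lt[OF q] by auto
      have bt': "real (Min p) \<le> Re z" "Re z \<le> real (Max p)"
        using arc_power_neg_imp_between[of p z] z lt[OF p] by (auto simp: arc_region_def)
      \<comment> \<open>Only an enclosing arc is left: separate arcs are excluded by the position of
        \<open>Re z\<close>, nested ones by the definition of the region.\<close>
      have "Min q < Min p \<and> Max p < Max q"
        using noncrossing_matching_laminar[OF U q p \<open>q \<noteq> p\<close>] bt bt' z 0 q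
        by (auto simp: arc_region_def)
      then have "arc_power q z \<le> arc_power p z - 1"
        using arc_power_nested[of p z q] z lt[OF p] by (auto simp: arc_region_def)
      then show False using 0 z by (auto simp: arc_region_def)
    qed
    then show "z \<in> S" using S z circ by (auto simp: arc_region_def)
  qed
  have ne: "?R \<noteq> {}"
  proof -
    have "Max p - 1 \<in> arc_indices U p"
      using lt[OF p] by (auto simp: arc_indices_def)
    then have "complex_of_real (real (Max p - 1) + 1/2) \<in> closure ?R"
      using lt by (intro segment_in_closure_arc_region[OF s]) auto
    then show ?thesis by auto
  qed
  have clos: "closure ?R \<inter> S \<subseteq> ?R"
  proof
    fix z assume z: "z \<in> closure ?R \<inter> S"
    then have *: "s * Im z \<ge> 0" "arc_power p z \<le> 0"
       "\<forall>q\<in>U. Min p < Min q \<and> Max q < Max p \<longrightarrow> arc_power q z \<ge> 0"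
      using closure_arc_region[of s U p] by auto
    have "Im z \<noteq> 0" using z real by auto
    then have pos: "s * Im z > 0" using * s by auto
    then have "\<forall>q\<in>U. arc_power q z \<noteq> 0" using z S circ by auto
    then show "z \<in> ?R" using * pos p unfolding arc_region_def
      by (smt (verit) mem_Collect_eq)
  qed
  show "?R \<in> components S"
    unfolding in_components_maximal
  proof (intro conjI allI impI)
    fix d assume d: "d \<noteq> {} \<and> ?R \<subseteq> d \<and> d \<subseteq> S \<and> connected d"
    have "?R \<inter> d = {} \<or> - closure ?R \<inter> d = {}"
    proof (rule connectedD)
      show "open ?R" by (rule open_arc_region[OF fin])
      show "?R \<inter> - closure ?R \<inter> d = {}" using closure_subset[of ?R] by auto
      show "d \<subseteq> ?R \<union> - closure ?R" using d clos by auto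
    qed (use d in auto)
    then show "d = ?R" using d ne clos by blast
  qed (use sub ne connected_arc_region[OF s U p] in auto)
  show "bounded ?R"
  proof (rule bounded_subset)
    let ?r = "real (Max p)"
    show "?R \<subseteq> cbox (Complex (real (Min p)) (-?r)) (Complex ?r ?r)"
    proof
      fix z assume z: "z \<in> ?R"
      have bt: "real (Min p) \<le> Re z" "Re z \<le> ?r"
        using arc_power_neg_imp_between[of p z] z lt[OF p] by (auto simp: arc_region_def)
      have "(Im z)\<^sup>2 \<le> (Re z - real (Min p)) * (?r - Re z)"
        using z by (auto simp: arc_region_def arc_power_def algebra_simps)
      also have "\<dots> \<le> ?r * ?r" using bt by (intro mult_mono) auto
      finally have "(Im z)\<^sup>2 \<le> ?r\<^sup>2" by (simp add: power2_eq_square)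
      then have "\<bar>Im z\<bar> \<le> ?r" using abs_le_square_iff[of "Im z" ?r] by auto
      then show "z \<in> cbox (Complex (real (Min p)) (-?r)) (Complex ?r ?r)"
        using bt by (auto simp: in_cbox_complex_iff)
    qed
  qed (rule bounded_cbox)
qed

text \<open>A point under some arc lies in the region of a shortest arc above it. A point under no
  arc can be moved vertically to infinity without meeting a circle, so its component is
  unbounded.\<close>

lemma bounded_component_is_arc_region:
  assumes s: "s = 1 \<or> s = -1" and U: "noncrossing_matching {0..<2*k} U"
    and real: "\<And>z. z \<in> S \<Longrightarrow> Im z \<noteq> 0"
    and S: "\<And>z. s * Im z > 0 \<Longrightarrow> z \<in> S \<longleftrightarrow> (\<forall>q\<in>U. z \<notin> arc_circle q)"
    and F: "F \<in> components S" "bounded F" "z \<in> F" "s * Im z > 0"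
  shows "F \<in> arc_region s U ` U"
proof -
  have fin: "finite U"
    using U finite_elements[of "{0..<2*k}" U] by (auto simp: noncrossing_matching_def)
  have lt: "\<And>q. q \<in> U \<Longrightarrow> Min q < Max q" using noncrossing_matchingE[OF U] by metis
  have circ: "\<And>q z. q \<in> U \<Longrightarrow> z \<in> arc_circle q \<longleftrightarrow> arc_power q z = 0"
    using mem_arc_circle lt by (simp add: less_imp_le)
  have zS: "z \<in> S" using F in_components_subset by blast
  then have nz: "\<And>q. q \<in> U \<Longrightarrow> arc_power q z \<noteq> 0" using S F circ by auto
  have FR: "F = connected_component_set S z"
    using F by (metis connected_component_eq componentsE)
  show ?thesis
  proof (cases "\<exists>q\<in>U. arc_power q z < 0")
    case True
    define Q where "Q = {q\<in>U. arc_power q z < 0}"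
    have "finite Q" "Q \<noteq> {}" using fin True by (auto simp: Q_def)
    define p where "p = arg_min_on (\<lambda>q. Max q - Min q) Q"
    have p: "p \<in> Q" "\<And>q. q \<in> Q \<Longrightarrow> Max p - Min p \<le> Max q - Min q"
      unfolding p_def by (rule arg_min_if_finite(1)[OF \<open>finite Q\<close> \<open>Q \<noteq> {}\<close>],
        rule arg_min_least[OF \<open>finite Q\<close> \<open>Q \<noteq> {}\<close>])
    have "arc_power q z > 0" if q: "q \<in> U" "Min p < Min q" "Max q < Max p" for q
    proof (rule ccontr)
      assume "\<not> arc_power q z > 0"
      then have "q \<in> Q" using nz[OF q(1)] q by (auto simp: Q_def)
      then have "Max p - Min p \<le> Max q - Min q" by (rule p(2))
      then show False using q(2,3) lt[OF q(1)] by linarith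
    qed
    then have zp: "z \<in> arc_region s U p" using p F by (auto simp: arc_region_def Q_def)
    have pU: "p \<in> U" using p by (auto simp: Q_def)
    have "F = arc_region s U p"
      using arc_region_in_components(1)[OF s U pU real S] F(1,3) zp
      by (metis IntI components_nonoverlap empty_iff)
    then show ?thesis using pU by auto
  next
    case False
    then have pos: "\<And>q. q \<in> U \<Longrightarrow> arc_power q z > 0" using nz by (meson linorder_neqE)
    define g where "g t = z + \<i> * complex_of_real (s * t)" for t
    have "g ` {0..} \<subseteq> S"
    proof
      fix v assume "v \<in> g ` {0..}"
      then obtain t where t: "t \<ge> 0" "v = g t" by auto
      have sv: "s * Im v = s * Im z + t" using s t by (auto simp: g_def)
      then have "s * Im z \<le> s * Im v" using t by simp
      from power2_Im_mono[OF F(4) this s] have "arc_power q v \<ge> arc_power q z" for q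
        using t by (simp add: arc_power_def g_def)
      then have nz: "\<forall>q\<in>U. arc_power q v \<noteq> 0" using pos by (metis less_le_trans less_irrefl)
      have "s * Im v > 0" using sv t F by simp
      from S[OF this] nz circ show "v \<in> S" by simp
    qed
    moreover have "connected (g ` {0..})"
    proof (rule connected_continuous_image)
      show "continuous_on {0..} g" unfolding g_def by (intro continuous_intros)
    qed (rule connected_Ici)
    moreover have "z \<in> g ` {0..}" by (rule image_eqI[of _ _ 0]) (auto simp: g_def)
    ultimately have "g ` {0..} \<subseteq> F" unfolding FR by (intro connected_component_maximal)
    then have "bounded (g ` {0..})" by (rule bounded_subset[OF F(2)])
    then obtain B where "\<forall>v\<in>g ` {0..}. norm v \<le> B" unfolding bounded_iff ..
    then have B: "\<And>t. t \<ge> 0 \<Longrightarrow> norm (g t) \<le> B" by simp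
    have "t \<le> B + norm z" if "t \<ge> 0" for t
    proof -
      have "norm (g t - z) = t" using s that by (auto simp: g_def norm_mult)
      then show ?thesis using norm_triangle_ineq4[of "g t" z] B[OF that] by linarith
    qed
    from this[of "max 0 (B + norm z + 1)"] show ?thesis by auto
  qed
qed

section \<open>The faces of a drawing as regions of arcs\<close>

lemma drawing_side:
  "Im z > 0 \<Longrightarrow> z \<in> - drawing (U, D) \<longleftrightarrow> (\<forall>q\<in>U. z \<notin> arc_circle q)"
  "Im z < 0 \<Longrightarrow> z \<in> - drawing (U, D) \<longleftrightarrow> (\<forall>q\<in>D. z \<notin> arc_circle q)"
  "z \<in> - drawing (U, D) \<Longrightarrow> Im z \<noteq> 0"
  by (auto simp: drawing_def complex_is_Real_iff)

lemma faces_eq_arc_regions: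
  assumes U: "noncrossing_matching {0..<2*k} U" and D: "noncrossing_matching {0..<2*k} D"
  shows "faces (U, D) = arc_region 1 U ` U \<union> arc_region (-1) D ` D"
proof (intro equalityI subsetI)
  fix F assume "F \<in> faces (U, D)"
  then have F: "F \<in> components (- drawing (U, D))" "bounded F" by (auto simp: faces_def)
  obtain z where z: "z \<in> F" using F in_components_nonempty by blast
  then have "Im z \<noteq> 0" using F(1) in_components_subset drawing_side(3) by blast
  then consider "Im z > 0" | "Im z < 0" by linarith
  then show "F \<in> arc_region 1 U ` U \<union> arc_region (-1) D ` D"
  proof cases
    case 1
    then show ?thesis
      using bounded_component_is_arc_region[of 1 k U "- drawing (U, D)" F z] U F z drawing_side(1,3)
      by auto
  next
    case 2
    then show ?thesis
      using bounded_component_is_arc_region[of "-1" k D "- drawing (U, D)" F z] D F z drawing_side(2,3)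
      by auto
  qed
next
  fix F assume "F \<in> arc_region 1 U ` U \<union> arc_region (-1) D ` D"
  then consider p where "p \<in> U" "F = arc_region 1 U p" | p where "p \<in> D" "F = arc_region (-1) D p"
    by auto
  then show "F \<in> faces (U, D)"
  proof cases
    case 1
    then show ?thesis
      using arc_region_in_components[of 1 k U p "- drawing (U, D)"] U drawing_side(1,3)
      by (auto simp: faces_def)
  next
    case 2
    then show ?thesis
      using arc_region_in_components[of "-1" k D p "- drawing (U, D)"] D drawing_side(2,3)
      by (auto simp: faces_def)
  qed
qed

lemma arc_indices_Min: "Min p < Max p \<Longrightarrow> Min p \<in> arc_indices U p"
  by (auto simp: arc_indices_def)

lemma arc_indices_disjoint:
  assumes "noncrossing_matching V U" "p \<in> U" "q \<in> U" "p \<noteq> q"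
  shows "arc_indices U p \<inter> arc_indices U q = {}"
  using noncrossing_matching_laminar[OF assms] assms(2,3) by (auto simp: arc_indices_def)

text \<open>The index set of a region is nonempty and identifies the arc. This lets products over
  faces be reindexed by arcs.\<close>

lemma inj_on_arc_region:
  assumes s: "s = 1 \<or> s = -1" and U: "noncrossing_matching {0..<2*k} U"
  shows "inj_on (arc_region s U) U"
proof (rule inj_onI)
  fix p q assume pq: "p \<in> U" "q \<in> U" and eq: "arc_region s U p = arc_region s U q"
  have I: "arc_indices U p = arc_indices U q"
    using face_indices_arc_region[OF s U] pq eq by metis
  have "Min p < Max p" using noncrossing_matchingE[OF U pq(1)] by metis
  then have "Min p \<in> arc_indices U p" by (rule arc_indices_Min)
  then show "p = q" using arc_indices_disjoint[OF U pq] I by auto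
qed


section \<open>Arcs of a word\<close>

fun letter_step :: "letter \<Rightarrow> int" where
  "letter_step L = 1"
| "letter_step R = -1"

text \<open>Taken over arbitrary sets of positions rather than intervals, since the positions
  belonging to one face are scattered; heights then add up over disjoint blocks.\<close>

definition word_height :: "(int \<Rightarrow> letter) \<Rightarrow> int set \<Rightarrow> int" where
  "word_height w S = (\<Sum>m\<in>S. letter_step (w m))"

text \<open>The matching of a word pairs \<open>i\<close> with the first return of the walk to its level before \<open>i\<close>.\<close>

definition is_arc :: "(int \<Rightarrow> letter) \<Rightarrow> int \<Rightarrow> int \<Rightarrow> bool" where
  "is_arc w i j \<longleftrightarrow> i < j \<and> word_height w {i..j} = 0 \<and> (\<forall>t. i \<le> t \<and> t < j \<longrightarrow> word_height w {i..t} > 0)"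

definition arc_set :: "(int \<Rightarrow> letter) \<Rightarrow> int set set" where
  "arc_set w = {{i, j} | i j. is_arc w i j}"

definition matchable :: "(int \<Rightarrow> letter) \<Rightarrow> bool" where
  "matchable w \<longleftrightarrow> (\<forall>i. \<exists>j. is_arc w i j \<or> is_arc w j i)"

text \<open>The usual Dyck condition for the letters read along \<open>G\<close> in increasing
  order. \<open>G\<close> need not be an interval, as a face can touch several gaps.\<close>

definition dyck :: "(int \<Rightarrow> letter) \<Rightarrow> int set \<Rightarrow> bool" where
  "dyck w G \<longleftrightarrow> word_height w G = 0 \<and> (\<forall>t. word_height w (G \<inter> {..t}) \<ge> 0)"

lemma word_height_union_disjoint:
  "finite A \<Longrightarrow> finite B \<Longrightarrow> A \<inter> B = {} \<Longrightarrow> word_height w (A \<union> B) = word_height w A + word_height w B"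
  by (simp add: word_height_def sum.union_disjoint)

lemma word_height_split:
  fixes i j t :: int
  assumes "i \<le> t + 1" "t \<le> j"
  shows "word_height w {i..j} = word_height w {i..t} + word_height w {t+1..j}"
proof -
  have "{i..j} = {i..t} \<union> {t+1..j}" using assms by auto
  then show ?thesis by (simp add: word_height_union_disjoint)
qed

lemma word_height_singleton [simp]: "word_height w {i} = letter_step (w i)"
  by (simp add: word_height_def)

lemma word_height_empty [simp]: "word_height w {} = 0"
  by (simp add: word_height_def)

lemma is_arc_less: "is_arc w i j \<Longrightarrow> i < j"
  by (simp add: is_arc_def)

lemma letter_step_pos: "letter_step x > 0 \<longleftrightarrow> x = L"
  by (cases x) auto

lemma letter_step_neg: "letter_step x < 0 \<longleftrightarrow> x = R"
  by (cases x) auto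

lemma is_arc_letters:
  assumes "is_arc w i j"
  shows "w i = L" "w j = R"
proof -
  have "word_height w {i..i} > 0" using assms unfolding is_arc_def by blast
  then show "w i = L" by (simp add: letter_step_pos)
  have "word_height w {i..j} = word_height w {i..j-1} + word_height w {j..j}"
    using word_height_split[of i "j-1" j w] assms by (simp add: is_arc_def)
  moreover have "word_height w {i..j-1} > 0" "word_height w {i..j} = 0" using assms by (auto simp: is_arc_def)
  ultimately have "letter_step (w j) < 0" by simp
  then show "w j = R" by (simp add: letter_step_neg)
qed

lemma is_arc_right_unique:
  assumes "is_arc w i j" "is_arc w i j'"
  shows "j = j'"
proof (rule ccontr)
  assume "j \<noteq> j'"
  then consider "j < j'" | "j' < j" by linarith
  then show False using assms unfolding is_arc_def
    by cases (metis less_irrefl less_imp_le)+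
qed

lemma is_arc_left_unique_aux:
  assumes "is_arc w i j" "is_arc w i' j" "i < i'"
  shows False
proof -
  have "word_height w {i..j} = word_height w {i..i'-1} + word_height w {i'..j}"
    using word_height_split[of i "i'-1" j w] assms by (auto simp: is_arc_def)
  moreover have "word_height w {i..i'-1} > 0" "word_height w {i..j} = 0" "word_height w {i'..j} = 0"
    using assms by (auto simp: is_arc_def)
  ultimately show False by simp
qed

lemma is_arc_left_unique:
  assumes "is_arc w i j" "is_arc w i' j"
  shows "i = i'"
  using is_arc_left_unique_aux assms by (metis linorder_neqE)

lemma is_arc_noncrossing:
  assumes "is_arc w i k" "is_arc w j l" "i < j" "j < k" "k < l"
  shows False
proof -
  have "word_height w {i..k} = word_height w {i..j-1} + word_height w {j..k}"
    using word_height_split[of i "j-1" k w] assms by auto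
  moreover have "word_height w {i..j-1} > 0" "word_height w {j..k} > 0" "word_height w {i..k} = 0"
    using assms by (auto simp: is_arc_def)
  ultimately show False by simp
qed

lemma is_arc_cong:
  assumes "\<And>m. i \<le> m \<Longrightarrow> m \<le> j \<Longrightarrow> w m = w' m"
  shows "is_arc w i j \<longleftrightarrow> is_arc w' i j"
proof -
  have "word_height w {i..t} = word_height w' {i..t}" if "t \<le> j" for t
    unfolding word_height_def using assms that by (intro sum.cong) auto
  then show ?thesis unfolding is_arc_def by (metis order_refl less_imp_le)
qed

lemma doubleton_in_arc_set: "{i, j} \<in> arc_set w \<longleftrightarrow> is_arc w i j \<or> is_arc w j i"
  unfolding arc_set_def by (auto simp: doubleton_eq_iff)

lemma word_height_eq_card:
  assumes "finite G"
  shows "word_height w G = int (card {m\<in>G. w m = L}) - int (card {m\<in>G. w m = R})"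
proof -
  have "letter_step x = (if x = L then 1 else 0) - (if x = R then 1 else 0)" for x
    by (cases x) auto
  then have "word_height w G = (\<Sum>m\<in>G. (if w m = L then 1 else 0) - (if w m = R then 1 else 0))"
    by (simp add: word_height_def)
  also have "\<dots> = (\<Sum>m\<in>G. if w m = L then 1 else 0) - (\<Sum>m\<in>G. if w m = R then 1 else 0)"
    by (rule sum_subtractf)
  finally show ?thesis
    using assms by (simp add: sum.If_cases Int_def)
qed

text \<open>Partners inject the letters \<open>R\<close> into the letters \<open>L\<close>. The
  relation \<open>A\<close> is left open because it is applied both to the arcs of a word and to the
  pairs of a given matching.\<close>

lemma word_height_nonneg:
  assumes "finite G" "\<And>j. j \<in> G \<Longrightarrow> w j = R \<Longrightarrow> \<exists>i\<in>G. w i = L \<and> A i j"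
    and "\<And>i j j'. A i j \<Longrightarrow> A i j' \<Longrightarrow> j = j'"
  shows "word_height w G \<ge> 0"
proof -
  obtain f where f: "\<And>j. j \<in> G \<Longrightarrow> w j = R \<Longrightarrow> f j \<in> G \<and> w (f j) = L \<and> A (f j) j"
    using assms(2) by metis
  have "inj_on f {m\<in>G. w m = R}"
    by (rule inj_onI) (metis (mono_tags, lifting) assms(3) f mem_Collect_eq)
  moreover have "f ` {m\<in>G. w m = R} \<subseteq> {m\<in>G. w m = L}" using f by auto
  ultimately have "card {m\<in>G. w m = R} \<le> card {m\<in>G. w m = L}"
    using assms(1) by (intro card_inj_on_le[of f]) auto
  then show ?thesis using word_height_eq_card[OF assms(1)] by simp
qed

lemma word_height_nonpos:
  assumes "finite G" "\<And>i. i \<in> G \<Longrightarrow> w i = L \<Longrightarrow> \<exists>j\<in>G. w j = R \<and> A i j"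
    and "\<And>i i' j. A i j \<Longrightarrow> A i' j \<Longrightarrow> i = i'"
  shows "word_height w G \<le> 0"
proof -
  obtain f where f: "\<And>j. j \<in> G \<Longrightarrow> w j = L \<Longrightarrow> f j \<in> G \<and> w (f j) = R \<and> A j (f j)"
    using assms(2) by metis
  have "inj_on f {m\<in>G. w m = L}"
    by (rule inj_onI) (metis (mono_tags, lifting) assms(3) f mem_Collect_eq)
  moreover have "f ` {m\<in>G. w m = L} \<subseteq> {m\<in>G. w m = R}" using f by auto
  ultimately have "card {m\<in>G. w m = L} \<le> card {m\<in>G. w m = R}"
    using assms(1) by (intro card_inj_on_le[of f]) auto
  then show ?thesis using word_height_eq_card[OF assms(1)] by simp
qed

lemma matchable_partner:
  assumes "matchable w"
  shows "w i = L \<Longrightarrow> \<exists>j. is_arc w i j" "w j = R \<Longrightarrow> \<exists>i. is_arc w i j"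
  using assms is_arc_letters unfolding matchable_def by (metis letter.distinct(1))+

text \<open>The partner of an \<open>R\<close> in a prefix of \<open>G\<close> lies to its left and
  in \<open>G\<close>, hence in the same prefix. So no prefix has more \<open>R\<close> than
  \<open>L\<close>, and the reverse injection balances the whole of \<open>G\<close>.\<close>

lemma dyck_closed:
  assumes "matchable w" "finite G" "\<And>i j. is_arc w i j \<Longrightarrow> i \<in> G \<longleftrightarrow> j \<in> G"
  shows "dyck w G"
  unfolding dyck_def
proof (intro conjI allI antisym)
  have 1: "\<exists>i\<in>G \<inter> {..t}. w i = L \<and> is_arc w i j" if "j \<in> G \<inter> {..t}" "w j = R" for j t
  proof -
    obtain i where i: "is_arc w i j" using matchable_partner(2)[OF assms(1)] \<open>w j = R\<close> by blast
    show ?thesis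
      using that assms(3)[OF i] is_arc_less[OF i] is_arc_letters[OF i] i by (intro bexI[of _ i]) auto
  qed
  show "0 \<le> word_height w (G \<inter> {..t})" for t
    by (rule word_height_nonneg[where A = "is_arc w"]) (use 1 assms(2) is_arc_right_unique in auto)
  show "word_height w G \<le> 0"
  proof (rule word_height_nonpos[where A = "is_arc w"])
    fix i assume "i \<in> G" "w i = L"
    then show "\<exists>j\<in>G. w j = R \<and> is_arc w i j"
      using assms(3) matchable_partner(1)[OF assms(1)] is_arc_letters(2) by meson
  qed (use assms(2) is_arc_left_unique in auto)
  show "0 \<le> word_height w G"
  proof (rule word_height_nonneg[where A = "is_arc w"])
    fix j assume "j \<in> G" "w j = R"
    then show "\<exists>i\<in>G. w i = L \<and> is_arc w i j"
      using assms(3) matchable_partner(2)[OF assms(1)] is_arc_letters(1) by meson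
  qed (use assms(2) is_arc_right_unique in auto)
qed

lemma noncrossing_matching_partner:
  assumes "noncrossing_matching V P" "x \<in> V"
  obtains y where "y \<noteq> x" "{x, y} \<in> P" "y \<in> V"
proof -
  have "x \<in> \<Union>P" using assms by (auto simp: noncrossing_matching_def partition_on_def)
  then obtain p where p: "p \<in> P" "x \<in> p" by auto
  obtain a b where "a < b" "p = {a, b}" "a \<in> V" "b \<in> V"
    using noncrossing_matchingE[OF assms(1) p(1)] by metis
  then show ?thesis using p that by (metis doubleton_eq_iff empty_iff insert_iff less_irrefl)
qed

lemma noncrossing_matching_partner_unique:
  assumes "noncrossing_matching V P" "{x, y} \<in> P" "{x, z} \<in> P"
  shows "y = z"
proof -
  have "{x, y} = {x, z}" using noncrossing_matching_unique[OF assms, of x] by simp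
  then show ?thesis by (auto simp: doubleton_eq_iff)
qed

lemma noncrossing_matching_pair:
  assumes "noncrossing_matching V P" "{x, y} \<in> P"
  shows "x \<noteq> y" "x \<in> V" "y \<in> V"
proof -
  obtain a b where "a < b" "{x, y} = {a, b}" "a \<in> V" "b \<in> V"
    using noncrossing_matchingE[OF assms] by metis
  then show "x \<noteq> y" "x \<in> V" "y \<in> V" by (auto simp: doubleton_eq_iff)
qed

lemma noncrossing_matching_between:
  fixes i j m m' :: "'a::linorder"
  assumes "noncrossing_matching V P" "{i, j} \<in> P" "{m, m'} \<in> P" "i < m" "m < j"
  shows "i < m' \<and> m' < j"
proof -
  have nc: "\<not> (a < b \<and> b < c \<and> c < d \<and> {a, c} \<in> P \<and> {b, d} \<in> P)" for a b c d
    using assms(1) unfolding noncrossing_matching_def noncrossing_def by blast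
  have ne: "m' \<noteq> i" "m' \<noteq> j"
    using noncrossing_matching_unique[OF assms(1-3)] assms(4,5) by (auto simp: doubleton_eq_iff)
  show ?thesis
    using nc[of m' i m j] nc[of i m j m'] assms ne by (metis insert_commute linorder_neqE)
qed

text \<open>\<open>G\<close> is a disjoint union of pairs. The parity statements about gaps and
  faces all come from choosing a suitable closed set \<open>G\<close>.\<close>

lemma noncrossing_matching_even_card:
  assumes "noncrossing_matching V P" "finite G" "G \<subseteq> V"
    and "\<And>x y. {x, y} \<in> P \<Longrightarrow> x \<in> G \<Longrightarrow> y \<in> G"
  shows "even (card G)"
proof -
  define Q where "Q = {p\<in>P. p \<subseteq> G}"
  have "\<Union>Q = G"
  proof (intro equalityI subsetI)
    fix x assume "x \<in> G"
    then obtain y where "{x, y} \<in> P" using noncrossing_matching_partner[OF assms(1)] assms(3) by blast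
    then show "x \<in> \<Union>Q" using assms(4) \<open>x \<in> G\<close> by (auto simp: Q_def)
  qed (auto simp: Q_def)
  moreover have "finite Q" using assms(2) by (rule_tac finite_subset[of Q "Pow G"]) (auto simp: Q_def)
  moreover have "card q = 2" if "q \<in> Q" for q
    using that assms(1) by (auto simp: Q_def noncrossing_matching_def)
  moreover have "p \<inter> q = {}" if "p \<in> Q" "q \<in> Q" "p \<noteq> q" for p q
    using noncrossing_matching_unique[OF assms(1)] that unfolding Q_def by blast
  ultimately have "2 * card Q = card G" using assms(2) card_partition[of Q 2] by simp
  then show ?thesis by presburger
qed

section \<open>Existence and uniqueness of the matching of a word\<close>

lemma matches_word_letters:
  assumes "matches_word w P" "{i, j} \<in> P" "i < j"
  shows "w i = L" "w j = R"
proof -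
  have "Min {i, j} = i" using assms(3) by simp
  moreover have "\<forall>m\<in>{i, j}. m = Min {i, j} \<longleftrightarrow> w m = L"
    using assms(1,2) unfolding matches_word_def by blast
  ultimately have "w i = L" "w j \<noteq> L" using assms(3) by auto
  then show "w i = L" "w j = R" by (auto intro: letter.exhaust)
qed

text \<open>Pairs meeting \<open>{i..j}\<close> stay inside, so the two injections force height 0. A
  prefix of the interior contains the left partner of each of its \<open>R\<close>, so its height is
  nonnegative, and the \<open>L\<close> at \<open>i\<close> makes the total positive. Any matching
  of \<open>w\<close> is thus forced to use first returns.\<close>

lemma matches_word_is_arc:
  assumes "matches_word w P" "{i, j} \<in> P" "i < j"
  shows "is_arc w i j"
proof -
  have P: "noncrossing_matching UNIV P" using assms(1) by (simp add: matches_word_def)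
  define A where "A m n \<longleftrightarrow> m < n \<and> {m, n} \<in> P" for m n
  have uniq: "A m n \<Longrightarrow> A m n' \<Longrightarrow> n = n'" "A m n \<Longrightarrow> A m' n \<Longrightarrow> m = m'" for m n m' n'
    using noncrossing_matching_partner_unique[OF P] unfolding A_def by (metis insert_commute)+
  have R: "\<exists>i. A i j \<and> w i = L" if "w j = R" for j
    using noncrossing_matching_partner[OF P, of j] matches_word_letters[OF assms(1)] that
    unfolding A_def by (metis UNIV_I insert_commute letter.distinct(1) linorder_neqE)
  have L: "\<exists>j. A i j \<and> w j = R" if "w i = L" for i
    using noncrossing_matching_partner[OF P, of i] matches_word_letters[OF assms(1)] that
    unfolding A_def by (metis UNIV_I insert_commute letter.distinct(1) linorder_neqE)
  have btw: "i < m' \<and> m' < j" if "A m m' \<or> A m' m" "i < m" "m < j" for m m'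
    using noncrossing_matching_between[OF P assms(2), of m m'] that
    unfolding A_def by (metis insert_commute)
  have Aij: "A i j" using assms by (simp add: A_def)
  have "word_height w {i..j} \<ge> 0"
  proof (rule word_height_nonneg[where A = A])
    fix n assume n: "n \<in> {i..j}" "w n = R"
    obtain m where m: "A m n" "w m = L" using R n by blast
    show "\<exists>m\<in>{i..j}. w m = L \<and> A m n"
    proof (cases "n = j")
      case True
      then show ?thesis using m Aij uniq(2)[OF m(1)] assms(3) by (intro bexI[of _ m]) auto
    next
      case False
      have "n \<noteq> i" using matches_word_letters[OF assms] n by auto
      then show ?thesis using m btw[of n m] n False by (intro bexI[of _ m]) auto
    qed
  qed (use uniq in auto)
  moreover have "word_height w {i..j} \<le> 0"
  proof (rule word_height_nonpos[where A = A])
    fix n assume n: "n \<in> {i..j}" "w n = L"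
    obtain m where m: "A n m" "w m = R" using L n by blast
    show "\<exists>m\<in>{i..j}. w m = R \<and> A n m"
    proof (cases "n = i")
      case True
      then show ?thesis using m Aij uniq(1)[OF m(1)] assms(3) by (intro bexI[of _ m]) auto
    next
      case False
      have "n \<noteq> j" using matches_word_letters[OF assms] n by auto
      then show ?thesis using m btw[of n m] n False by (intro bexI[of _ m]) auto
    qed
  qed (use uniq in auto)
  moreover have "word_height w {i..t} > 0" if t: "i \<le> t" "t < j" for t
  proof -
    have "word_height w {i+1..t} \<ge> 0"
    proof (rule word_height_nonneg[where A = A])
      fix n assume n: "n \<in> {i+1..t}" "w n = R"
      obtain m where m: "A m n" "w m = L" using R n by blast
      then have "i < m" "m < n" using btw[of n m] n t by (auto simp: A_def)
      then show "\<exists>m\<in>{i+1..t}. w m = L \<and> A m n" using m n by (intro bexI[of _ m]) auto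
    qed (use uniq in auto)
    moreover have "word_height w {i..t} = word_height w {i..i} + word_height w {i+1..t}"
      using t by (intro word_height_split) auto
    ultimately show ?thesis using matches_word_letters[OF assms] by simp
  qed
  ultimately show ?thesis using assms(3) by (auto simp: is_arc_def)
qed

lemma matches_word_arc_set:
  assumes "matchable w"
  shows "matches_word w (arc_set w)"
proof -
  have mem: "\<exists>i j. i < j \<and> p = {i, j} \<and> is_arc w i j" if "p \<in> arc_set w" for p
    using that is_arc_less unfolding arc_set_def by blast
  have "partition_on UNIV (arc_set w)"
    unfolding partition_on_def
  proof (intro conjI)
    show "\<Union>(arc_set w) = UNIV"
      using assms unfolding matchable_def arc_set_def by blast
    show "disjoint (arc_set w)"
    proof (rule disjointI)
      fix p q assume pq: "p \<in> arc_set w" "q \<in> arc_set w" "p \<noteq> q"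
      obtain i j where p: "p = {i, j}" "is_arc w i j" using mem[OF pq(1)] by blast
      obtain k l where q: "q = {k, l}" "is_arc w k l" using mem[OF pq(2)] by blast
      have "i \<noteq> k" "j \<noteq> l" using is_arc_right_unique is_arc_left_unique p q pq(3) by blast+
      moreover have "i \<noteq> l" "j \<noteq> k"
        using is_arc_letters[OF p(2)] is_arc_letters[OF q(2)] by auto
      ultimately show "p \<inter> q = {}" using p q by auto
    qed
  qed (auto simp: arc_set_def)
  moreover have "\<forall>p\<in>arc_set w. card p = 2" using mem by fastforce
  moreover have "noncrossing (arc_set w)"
    unfolding noncrossing_def doubleton_in_arc_set
    by (metis is_arc_less is_arc_noncrossing less_trans order_less_asym)
  moreover have "i = Min p \<longleftrightarrow> w i = L" if "p \<in> arc_set w" "i \<in> p" for p i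
  proof -
    obtain a b where ab: "a < b" "p = {a, b}" "is_arc w a b" using mem \<open>p \<in> arc_set w\<close> by blast
    then show ?thesis using that is_arc_letters[OF ab(3)] by auto
  qed
  ultimately show ?thesis unfolding matches_word_def noncrossing_matching_def by blast
qed

text \<open>Every pair of the given matching is an arc, and a matching contained in another matching
  of the same set equals it.\<close>

lemma matches_word_imp:
  assumes "matches_word w P"
  shows "matchable w" "P = arc_set w"
proof -
  have P: "noncrossing_matching UNIV P" using assms by (simp add: matches_word_def)
  show m: "matchable w"
    unfolding matchable_def
  proof
    fix i
    obtain j where j: "j \<noteq> i" "{i, j} \<in> P"
      using noncrossing_matching_partner[OF P, of i] by blast
    then show "\<exists>j. is_arc w i j \<or> is_arc w j i"
      using matches_word_is_arc[OF assms] by (metis insert_commute linorder_neqE)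
  qed
  have Q: "noncrossing_matching UNIV (arc_set w)"
    using matches_word_arc_set[OF m] by (simp add: matches_word_def)
  have sub: "P \<subseteq> arc_set w"
  proof
    fix p assume "p \<in> P"
    then obtain a b where "a < b" "p = {a, b}" using noncrossing_matchingE[OF P] by metis
    then show "p \<in> arc_set w"
      using matches_word_is_arc[OF assms] \<open>p \<in> P\<close> by (auto simp: doubleton_in_arc_set)
  qed
  show "P = arc_set w"
  proof (rule antisym[OF sub], rule subsetI)
    fix q assume q: "q \<in> arc_set w"
    then obtain a b where "a < b" "q = {a, b}" using noncrossing_matchingE[OF Q] by metis
    moreover obtain c where "{a, c} \<in> P" using noncrossing_matching_partner[OF P, of a] by blast
    ultimately show "q \<in> P"
      using noncrossing_matching_partner_unique[OF Q] sub q by (metis subsetD)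
  qed
qed

text \<open>The definite description disappears here: the uniqueness test in
  \<open>word_matching\<close> succeeds exactly for the \<open>matchable\<close> words, a condition
  whose measurability is accessible.\<close>

lemma word_matching_eq: "word_matching w = (if matchable w then arc_set w else {})"
proof (cases "matchable w")
  case True
  then have "matches_word w = (\<lambda>P. P = arc_set w)"
    using matches_word_arc_set matches_word_imp by blast
  then show ?thesis using True by (simp add: word_matching_def)
next
  case False
  then show ?thesis using matches_word_imp(1) by (auto simp: word_matching_def)
qed


section \<open>Counting Dyck words\<close>

text \<open>Positions outside \<open>G\<close> carry \<open>undefined\<close>, which makes the set
  finite. Arbitrary finite \<open>G\<close> are allowed, so scattered positions are counted without
  renumbering.\<close>

definition ballot_words :: "int set \<Rightarrow> nat \<Rightarrow> nat \<Rightarrow> (int \<Rightarrow> letter) set" where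
  "ballot_words G a b = {v \<in> G \<rightarrow>\<^sub>E UNIV. card {m\<in>G. v m = L} = a \<and> card {m\<in>G. v m = R} = b \<and>
     (\<forall>t. word_height v (G \<inter> {..t}) \<ge> 0)}"

text \<open>The value predicted by the reflection principle. The case \<open>b = 0\<close> is
  separated because \<open>b - 1\<close> truncates to 0 in \<open>nat\<close>.\<close>

definition ballot_number :: "nat \<Rightarrow> nat \<Rightarrow> int" where
  "ballot_number a b = int ((a + b) choose b) - (if b = 0 then 0 else int ((a + b) choose (b - 1)))"

lemma finite_ballot_words: "finite G \<Longrightarrow> finite (ballot_words G a b)"
  by (rule finite_subset[of _ "G \<rightarrow>\<^sub>E UNIV"])
    (auto simp: ballot_words_def intro!: finite_PiE finite_subset[of UNIV "{L, R}"] intro: letter.exhaust)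

lemma word_height_cong: "(\<And>m. m \<in> S \<Longrightarrow> v m = w m) \<Longrightarrow> word_height v S = word_height w S"
  unfolding word_height_def by (intro sum.cong) auto

lemma ballot_words_empty:
  assumes "finite G" "a < b"
  shows "ballot_words G a b = {}"
proof (rule ccontr)
  assume "ballot_words G a b \<noteq> {}"
  then obtain v where v: "card {m\<in>G. v m = L} = a" "card {m\<in>G. v m = R} = b"
      "\<And>t. word_height v (G \<inter> {..t}) \<ge> 0"
    by (auto simp: ballot_words_def)
  obtain t where "\<forall>x\<in>G. x \<le> t" using assms(1) by (metis Max_ge)
  then have "G \<inter> {..t} = G" by auto
  then show False using v(3)[of t] word_height_eq_card[OF assms(1), of v] v(1,2) assms(2) by simp
qed

text \<open>The new position is the last one, so earlier prefixes are unchanged; the only new prefix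
  is the whole word, whose height is nonnegative by \<open>b \<le> a\<close>.\<close>

lemma ballot_words_insert:
  assumes "finite G" "\<And>x. x \<in> G \<Longrightarrow> x < m" "b \<le> a"
    and c: "(c = L \<and> a = Suc a' \<and> b = b') \<or> (c = R \<and> a = a' \<and> b = Suc b')"
  shows "(\<lambda>v. v(m := c)) ` ballot_words G a' b' \<subseteq> ballot_words (insert m G) a b"
proof
  fix v' assume "v' \<in> (\<lambda>v. v(m := c)) ` ballot_words G a' b'"
  then obtain v where v: "v \<in> ballot_words G a' b'" "v' = v(m := c)" by auto
  have m: "m \<notin> G" using assms(2) by blast
  have ext: "v' \<in> insert m G \<rightarrow>\<^sub>E UNIV" using v by (auto simp: ballot_words_def PiE_def extensional_def)
  have 1: "{x\<in>insert m G. v' x = d} = (if d = c then insert m else id) {x\<in>G. v x = d}" for d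
    using m v(2) by auto
  have cards: "card {x\<in>insert m G. v' x = L} = a" "card {x\<in>insert m G. v' x = R} = b"
    using c v(1) m assms(1) unfolding 1 by (auto simp: ballot_words_def)
  have "word_height v' (insert m G \<inter> {..t}) \<ge> 0" for t
  proof (cases "m \<le> t")
    case True
    then have "insert m G \<inter> {..t} = insert m G" using assms(2) by (auto intro: less_imp_le less_le_trans)
    then show ?thesis using word_height_eq_card[of "insert m G" v'] cards assms by simp
  next
    case False
    then have "insert m G \<inter> {..t} = G \<inter> {..t}" by auto
    moreover have "word_height v' (G \<inter> {..t}) = word_height v (G \<inter> {..t})"
      using m v(2) by (intro word_height_cong) auto
    ultimately show ?thesis using v(1) by (auto simp: ballot_words_def)
  qed
  then show "v' \<in> ballot_words (insert m G) a b" using ext cards by (auto simp: ballot_words_def)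
qed

lemma ballot_words_restrict:
  assumes "finite G" "\<And>x. x \<in> G \<Longrightarrow> x < m" "v \<in> ballot_words (insert m G) a b"
  shows "v m = L \<Longrightarrow> \<exists>a'. a = Suc a' \<and> v \<in> (\<lambda>v. v(m := L)) ` ballot_words G a' b"
    and "v m = R \<Longrightarrow> \<exists>b'. b = Suc b' \<and> v \<in> (\<lambda>v. v(m := R)) ` ballot_words G a b'"
proof -
  define u where "u = v(m := undefined)"
  have m: "m \<notin> G" using assms(2) by blast
  have ext: "u \<in> G \<rightarrow>\<^sub>E UNIV" using assms(3) by (auto simp: ballot_words_def PiE_def extensional_def u_def)
  have "{x\<in>G. u x = d} = {x\<in>G. v x = d}" for d using m by (auto simp: u_def)
  moreover have "{x\<in>insert m G. v x = d} = (if v m = d then insert m else id) {x\<in>G. v x = d}" for d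
    by auto
  ultimately have 1: "card {x\<in>insert m G. v x = d} = (if v m = d then 1 else 0) + card {x\<in>G. u x = d}" for d
    using m assms(1) by auto
  have h: "word_height u (G \<inter> {..t}) \<ge> 0" for t
  proof -
    \<comment> \<open>Cutting at \<open>min t (m - 1)\<close> keeps the prefix in front of
      \<open>m\<close>, where \<open>u\<close> and \<open>v\<close> agree.\<close>
    have "word_height u (G \<inter> {..t}) = word_height v (G \<inter> {..min t (m - 1)})"
    proof -
      have "x \<le> min t (m - 1)" if "x \<in> G" "x \<le> t" for x using assms(2)[OF that(1)] that(2) by simp
      then have "G \<inter> {..t} = G \<inter> {..min t (m - 1)}" by auto
      moreover have "u x = v x" if "x \<in> G" for x using m that by (auto simp: u_def)
      ultimately show ?thesis using word_height_cong[of "G \<inter> {..min t (m - 1)}" u v] by auto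
    qed
    also have "G \<inter> {..min t (m - 1)} = insert m G \<inter> {..min t (m - 1)}" by auto
    finally have "word_height u (G \<inter> {..t}) = word_height v (insert m G \<inter> {..min t (m - 1)})" .
    also have "\<dots> \<ge> 0" using assms(3) unfolding ballot_words_def by blast
    finally show ?thesis .
  qed
  have v_eq: "v = u(m := v m)" by (simp add: u_def)
  have v_cards: "card {x\<in>insert m G. v x = L} = a" "card {x\<in>insert m G. v x = R} = b"
    using assms(3) by (auto simp: ballot_words_def)
  show "\<exists>a'. a = Suc a' \<and> v \<in> (\<lambda>v. v(m := L)) ` ballot_words G a' b" if "v m = L"
  proof (intro exI conjI image_eqI)
    show "a = Suc (card {x\<in>G. u x = L})" using v_cards 1 that by simp
    show "u \<in> ballot_words G (card {x\<in>G. u x = L}) b"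
      using ext h v_cards 1 that by (simp add: ballot_words_def)
  qed (use v_eq that in simp)
  show "\<exists>b'. b = Suc b' \<and> v \<in> (\<lambda>v. v(m := R)) ` ballot_words G a b'" if "v m = R"
  proof (intro exI conjI image_eqI)
    show "b = Suc (card {x\<in>G. u x = R})" using v_cards 1 that by simp
    show "u \<in> ballot_words G a (card {x\<in>G. u x = R})"
      using ext h v_cards 1 that by (simp add: ballot_words_def)
  qed (use v_eq that in simp)
qed

lemma card_update_image:
  assumes "m \<notin> G" "A \<subseteq> G \<rightarrow>\<^sub>E UNIV"
  shows "card ((\<lambda>v. v(m := c)) ` A) = card A"
proof (rule card_image, rule inj_onI)
  fix u v assume uv: "u \<in> A" "v \<in> A" "u(m := c) = v(m := c)"
  show "u = v"
  proof
    fix x show "u x = v x"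
    proof (cases "x = m")
      case True
      have "u \<in> G \<rightarrow>\<^sub>E UNIV" "v \<in> G \<rightarrow>\<^sub>E UNIV" using uv(1,2) assms(2) by auto
      then have "u m = undefined" "v m = undefined" using assms(1) by (auto intro: PiE_arb)
      then show ?thesis using True by simp
    next
      case False
      then show ?thesis using uv(3) by (metis fun_upd_other)
    qed
  qed
qed

text \<open>The words are classified by their letter at the last position \<open>m\<close>.\<close>

lemma card_ballot_words_insert:
  assumes "finite G" "\<And>x. x \<in> G \<Longrightarrow> x < m" "b \<le> a"
  shows "card (ballot_words (insert m G) a b) =
    (if a = 0 then 0 else card (ballot_words G (a - 1) b)) +
    (if b = 0 then 0 else card (ballot_words G a (b - 1)))"
proof -
  define X where "X = (if a = 0 then {} else (\<lambda>v. v(m := L)) ` ballot_words G (a - 1) b)"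
  define Y where "Y = (if b = 0 then {} else (\<lambda>v. v(m := R)) ` ballot_words G a (b - 1))"
  have "X \<subseteq> ballot_words (insert m G) a b"
    using ballot_words_insert[OF assms(1,2,3), where c = L and a' = "a - 1" and b' = b]
    unfolding X_def by auto
  moreover have "Y \<subseteq> ballot_words (insert m G) a b"
    using ballot_words_insert[OF assms(1,2,3), where c = R and a' = a and b' = "b - 1"]
    unfolding Y_def by auto
  moreover have "ballot_words (insert m G) a b \<subseteq> X \<union> Y"
  proof
    fix v assume v: "v \<in> ballot_words (insert m G) a b"
    show "v \<in> X \<union> Y"
      using ballot_words_restrict[OF assms(1,2) v] by (cases "v m") (auto simp: X_def Y_def)
  qed
  ultimately have "ballot_words (insert m G) a b = X \<union> Y" by blast
  moreover have "X \<inter> Y = {}"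
  proof -
    have "v m = L" if "v \<in> X" for v using that by (auto simp: X_def split: if_splits)
    moreover have "v m = R" if "v \<in> Y" for v using that by (auto simp: Y_def split: if_splits)
    ultimately show ?thesis by force
  qed
  moreover have "m \<notin> G" using assms(2) by blast
  then have "card X = (if a = 0 then 0 else card (ballot_words G (a - 1) b))"
      "card Y = (if b = 0 then 0 else card (ballot_words G a (b - 1)))"
    unfolding X_def Y_def by (auto intro!: card_update_image simp: ballot_words_def)
  moreover have "finite X" "finite Y" using finite_ballot_words[OF assms(1)] by (auto simp: X_def Y_def)
  ultimately show ?thesis by (simp add: card_Un_disjoint)
qed

lemma ballot_number_rec:
  assumes "b \<le> a" "0 < a"
  shows "ballot_number a b = ballot_number (a - 1) b + (if b = 0 then 0 else ballot_number a (b - 1))"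
proof -
  obtain a' where a: "a = Suc a'" using assms(2) by (cases a) auto
  show ?thesis
  proof (cases b)
    case 0
    then show ?thesis by (simp add: ballot_number_def a)
  next
    case (Suc b')
    then show ?thesis
      by (cases b') (simp_all add: ballot_number_def a)
  qed
qed

lemma ballot_number_zero: "ballot_number a (Suc a) = 0"
  using binomial_symmetric[of a "a + Suc a"] by (simp add: ballot_number_def)

text \<open>The range includes the line \<open>b = a + 1\<close>, where both sides vanish: removing
  a final \<open>L\<close> from the case \<open>a = b\<close> leads there, so the induction
  hypothesis must cover it.\<close>

lemma card_ballot_words:
  assumes "finite G" "card G = a + b" "b \<le> a + 1"
  shows "int (card (ballot_words G a b)) = ballot_number a b"
  using assms
proof (induction G arbitrary: a b rule: finite_linorder_max_induct)
  case empty
  then have "ballot_words {} a b = {\<lambda>_. undefined}"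
    by (auto simp: ballot_words_def)
  then show ?case using empty by (simp add: ballot_number_def)
next
  case (insert m G)
  have m: "m \<notin> G" using insert by auto
  show ?case
  proof (cases "b = a + 1")
    case True
    then show ?thesis using ballot_words_empty[of "insert m G" a b] insert ballot_number_zero by simp
  next
    case False
    then have ba: "b \<le> a" using insert by simp
    have c: "card G + 1 = a + b" using insert m by simp
    then have a: "0 < a" using ba by simp
    have "int (card (ballot_words G (a - 1) b)) = ballot_number (a - 1) b"
      using insert.IH[of "a - 1" b] c a ba by simp
    moreover have "int (card (ballot_words G a (b - 1))) = ballot_number a (b - 1)" if "b \<noteq> 0"
      using insert.IH[of a "b - 1"] c a ba that by simp
    moreover have "card (ballot_words (insert m G) a b) = card (ballot_words G (a - 1) b) +
       (if b = 0 then 0 else card (ballot_words G a (b - 1)))"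
      using card_ballot_words_insert[of G m b a] insert ba a by simp
    ultimately show ?thesis using ballot_number_rec[OF ba a] by simp
  qed
qed

text \<open>With \<open>n = Suc m\<close>, the ratio of \<open>(2 * n) choose m\<close> to
  \<open>(2 * n) choose n\<close> is \<open>n / (n + 1)\<close>, which turns the difference of the
  two into the Catalan number.\<close>

lemma ballot_number_catalan: "real_of_int (ballot_number n n) = catalan n"
proof (cases n)
  case 0
  then show ?thesis by (simp add: ballot_number_def catalan_def)
next
  case (Suc m)
  have e: "Suc (m + Suc m) = 2 * n" using Suc by simp
  have "(n + 1) * ((2 * n) choose m) = n * ((2 * n) choose n)"
    using Suc_times_binomial_add[of m "Suc m", unfolded e, folded Suc] by simp
  then have "(real n + 1) * real ((2 * n) choose m) = real n * real ((2 * n) choose n)"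
    by (metis of_nat_1 of_nat_add of_nat_mult)
  moreover have "B - D = B / (real n + 1)" if "(real n + 1) * D = real n * B" for B D :: real
  proof -
    have "(real n + 1) * (B - D) = B" using that by (simp add: algebra_simps)
    then show ?thesis by (simp add: eq_divide_eq mult.commute)
  qed
  ultimately have "real ((2 * n) choose n) - real ((2 * n) choose m) = real ((2 * n) choose n) / (real n + 1)"
    by blast
  then show ?thesis using Suc
    by (simp add: ballot_number_def catalan_def mult_2)
qed

lemma card_dyck:
  assumes "finite G" "card G = 2 * n"
  shows "real (card {v \<in> G \<rightarrow>\<^sub>E UNIV. dyck v G}) = catalan n"
proof -
  have "{v \<in> G \<rightarrow>\<^sub>E UNIV. dyck v G} = ballot_words G n n"
  proof -
    have "word_height v G = 0 \<longleftrightarrow> card {m\<in>G. v m = L} = n \<and> card {m\<in>G. v m = R} = n" for v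
    proof -
      have "v m = L \<or> v m = R" for m by (cases "v m") auto
      then have "{m\<in>G. v m = L} \<union> {m\<in>G. v m = R} = G" by blast
      moreover have "{m\<in>G. v m = L} \<inter> {m\<in>G. v m = R} = {}" by auto
      ultimately have "card {m\<in>G. v m = L} + card {m\<in>G. v m = R} = 2 * n"
        using assms card_Un_disjoint[of "{m\<in>G. v m = L}" "{m\<in>G. v m = R}"] by simp
      then show ?thesis using word_height_eq_card[OF assms(1), of v] by auto
    qed
    then show ?thesis by (auto simp: ballot_words_def dyck_def)
  qed
  moreover have "int (card (ballot_words G n n)) = ballot_number n n"
    by (rule card_ballot_words) (use assms in auto)
  then have "real (card (ballot_words G n n)) = catalan n"
    using ballot_number_catalan[of n] by (metis of_int_of_nat_eq)
  ultimately show ?thesis by (simp only:)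
qed

lemma dyck_cong:
  assumes "\<And>m. m \<in> G \<Longrightarrow> v m = w m"
  shows "dyck v G \<longleftrightarrow> dyck w G"
proof -
  have 1: "word_height v (G \<inter> T) = word_height w (G \<inter> T)" for T
    by (rule word_height_cong) (use assms in auto)
  have 2: "word_height v G = word_height w G"
    by (rule word_height_cong) (use assms in auto)
  show ?thesis unfolding dyck_def 1 2 ..
qed


section \<open>Sites and gaps\<close>

text \<open>The vertex \<open>i\<close> of a meander is placed at \<open>site l i\<close>; the gap after it contains \<open>2 * l i\<close> sites.\<close>

definition site :: "(nat \<Rightarrow> nat) \<Rightarrow> nat \<Rightarrow> int" where
  "site l i = (\<Sum>j<i. 2 * int (l j) + 1)"

definition gap :: "(nat \<Rightarrow> nat) \<Rightarrow> nat \<Rightarrow> int set" where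
  "gap l i = {site l i<..<site l (Suc i)}"

definition gaps :: "(nat \<Rightarrow> nat) \<Rightarrow> nat set set \<Rightarrow> nat set \<Rightarrow> int set" where
  "gaps l U p = (\<Union>i\<in>arc_indices U p. gap l i)"

text \<open>All positions read by the event of the arc \<open>p\<close>; disjointness of the blocks
  yields independence of the events.\<close>

definition block :: "(nat \<Rightarrow> nat) \<Rightarrow> nat set set \<Rightarrow> nat set \<Rightarrow> int set" where
  "block l U p = {site l (Min p), site l (Max p)} \<union> gaps l U p"

lemma site_0 [simp]: "site l 0 = 0"
  by (simp add: site_def)

lemma site_Suc: "site l (Suc i) = site l i + 2 * int (l i) + 1"
  by (simp add: site_def)

lemma strict_mono_site: "strict_mono (site l)"
  by (rule strict_mono_Suc_iff[THEN iffD2]) (simp add: site_Suc)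

lemma site_less_iff [simp]: "site l i < site l j \<longleftrightarrow> i < j"
  by (rule strict_mono_less[OF strict_mono_site])

lemma site_le_iff [simp]: "site l i \<le> site l j \<longleftrightarrow> i \<le> j"
  by (rule strict_mono_less_eq[OF strict_mono_site])

lemma site_eq_iff [simp]: "site l i = site l j \<longleftrightarrow> i = j"
  by (rule strict_mono_eq[OF strict_mono_site])

lemma inj_site: "inj (site l)"
  by (simp add: inj_def)

lemma card_gap: "card (gap l i) = 2 * l i"
  by (simp add: gap_def site_Suc)

lemma gap_disjoint: "i \<noteq> j \<Longrightarrow> gap l i \<inter> gap l j = {}"
proof -
  assume "i \<noteq> j"
  then consider "Suc i \<le> j" | "Suc j \<le> i" by linarith
  then show ?thesis
  proof cases
    case 1
    then have "site l (Suc i) \<le> site l j" by simp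
    then show ?thesis by (auto simp: gap_def)
  next
    case 2
    then have "site l (Suc j) \<le> site l i" by simp
    then show ?thesis by (auto simp: gap_def)
  qed
qed

lemma site_notin_gap: "site l j \<notin> gap l i"
  by (auto simp: gap_def)

lemma site_notin_gaps: "site l j \<notin> gaps l U p"
  by (auto simp: gaps_def site_notin_gap)

lemma site_or_gap:
  assumes "site l a \<le> m" "m < site l b"
  obtains i where "a \<le> i" "i < b" "m = site l i \<or> m \<in> gap l i"
proof -
  have "a < b" using assms by (metis le_less_trans site_less_iff)
  have "\<exists>i. a \<le> i \<and> i < b \<and> (m = site l i \<or> m \<in> gap l i)" using \<open>a < b\<close> assms(2)
  proof (induction b)
    case (Suc b)
    show ?case
    proof (cases "m < site l b")
      case True
      then have "a < b" using assms(1) by (metis le_less_trans site_less_iff)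
      then show ?thesis using Suc True by (meson less_Suc_eq)
    next
      case False
      then show ?thesis using Suc by (intro exI[of _ b]) (auto simp: gap_def)
    qed
  qed simp
  then show ?thesis using that by blast
qed

lemma arc_indices_subset: "arc_indices U p \<subseteq> {Min p..<Max p}"
  by (auto simp: arc_indices_def)

lemma finite_arc_indices: "finite (arc_indices U p)"
  by (rule finite_subset[OF arc_indices_subset]) simp

lemma finite_gaps: "finite (gaps l U p)"
  by (simp add: gaps_def gap_def finite_arc_indices)

lemma card_gaps: "card (gaps l U p) = 2 * (\<Sum>i\<in>arc_indices U p. l i)"
proof -
  have "card (gaps l U p) = (\<Sum>i\<in>arc_indices U p. card (gap l i))"
    unfolding gaps_def
    by (rule card_UN_disjoint) (use gap_disjoint in \<open>auto simp: finite_arc_indices gap_def\<close>)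
  then show ?thesis by (simp add: card_gap sum_distrib_left)
qed

lemma gaps_bounds: "gaps l U p \<subseteq> {site l (Min p)<..<site l (Max p)}"
proof
  fix m assume "m \<in> gaps l U p"
  then obtain i where i: "i \<in> arc_indices U p" "site l i < m" "m < site l (Suc i)"
    by (auto simp: gaps_def gap_def)
  then have "Min p \<le> i" "Suc i \<le> Max p" by (auto simp: arc_indices_def)
  then have "site l (Min p) \<le> site l i" "site l (Suc i) \<le> site l (Max p)" by simp_all
  with i(2,3) have "site l (Min p) < m" "m < site l (Max p)" by linarith+
  then show "m \<in> {site l (Min p)<..<site l (Max p)}" by simp
qed

section \<open>Arcs of a finite matching placed at the sites of a word\<close>

locale finite_noncrossing =
  fixes V :: "nat set" and U :: "nat set set"
  assumes nm: "noncrossing_matching V U"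
begin

lemma Min_less_Max: "p \<in> U \<Longrightarrow> Min p < Max p"
  using noncrossing_matchingE[OF nm] by metis

lemma arc_eq: "p \<in> U \<Longrightarrow> p = {Min p, Max p}"
  using noncrossing_matchingE[OF nm] by metis

lemma gaps_disjoint:
  assumes "p \<in> U" "q \<in> U" "p \<noteq> q"
  shows "gaps l U p \<inter> gaps l U q = {}"
proof (rule ccontr)
  assume "gaps l U p \<inter> gaps l U q \<noteq> {}"
  then obtain m i j where "m \<in> gap l i" "m \<in> gap l j" "i \<in> arc_indices U p" "j \<in> arc_indices U q"
    by (auto simp: gaps_def)
  moreover from this have "i = j" using gap_disjoint[of i j l] by blast
  ultimately show False using arc_indices_disjoint[OF nm assms] by blast
qed

lemma block_disjoint:
  assumes "p \<in> U" "q \<in> U" "p \<noteq> q"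
  shows "block l U p \<inter> block l U q = {}"
proof -
  have "p \<inter> q = {}" using noncrossing_matching_unique[OF nm] assms by blast
  then have "Min p \<noteq> Min q" "Min p \<noteq> Max q" "Max p \<noteq> Min q" "Max p \<noteq> Max q"
    using arc_eq assms by blast+
  then show ?thesis
    using gaps_disjoint[OF assms, of l] by (auto simp: block_def site_notin_gaps)
qed

text \<open>A shortest arc over \<open>i\<close> among those weakly nested in \<open>p\<close> has
  no nested arc over \<open>i\<close>, which is the defining condition of
  \<open>arc_indices\<close>.\<close>

lemma innermost_arc:
  assumes fin: "finite U" and p: "p \<in> U" "Min p \<le> i" "i < Max p"
  obtains q where "q \<in> U" "Min p \<le> Min q" "Max q \<le> Max p" "i \<in> arc_indices U q"
proof -
  define Q where "Q = {q\<in>U. Min p \<le> Min q \<and> Max q \<le> Max p \<and> Min q \<le> i \<and> i < Max q}"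
  have Q: "finite Q" "Q \<noteq> {}" using fin p by (auto simp: Q_def)
  define q where "q = arg_min_on (\<lambda>q. Max q - Min q) Q"
  have q: "q \<in> Q" "\<And>r. r \<in> Q \<Longrightarrow> Max q - Min q \<le> Max r - Min r"
    unfolding q_def by (rule arg_min_if_finite(1)[OF Q], rule arg_min_least[OF Q])
  have "i \<in> arc_indices U q"
    unfolding arc_indices_def
  proof (intro CollectI conjI notI)
    assume "\<exists>r\<in>U. Min q < Min r \<and> Min r \<le> i \<and> i < Max r \<and> Max r < Max q"
    then obtain r where r: "r \<in> U" "Min q < Min r" "Min r \<le> i" "i < Max r" "Max r < Max q" by blast
    then have "r \<in> Q" using q(1) by (auto simp: Q_def)
    then show False using q(2)[of r] r by linarith
  qed (use q in \<open>auto simp: Q_def\<close>)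
  then show ?thesis using q(1) that by (auto simp: Q_def)
qed

text \<open>By laminarity, a vertex under \<open>p\<close> belongs to an arc weakly nested in
  \<open>p\<close>, and each gap belongs to the innermost arc over it. Heights over the interval can
  then be summed block by block.\<close>

lemma interval_eq_blocks:
  assumes fin: "finite U" and V: "\<Union>U = {0..<2*k}" and p: "p \<in> U"
  shows "{site l (Min p)..site l (Max p)} = (\<Union>q\<in>{q\<in>U. Min p \<le> Min q \<and> Max q \<le> Max p}. block l U q)"
proof (intro equalityI subsetI)
  fix m assume m: "m \<in> {site l (Min p)..site l (Max p)}"
  show "m \<in> (\<Union>q\<in>{q\<in>U. Min p \<le> Min q \<and> Max q \<le> Max p}. block l U q)"
  proof (cases "m = site l (Max p)")
    case True
    then show ?thesis using p by (auto simp: block_def)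
  next
    case False
    then have "site l (Min p) \<le> m" "m < site l (Max p)" using m by auto
    then obtain i where i: "Min p \<le> i" "i < Max p" "m = site l i \<or> m \<in> gap l i"
      by (rule site_or_gap)
    show ?thesis using i(3)
    proof
      assume mi: "m = site l i"
      have "Max p \<in> \<Union>U" using p arc_eq by blast
      then have "i \<in> \<Union>U" using i(2) V by auto
      then obtain q where q: "q \<in> U" "i \<in> q" by auto
      have qi: "i = Min q \<or> i = Max q" using arc_eq[OF q(1)] q(2) by blast
      have "Min p \<le> Min q \<and> Max q \<le> Max p"
      proof (cases "p = q")
        case False
        from noncrossing_matching_laminar[OF nm p q(1) False] show ?thesis
          using qi i(1,2) Min_less_Max[OF q(1)] by auto
      qed auto
      then show ?thesis using q(1) qi mi by (auto simp: block_def)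
    next
      assume mi: "m \<in> gap l i"
      obtain q where "q \<in> U" "Min p \<le> Min q" "Max q \<le> Max p" "i \<in> arc_indices U q"
        by (rule innermost_arc[OF fin p i(1,2)])
      then show ?thesis using mi by (auto simp: block_def gaps_def)
    qed
  qed
next
  fix m assume "m \<in> (\<Union>q\<in>{q\<in>U. Min p \<le> Min q \<and> Max q \<le> Max p}. block l U q)"
  then obtain q where q: "q \<in> U" "Min p \<le> Min q" "Max q \<le> Max p" "m \<in> block l U q" by auto
  have "site l (Min p) \<le> site l (Min q)" "site l (Max q) \<le> site l (Max p)" 
      "site l (Min q) \<le> site l (Max q)"
    using q Min_less_Max[OF q(1)] by simp_all
  moreover have "site l (Min q) \<le> m" "m \<le> site l (Max q)"
    using q(4) gaps_bounds[of l U q] \<open>site l (Min q) \<le> site l (Max q)\<close> unfolding block_def by auto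
  ultimately have "site l (Min p) \<le> m" "m \<le> site l (Max p)" by linarith+
  then show "m \<in> {site l (Min p)..site l (Max p)}" by simp
qed

text \<open>Along its block an arc reads \<open>L\<close>, a Dyck word and \<open>R\<close>: the
  opening letter lifts the nonnegative heights by 1, and the closing letter cancels the
  lift.\<close>

lemma word_height_block:
  assumes q: "q \<in> U" and w: "w (site l (Min q)) = L" "w (site l (Max q)) = R" "dyck w (gaps l U q)"
  shows "word_height w (block l U q \<inter> {..t}) \<ge> 0"
    and "site l (Min q) \<le> t \<Longrightarrow> t < site l (Max q) \<Longrightarrow> word_height w (block l U q \<inter> {..t}) > 0"
    and "site l (Max q) \<le> t \<Longrightarrow> word_height w (block l U q \<inter> {..t}) = 0"
proof -
  have lt: "site l (Min q) < site l (Max q)" using Min_less_Max[OF q] by simp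
  note gb = gaps_bounds[of l U q]
  have ins: "word_height w (insert x A) = letter_step (w x) + word_height w A" if "x \<notin> A" "finite A" for x A
    using that by (simp add: word_height_def)
  have dy: "word_height w (gaps l U q \<inter> {..t}) \<ge> 0" "word_height w (gaps l U q) = 0"
    using w(3) by (auto simp: dyck_def)
  show mid: "word_height w (block l U q \<inter> {..t}) > 0" if "site l (Min q) \<le> t" "t < site l (Max q)"
  proof -
    have "block l U q \<inter> {..t} = insert (site l (Min q)) (gaps l U q \<inter> {..t})"
      using that by (auto simp: block_def)
    then show ?thesis using dy ins[of "site l (Min q)" "gaps l U q \<inter> {..t}"] w
      by (simp add: site_notin_gaps finite_gaps)
  qed
  show hi: "word_height w (block l U q \<inter> {..t}) = 0" if "site l (Max q) \<le> t"
  proof -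
    have "block l U q \<inter> {..t} = insert (site l (Min q)) (insert (site l (Max q)) (gaps l U q))"
      using that lt gb unfolding block_def by (auto simp del: site_less_iff)
    moreover have "site l (Min q) \<notin> insert (site l (Max q)) (gaps l U q)"
      using lt by (simp add: site_notin_gaps)
    ultimately show ?thesis using dy w by (simp add: ins site_notin_gaps finite_gaps)
  qed
  show "word_height w (block l U q \<inter> {..t}) \<ge> 0"
  proof (cases "site l (Min q) \<le> t")
    case True
    then show ?thesis using mid hi by (cases "t < site l (Max q)") (auto simp: less_imp_le)
  next
    case False
    moreover have "site l (Min q) \<le> m" if "m \<in> block l U q" for m
      using that lt gb unfolding block_def by auto
    ultimately have "block l U q \<inter> {..t} = {}" by fastforce
    then show ?thesis by simp
  qed
qed

lemma finite_block: "finite (block l U q)"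
  by (simp add: block_def finite_gaps)

text \<open>The walk over the interval of \<open>p\<close> is the sum of the walks over the blocks
  of the arcs weakly nested in \<open>p\<close>. Each summand is nonnegative, the one of
  \<open>p\<close> itself is positive until its right end, and there all of them have returned to
  0.\<close>

lemma is_arc_if_dyck_gaps:
  assumes fin: "finite U" and V: "\<Union>U = {0..<2*k}" and p: "p \<in> U"
    and w: "\<And>q. q \<in> U \<Longrightarrow> w (site l (Min q)) = L \<and> w (site l (Max q)) = R \<and> dyck w (gaps l U q)"
  shows "is_arc w (site l (Min p)) (site l (Max p))"
proof -
  define Q where "Q = {q\<in>U. Min p \<le> Min q \<and> Max q \<le> Max p}"
  have Q: "finite Q" "p \<in> Q" "Q \<subseteq> U" using fin p by (auto simp: Q_def)
  have eq: "word_height w {site l (Min p)..t} = (\<Sum>q\<in>Q. word_height w (block l U q \<inter> {..t}))"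
    if "t \<le> site l (Max p)" for t
  proof -
    have "{site l (Min p)..t} = {site l (Min p)..site l (Max p)} \<inter> {..t}" using that by auto
    also have "\<dots> = (\<Union>q\<in>Q. block l U q \<inter> {..t})"
      unfolding interval_eq_blocks[OF fin V p] Q_def by auto
    finally have "word_height w {site l (Min p)..t} = word_height w (\<Union>q\<in>Q. block l U q \<inter> {..t})"
      by simp
    also have "\<dots> = (\<Sum>q\<in>Q. word_height w (block l U q \<inter> {..t}))"
      unfolding word_height_def
    proof (rule sum.UNION_disjoint)
      show "\<forall>q\<in>Q. \<forall>r\<in>Q. q \<noteq> r \<longrightarrow> block l U q \<inter> {..t} \<inter> (block l U r \<inter> {..t}) = {}"
      proof (intro ballI impI)
        fix q r assume "q \<in> Q" "r \<in> Q" "q \<noteq> r"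
        then have "block l U q \<inter> block l U r = {}" using Q(3) by (intro block_disjoint) auto
        then show "block l U q \<inter> {..t} \<inter> (block l U r \<inter> {..t}) = {}" by blast
      qed
    qed (use Q in \<open>simp_all add: finite_block\<close>)
    finally show ?thesis .
  qed
  note wh = word_height_block[of _ w l]
  show ?thesis
    unfolding is_arc_def
  proof (intro conjI allI impI)
    show "site l (Min p) < site l (Max p)" using Min_less_Max[OF p] by simp
    show "word_height w {site l (Min p)..site l (Max p)} = 0"
      unfolding eq[OF order_refl] using Q w by (intro sum.neutral ballI wh(3)) (auto simp: Q_def)
    fix t assume t: "site l (Min p) \<le> t \<and> t < site l (Max p)"
    have "(\<Sum>q\<in>Q. word_height w (block l U q \<inter> {..t})) > 0"
      by (rule sum_pos2[OF Q(1,2)]) (use t w p Q(3) in \<open>auto intro!: wh(1,2)\<close>)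
    then show "word_height w {site l (Min p)..t} > 0" using eq t by simp
  qed
qed

text \<open>It suffices that the gaps of \<open>p\<close> are closed under partners. The partner of
  a gap position lies under \<open>p\<close>; it is not the site of a vertex, since these are
  matched with each other; and it does not lie under an arc nested in \<open>p\<close>, since the
  given position would then do so as well.\<close>

lemma dyck_gaps_if_is_arc:
  assumes good: "matchable w" and V: "\<Union>U = {0..<2*k}" and p: "p \<in> U"
    and arcs: "\<And>q. q \<in> U \<Longrightarrow> is_arc w (site l (Min q)) (site l (Max q))"
  shows "dyck w (gaps l U p)"
proof (rule dyck_closed[OF good finite_gaps])
  have P: "noncrossing_matching UNIV (arc_set w)"
    using matches_word_arc_set[OF good] by (simp add: matches_word_def)
  have in_arc: "{site l (Min q), site l (Max q)} \<in> arc_set w" if "q \<in> U" for q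
    using arcs[OF that] by (simp add: doubleton_in_arc_set)
  have step: "n \<in> gaps l U p" if m: "m \<in> gaps l U p" and mn: "{m, n} \<in> arc_set w" for m n
  proof -
    obtain i where i: "i \<in> arc_indices U p" "m \<in> gap l i" using m by (auto simp: gaps_def)
    have "site l (Min p) < m" "m < site l (Max p)" using gaps_bounds[of l U p] m by auto
    then have n: "site l (Min p) < n" "n < site l (Max p)"
      using noncrossing_matching_between[OF P in_arc[OF p] mn] by auto
    then obtain j where j: "Min p \<le> j" "j < Max p" "n = site l j \<or> n \<in> gap l j"
      using site_or_gap[of l "Min p" n "Max p"] by (metis less_imp_le)
    have ngap: "n \<in> gap l j"
    proof (rule ccontr)
      assume "n \<notin> gap l j"
      then have nj: "n = site l j" using j by auto
      have "Max p \<in> \<Union>U" using p arc_eq by blast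
      then have "j \<in> \<Union>U" using j(2) V by auto
      then obtain q where q: "q \<in> U" "j \<in> q" by auto
      have "j = Min q \<or> j = Max q" using arc_eq[OF q(1)] q(2) by blast
      then obtain j' where "{n, site l j'} \<in> arc_set w"
        using in_arc[OF q(1)] nj by (metis insert_commute)
      then have "m = site l j'"
        using noncrossing_matching_partner_unique[OF P, of n m] mn by (metis insert_commute)
      then show False using i site_notin_gap by auto
    qed
    have "j \<in> arc_indices U p"
    proof (rule ccontr)
      assume "j \<notin> arc_indices U p"
      then obtain q where q: "q \<in> U" "Min p < Min q" "Min q \<le> j" "j < Max q" "Max q < Max p"
        using j by (auto simp: arc_indices_def)
      have "site l (Min q) \<le> site l j" "site l (Suc j) \<le> site l (Max q)" using q by simp_all
      moreover have "site l j < n" "n < site l (Suc j)" using ngap by (auto simp: gap_def)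
      ultimately have "site l (Min q) < n" "n < site l (Max q)" by linarith+
      then have mq: "site l (Min q) < m" "m < site l (Max q)"
        using noncrossing_matching_between[OF P in_arc[OF q(1)], of n m] mn by (auto simp: insert_commute)
      moreover have "site l i < m" "m < site l (Suc i)" using i(2) by (auto simp: gap_def)
      ultimately have "site l (Min q) < site l (Suc i)" "site l i < site l (Max q)" by linarith+
      then have "Min q \<le> i" "i < Max q" by simp_all
      then show False using i(1) q by (auto simp: arc_indices_def)
    qed
    then show ?thesis using ngap by (auto simp: gaps_def)
  qed
  show "m \<in> gaps l U p \<longleftrightarrow> n \<in> gaps l U p" if "is_arc w m n" for m n
    using step[of m n] step[of n m] that by (auto simp: doubleton_in_arc_set)
qed

end


section \<open>Finite components and meanders\<close>

lemma component_refl: "x \<in> component E x"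
  by (simp add: component_def)

lemma component_step:
  assumes "y \<in> component E x" "{y, z} \<in> E"
  shows "z \<in> component E x"
  using assms rtrancl_into_rtrancl[of x y "{(u, v). {u, v} \<in> E}" z] by (simp add: component_def)

lemma component_sym:
  assumes "y \<in> component E x"
  shows "x \<in> component E y"
proof -
  have "sym {(u, v). {u, v} \<in> E}" by (auto simp: sym_def insert_commute)
  then have "sym ({(u, v). {u, v} \<in> E}\<^sup>*)" by (rule sym_rtrancl)
  then show ?thesis using assms by (auto simp: component_def dest: symD)
qed

lemma component_trans: "y \<in> component E x \<Longrightarrow> z \<in> component E y \<Longrightarrow> z \<in> component E x"
  by (auto simp: component_def)

lemma component_eq: "y \<in> component E x \<Longrightarrow> component E y = component E x"
proof (intro equalityI subsetI)
  assume y: "y \<in> component E x"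
  show "z \<in> component E x" if "z \<in> component E y" for z using component_trans[OF y that] .
  show "z \<in> component E y" if "z \<in> component E x" for z
    using component_trans[OF component_sym[OF y] that] .
qed

lemma component_induct [consumes 1, case_names base step]:
  assumes "y \<in> component E x" "\<phi> x"
    "\<And>y z. y \<in> component E x \<Longrightarrow> {y, z} \<in> E \<Longrightarrow> \<phi> y \<Longrightarrow> \<phi> z"
  shows "\<phi> y"
proof -
  have "(x, y) \<in> {(u, v). {u, v} \<in> E}\<^sup>*" using assms(1) by (simp add: component_def)
  then show ?thesis
    by (induction rule: rtrancl_induct) (use assms(2,3) in \<open>auto simp: component_def\<close>)
qed

lemma component_image:
  assumes "y \<in> component E x" "\<And>u v. {u, v} \<in> E \<Longrightarrow> {f u, f v} \<in> E'"
  shows "f y \<in> component E' (f x)"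
  using assms(1)
proof (induction rule: component_induct)
  case (step y z)
  then show ?case using assms(2) component_step by metis
qed (rule component_refl)

definition embeds :: "(nat \<Rightarrow> int) \<Rightarrow> nat set set \<Rightarrow> int set set \<Rightarrow> bool" where
  "embeds x U P \<longleftrightarrow> (\<forall>p\<in>U. x ` p \<in> P)"

text \<open>The embedded matchings already provide a partner for every site, so the image is closed
  under both matchings; it is connected because the meander is.\<close>

lemma component_embedded_meander:
  assumes C: "(U, D) \<in> meanders k" "0 < k" and x: "inj x"
    and P: "noncrossing_matching UNIV P" and Q: "noncrossing_matching UNIV Q"
    and emb: "embeds x U P" "embeds x D Q"
  shows "component (P \<union> Q) (x 0) = x ` {0..<2*k}"
proof (intro equalityI subsetI)
  have U: "noncrossing_matching {0..<2*k} U" and D: "noncrossing_matching {0..<2*k} D"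
    and conn: "\<And>i j. i < 2*k \<Longrightarrow> j < 2*k \<Longrightarrow> j \<in> component (U \<union> D) i"
    using C by (auto simp: meanders_def meandric_systems_def)
  have closed: "z \<in> x ` {0..<2*k}"
    if h: "{x i, z} \<in> P'" "i < 2*k" "embeds x U' P'" "noncrossing_matching UNIV P'"
       "noncrossing_matching {0..<2*k} U'" for i z U' P'
  proof -
    obtain j where "{i, j} \<in> U'" "j \<in> {0..<2*k}"
      using noncrossing_matching_partner[OF h(5), of i] \<open>i < 2*k\<close> by auto
    moreover have "{x i, x j} \<in> P'" using h(3) \<open>{i, j} \<in> U'\<close> by (force simp: embeds_def)
    ultimately show ?thesis using noncrossing_matching_partner_unique[OF h(4) h(1)] by blast
  qed
  show "y \<in> x ` {0..<2*k}" if "y \<in> component (P \<union> Q) (x 0)" for y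
    using that
  proof (induction rule: component_induct)
    case base
    then show ?case using C(2) by auto
  next
    case (step y z)
    then show ?case using closed[OF _ _ emb(1) P U] closed[OF _ _ emb(2) Q D] by fastforce
  qed
  show "y \<in> component (P \<union> Q) (x 0)" if y: "y \<in> x ` {0..<2*k}" for y
  proof -
    obtain j where j: "j < 2*k" "y = x j" using y by auto
    have "j \<in> component (U \<union> D) 0" using conn j C(2) by simp
    then show ?thesis unfolding j(2)
    proof (rule component_image)
      show "{x u, x v} \<in> P \<union> Q" if "{u, v} \<in> U \<union> D" for u v
        using that emb unfolding embeds_def by force
    qed
  qed
qed

text \<open>The images of the two pairs at a common vertex share a point and hence coincide.
  Equality of matchings follows by using the inclusion in both directions.\<close>

lemma embeds_unique:
  assumes "embeds x U P" "embeds x U' P" "inj x" "noncrossing_matching V' P"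
    "noncrossing_matching V U" "noncrossing_matching V U'"
  shows "U \<subseteq> U'"
proof
  fix p assume p: "p \<in> U"
  obtain a where a: "a \<in> p" "a \<in> V" using noncrossing_matchingE[OF assms(5) p] by blast
  obtain q where q: "q \<in> U'" "a \<in> q"
    using assms(6) a(2) by (auto simp: noncrossing_matching_def partition_on_def)
  have "x ` p = x ` q"
    by (rule noncrossing_matching_unique[OF assms(4), of _ _ "x a"])
      (use assms(1,2) p q a in \<open>auto simp: embeds_def\<close>)
  then have "p = q" using assms(3) by (simp add: inj_image_eq_iff)
  then show "p \<in> U'" using q by simp
qed

text \<open>Exactly \<open>i\<close> elements of the image lie below \<open>x i\<close>, so the
  image determines which element has index \<open>i\<close>.\<close>

lemma strict_mono_image_unique:
  fixes x y :: "nat \<Rightarrow> int"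
  assumes "strict_mono x" "strict_mono y" "x ` {0..<n} = y ` {0..<n}" "i < n"
  shows "x i = y i"
proof -
  have card_eq: "card {m \<in> z ` {0..<n}. m < z i} = i" if "strict_mono z" "i < n" for z :: "nat \<Rightarrow> int" and i
  proof -
    have "{m \<in> z ` {0..<n}. m < z i} = z ` {0..<i}"
      using that strict_mono_less[OF that(1)] by auto
    moreover have "inj_on z {0..<i}" using that(1) strict_mono_imp_inj_on inj_on_subset by blast
    ultimately show ?thesis by (simp add: card_image)
  qed
  have "x i \<in> y ` {0..<n}" using assms(3,4) by auto
  then obtain j where j: "j < n" "x i = y j" by auto
  then have "i = j" using card_eq[OF assms(1,4)] card_eq[OF assms(2) j(1)] assms(3) by simp
  then show ?thesis using j by simp
qed

text \<open>The image determines all \<open>2 * k\<close> sites, and \<open>l i\<close> is read off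
  from the distance between the sites \<open>i\<close> and \<open>Suc i\<close>; outside the index
  range both functions are \<open>undefined\<close>.\<close>

lemma site_image_unique:
  assumes "l \<in> {0..2*k-2} \<rightarrow>\<^sub>E UNIV" "l' \<in> {0..2*k-2} \<rightarrow>\<^sub>E UNIV" "0 < k"
    and eq: "site l ` {0..<2*k} = site l' ` {0..<2*k}"
  shows "l = l'"
proof
  fix i show "l i = l' i"
  proof (cases "i \<le> 2*k-2")
    case True
    then have "site l i = site l' i" "site l (Suc i) = site l' (Suc i)"
      using assms(3) by (auto intro!: strict_mono_image_unique[OF strict_mono_site strict_mono_site eq])
    then show ?thesis by (simp add: site_Suc)
  next
    case False
    then have "i \<notin> {0..2*k-2}" by simp
    then show ?thesis using PiE_arb[OF assms(1)] PiE_arb[OF assms(2)] by simp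
  qed
qed

text \<open>Closure of the image under partners ensures that every index is covered, and
  monotonicity of \<open>x\<close> transports the non-crossing condition.\<close>

lemma noncrossing_matching_pullback:
  assumes P: "noncrossing_matching V P" and x: "strict_mono_on {0..<n} x"
    and S: "x ` {0..<n} \<subseteq> V" "\<And>u v. {u, v} \<in> P \<Longrightarrow> u \<in> x ` {0..<n} \<Longrightarrow> v \<in> x ` {0..<n}"
  shows "noncrossing_matching {0..<n} {p. p \<subseteq> {0..<n} \<and> x ` p \<in> P}" (is "noncrossing_matching _ ?U")
proof -
  have inj: "inj_on x {0..<n}" using x by (rule strict_mono_on_imp_inj_on)
  have "partition_on {0..<n} ?U"
    unfolding partition_on_def
  proof (intro conjI)
    show "\<Union>?U = {0..<n}"
    proof (intro equalityI subsetI)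
      fix i assume i: "i \<in> {0..<n}"
      then have "x i \<in> V" using S(1) by auto
      then obtain v where v: "{x i, v} \<in> P" using noncrossing_matching_partner[OF P] by metis
      then have "v \<in> x ` {0..<n}" using S(2) i by blast
      then obtain j where j: "j \<in> {0..<n}" "v = x j" by auto
      then have "{i, j} \<in> ?U" using v i by auto
      then show "i \<in> \<Union>?U" by blast
    qed auto
    show "disjoint ?U"
    proof (rule disjointI, rule ccontr)
      fix p q assume pq: "p \<in> ?U" "q \<in> ?U" "p \<noteq> q" "p \<inter> q \<noteq> {}"
      then obtain i where "i \<in> p" "i \<in> q" by auto
      then have "x ` p = x ` q"
        using pq by (intro noncrossing_matching_unique[OF P, of _ _ "x i"]) auto
      then show False using pq inj by (simp add: inj_on_image_eq_iff)
    qed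
    show "{} \<notin> ?U" using P by (auto simp: noncrossing_matching_def partition_on_def)
  qed
  moreover have "card p = 2" if "p \<in> ?U" for p
  proof -
    have "card (x ` p) = 2" using P that by (auto simp: noncrossing_matching_def)
    moreover have "inj_on x p" using inj that inj_on_subset by blast
    ultimately show ?thesis by (simp add: card_image)
  qed
  moreover have "noncrossing ?U"
    unfolding noncrossing_def
  proof (rule notI, elim exE conjE)
    fix i j k l assume h: "i < j" "j < k" "k < l" "{i, k} \<in> ?U" "{j, l} \<in> ?U"
    then have "x i < x j" "x j < x k" "x k < x l"
      using x by (auto intro!: strict_mono_onD[of "{0..<n}" x])
    moreover have "{x i, x k} \<in> P" "{x j, x l} \<in> P" using h by auto
    ultimately show False using P unfolding noncrossing_matching_def noncrossing_def by blast
  qed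
  ultimately show ?thesis by (auto simp: noncrossing_matching_def)
qed

text \<open>The component, listed increasingly as \<open>x\<close>, pulls both matchings back to a
  meander. Writing \<open>x\<close> as \<open>site l\<close> requires consecutive differences to be
  odd; for this the parity of \<open>x i - int i\<close> is shown to be constant along arcs, hence
  by connectedness equal to that of \<open>x 0 - 0 = 0\<close>.\<close>

lemma finite_component_is_meander:
  assumes P: "noncrossing_matching UNIV P" and Q: "noncrossing_matching UNIV Q"
    and fin: "finite (component (P \<union> Q) (0::int))" and min: "Min (component (P \<union> Q) 0) = 0"
  obtains k l U D where "0 < k" "(U, D) \<in> meanders k" "l \<in> {0..2*k-2} \<rightarrow>\<^sub>E UNIV"
    "embeds (site l) U P" "embeds (site l) D Q"
proof -
  define S where "S = component (P \<union> Q) 0"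
  define xs where "xs = sorted_list_of_set S"
  define n where "n = card S"
  define x where "x i = xs ! i" for i
  have finS: "finite S" using fin by (simp add: S_def)
  have S0: "0 \<in> S" by (simp add: S_def component_refl)
  have closed: "v \<in> S" if "u \<in> S" "{u, v} \<in> P \<union> Q" for u v
    using that component_step unfolding S_def by metis
  have len: "length xs = n" by (simp add: xs_def n_def)
  have sorted: "sorted_wrt (<) xs" unfolding xs_def by (rule strict_sorted_list_of_set)
  have x: "strict_mono_on {0..<n} x"
    by (rule strict_mono_onI) (auto simp: x_def len intro: sorted_wrt_nth_less[OF sorted])
  have inj: "inj_on x {0..<n}" using x by (rule strict_mono_on_imp_inj_on)
  have S: "x ` {0..<n} = S"
  proof -
    have "x ` {0..<n} = set xs" by (auto simp: set_conv_nth x_def len)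
    then show ?thesis using finS by (simp add: xs_def)
  qed
  have "even n" unfolding n_def
    by (rule noncrossing_matching_even_card[OF P finS]) (use closed in auto)
  then obtain k where k: "n = 2 * k" by auto
  have npos: "0 < n" using S0 finS by (auto simp: n_def card_gt_0_iff)
  then have kpos: "0 < k" using k by simp
  have less: "x i < x j \<longleftrightarrow> i < j" if "i < n" "j < n" for i j
    using strict_mono_on_less[OF x] that by auto
  have x0: "x 0 = 0"
  proof -
    obtain i where i: "i < n" "x i = 0" using S0 S by auto
    have "x 0 \<in> S" using S npos by auto
    then have "0 \<le> x 0" using min finS unfolding S_def[symmetric] by (metis Min_le)
    then have "\<not> 0 < i" using less[of 0 i] i npos by auto
    then show ?thesis using i by simp
  qed
  define U where "U = {p. p \<subseteq> {0..<n} \<and> x ` p \<in> P}"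
  define D where "D = {p. p \<subseteq> {0..<n} \<and> x ` p \<in> Q}"
  have U: "noncrossing_matching {0..<n} U"
    unfolding U_def by (rule noncrossing_matching_pullback[OF P x]) (use closed S in auto)
  have D: "noncrossing_matching {0..<n} D"
    unfolding D_def by (rule noncrossing_matching_pullback[OF Q x]) (use closed S in auto)
  have UD: "{i, j} \<in> U \<union> D \<longleftrightarrow> {x i, x j} \<in> P \<union> Q" if "i < n" "j < n" for i j
    using that by (auto simp: U_def D_def)
  have conn0: "\<exists>i<n. y = x i \<and> i \<in> component (U \<union> D) 0" if "y \<in> component (P \<union> Q) 0" for y
    using that
  proof (induction rule: component_induct)
    case base
    then show ?case using npos x0 component_refl by (intro exI[of _ 0]) auto
  next
    case (step y z)
    then obtain i where i: "i < n" "y = x i" "i \<in> component (U \<union> D) 0" by blast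
    have "z \<in> S" using closed step by (auto simp: S_def)
    then obtain j where j: "j < n" "z = x j" using S by auto
    have "{i, j} \<in> U \<union> D" using UD i j step by simp
    then show ?case using i(3) j component_step by metis
  qed
  have conn: "j \<in> component (U \<union> D) i" if "i < n" "j < n" for i j
  proof -
    have "i \<in> component (U \<union> D) 0" if "i < n" for i
    proof -
      have "x i \<in> S" using S that by auto
      then obtain i' where i': "i' < n" "x i = x i'" "i' \<in> component (U \<union> D) 0"
        using conn0 unfolding S_def by blast
      then have "i = i'" using inj_onD[OF inj i'(2)] that by simp
      then show ?thesis using i' by simp
    qed
    then show ?thesis using that component_eq by metis
  qed
  have mean: "(U, D) \<in> meanders k"
    using U D conn by (simp add: meanders_def meandric_systems_def k)
  text \<open>Both \<open>x i\<close> and \<open>i\<close> change parity along every arc, so that all gaps have even length.\<close>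
  have par: "even (x i - int i) \<longleftrightarrow> even (x j - int j)"
    if ij: "i < n" "j < n" "{x i, x j} \<in> P'" and P': "P' = P \<or> P' = Q" for i j P'
  proof -
    have nm: "noncrossing_matching UNIV P'" using P' P Q by auto
    have cl: "v \<in> S" if "u \<in> S" "{u, v} \<in> P'" for u v using closed that P' by blast
    have main: "even (x i - int i) \<longleftrightarrow> even (x j - int j)"
      if ij: "i < n" "j < n" "{x i, x j} \<in> P'" "i < j" for i j
    proof -
      have lt: "x i < x j" using less ij by auto
      have I: "v \<in> {x i..x j}" if uv: "{u, v} \<in> P'" "u \<in> {x i..x j}" for u v
      proof -
        consider "u = x i" | "u = x j" | "x i < u" "u < x j" using uv(2) by fastforce
        then show ?thesis
        proof cases
          case 1
          then have "v = x j" using noncrossing_matching_partner_unique[OF nm] uv(1) ij(3) by metis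
          then show ?thesis using lt by simp
        next
          case 2
          then have "v = x i"
            using noncrossing_matching_partner_unique[OF nm] uv(1) ij(3) by (metis insert_commute)
          then show ?thesis using lt by simp
        next
          case 3
          then show ?thesis using noncrossing_matching_between[OF nm ij(3) uv(1)] by simp
        qed
      qed
      \<comment> \<open>The interval between the ends of an arc and its intersection with
        \<open>S\<close> are both unions of pairs. The first makes \<open>x j - x i\<close> odd, the
        second makes \<open>j - i\<close> odd.\<close>
      have "even (card {x i..x j})"
        by (rule noncrossing_matching_even_card[OF nm]) (use I in auto)
      then have 1: "even (x j - x i + 1)" using lt by (simp add: even_nat_iff)
      have "even (card (S \<inter> {x i..x j}))"
        by (rule noncrossing_matching_even_card[OF nm]) (use I cl finS in auto)
      moreover have "S \<inter> {x i..x j} = x ` {i..j}"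
      proof -
        have "x i \<le> x m \<longleftrightarrow> i \<le> m" "x m \<le> x j \<longleftrightarrow> m \<le> j" if "m < n" for m
          using less[of m i] less[of j m] that ij by (auto simp: not_less[symmetric])
        then show ?thesis unfolding S[symmetric] using ij by auto
      qed
      moreover have "card (x ` {i..j}) = Suc j - i"
      proof -
        have "{i..j} \<subseteq> {0..<n}" using ij by auto
        then show ?thesis using card_image[OF inj_on_subset[OF inj]] by simp
      qed
      ultimately have "even (Suc j - i)" by simp
      then show ?thesis using 1 ij(4) by presburger
    qed
    have "i \<noteq> j" using noncrossing_matching_pair(1)[OF nm ij(3)] by auto
    then show ?thesis using main[of i j] main[of j i] ij by (metis insert_commute linorder_neqE_nat)
  qed
  have parity: "even (x i - int i)" if "i < n" for i
  proof -
    have "i \<in> component (U \<union> D) 0" using conn npos that by simp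
    then have "i < n \<and> even (x i - int i)"
    proof (induction rule: component_induct)
      case base
      then show ?case using npos x0 by simp
    next
      case (step i j)
      then have "j < n" using noncrossing_matching_pair(3)[OF U] noncrossing_matching_pair(3)[OF D] by auto
      moreover have "{x i, x j} \<in> P \<union> Q" using UD step \<open>j < n\<close> by blast
      ultimately show ?case using step par by blast
    qed
    then show ?thesis by simp
  qed
  \<comment> \<open>Half the number of positions strictly between consecutive sites; the division is
    exact by \<open>parity\<close>, and \<open>restrict\<close> makes the function
    extensional.\<close>
  define l where "l = restrict (\<lambda>i. nat ((x (Suc i) - x i - 1) div 2)) {0..2*k-2}"
  have site_eq: "site l i = x i" if "i < n" for i using that
  proof (induction i)
    case 0
    then show ?case by (simp add: x0)
  next
    case (Suc i)
    have "i \<le> 2*k-2" using Suc(2) k by linarith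
    have "x i < x (Suc i)" using less Suc by auto
    moreover have "even (x (Suc i) - x i - 1)"
      using parity[of i] parity[of "Suc i"] Suc(2) by simp
    ultimately have "2 * int (l i) + 1 = x (Suc i) - x i"
      using \<open>i \<le> 2*k-2\<close> by (simp add: l_def)
    then show ?case using Suc by (simp add: site_Suc)
  qed
  have emb: "site l ` p = x ` p" if "p \<subseteq> {0..<n}" for p
    using that site_eq by (intro image_cong) auto
  show ?thesis
  proof (rule that[OF kpos mean])
    show "embeds (site l) U P" "embeds (site l) D Q" using emb by (auto simp: embeds_def U_def D_def)
  qed (simp add: l_def)
qed


section \<open>The random word\<close>

lemma finite_letter [simp]: "finite (UNIV :: letter set)"
  by (rule finite_subset[of _ "{L, R}"]) (auto intro: letter.exhaust)

lemma prob_space_word_law: "prob_space word_law"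
  unfolding word_law_def by (intro prob_space_PiM measure_pmf.prob_space_axioms)

interpretation word_law: prob_space word_law
  by (rule prob_space_word_law)

lemma space_word_law [simp]: "space word_law = UNIV"
  by (simp add: word_law_def space_PiM)

lemma measurable_letter [measurable]: "(\<lambda>w. w i) \<in> measurable word_law (count_space UNIV)"
proof -
  have "(\<lambda>w. w i) \<in> measurable word_law (measure_pmf (pmf_of_set {L, R}))"
    unfolding word_law_def by (rule measurable_component_singleton) simp
  then show ?thesis by (simp add: measurable_def)
qed

text \<open>An elementary substitute for measurability with respect to the coordinates in
  \<open>J\<close>: for finite \<open>J\<close>, probabilities and independence reduce to counting
  functions on \<open>J\<close>.\<close>

definition depends_only :: "int set \<Rightarrow> (int \<Rightarrow> letter) set \<Rightarrow> bool" where
  "depends_only J A \<longleftrightarrow> (\<forall>w w'. (\<forall>j\<in>J. w j = w' j) \<longrightarrow> (w \<in> A \<longleftrightarrow> w' \<in> A))"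

lemma depends_onlyD: "depends_only J A \<Longrightarrow> (\<And>j. j \<in> J \<Longrightarrow> w j = w' j) \<Longrightarrow> w \<in> A \<longleftrightarrow> w' \<in> A"
  by (simp add: depends_only_def)

lemma emeasure_cylinder:
  assumes "finite J"
  shows "{w. \<forall>j\<in>J. w j = v j} \<in> sets word_law"
    and "emeasure word_law {w. \<forall>j\<in>J. w j = v j} = ennreal ((1/2) ^ card J)"
proof -
  let ?M = "\<lambda>_::int. measure_pmf (pmf_of_set {L, R})"
  have eq: "{w. \<forall>j\<in>J. w j = v j} = prod_emb UNIV ?M J (PiE J (\<lambda>j. {v j}))"
    by (auto simp: prod_emb_def PiE_iff)
  show "{w. \<forall>j\<in>J. w j = v j} \<in> sets word_law"
    unfolding eq word_law_def using assms by (intro sets_PiM_I) auto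
  have "emeasure word_law {w. \<forall>j\<in>J. w j = v j} = (\<Prod>j\<in>J. emeasure (?M j) {v j})"
    unfolding eq word_law_def using assms
    by (intro emeasure_PiM_emb measure_pmf.prob_space_axioms) auto
  also have "\<dots> = (\<Prod>j\<in>J. ennreal (1/2))"
  proof (rule prod.cong)
    fix j
    have "v j \<in> {L, R}" by (cases "v j") auto
    then show "emeasure (?M j) {v j} = ennreal (1/2)"
      by (subst emeasure_pmf_single) (simp add: pmf_of_set)
  qed simp
  also have "\<dots> = ennreal ((1/2) ^ card J)"
    by (simp only: prod_constant ennreal_power[of "1/2"] divide_nonneg_nonneg zero_le_one zero_le_numeral)
  finally show "emeasure word_law {w. \<forall>j\<in>J. w j = v j} = ennreal ((1/2) ^ card J)" .
qed

text \<open>The event is a finite disjoint union of cylinders of equal probability, one for each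
  admissible assignment on \<open>J\<close>.\<close>

lemma prob_depends_only:
  assumes J: "finite J" and A: "depends_only J A"
  shows "A \<in> sets word_law"
    and "measure word_law A = card {v \<in> J \<rightarrow>\<^sub>E UNIV. v \<in> A} / 2 ^ card J"
proof -
  define S where "S = {v \<in> J \<rightarrow>\<^sub>E UNIV. v \<in> A}"
  define Z where "Z v = {w. \<forall>j\<in>J. w j = v j}" for v :: "int \<Rightarrow> letter"
  have S: "finite S" unfolding S_def by (rule finite_subset[of _ "J \<rightarrow>\<^sub>E UNIV"]) (auto intro: finite_PiE J)
  have A_eq: "A = (\<Union>v\<in>S. Z v)"
  proof (intro equalityI subsetI)
    fix w assume w: "w \<in> A"
    have "restrict w J \<in> A" using depends_onlyD[OF A, of w "restrict w J"] w by simp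
    then have "restrict w J \<in> S" by (simp add: S_def)
    moreover have "w \<in> Z (restrict w J)" by (simp add: Z_def)
    ultimately show "w \<in> (\<Union>v\<in>S. Z v)" by blast
  next
    fix w assume "w \<in> (\<Union>v\<in>S. Z v)"
    then obtain v where v: "v \<in> S" "\<And>j. j \<in> J \<Longrightarrow> w j = v j" by (auto simp: Z_def)
    then show "w \<in> A" using depends_onlyD[OF A, of w v] by (simp add: S_def)
  qed
  have Zs: "Z v \<in> sets word_law" for v unfolding Z_def by (rule emeasure_cylinder[OF J])
  show "A \<in> sets word_law" unfolding A_eq using S Zs by auto
  have disj: "disjoint_family_on Z S"
      unfolding disjoint_family_on_def
  proof (intro ballI impI)
    fix u v assume uv: "u \<in> S" "v \<in> S" "u \<noteq> v"
    show "Z u \<inter> Z v = {}"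
    proof (rule ccontr)
      assume "Z u \<inter> Z v \<noteq> {}"
      then obtain w where "\<And>j. j \<in> J \<Longrightarrow> u j = v j" unfolding Z_def by auto
      then have "u = v" using uv by (intro PiE_ext[of u J _ v]) (auto simp: S_def)
      then show False using uv by simp
    qed
  qed
  have Zm: "measure word_law (Z v) = (1/2) ^ card J" for v
    unfolding measure_def Z_def emeasure_cylinder(2)[OF J] by simp
  have "measure word_law A = (\<Sum>v\<in>S. measure word_law (Z v))"
    unfolding A_eq using S Zs disj by (intro word_law.finite_measure_finite_Union) auto
  also have "\<dots> = card S / 2 ^ card J"
    by (simp add: Zm power_one_over field_simps)
  finally show "measure word_law A = card {v \<in> J \<rightarrow>\<^sub>E UNIV. v \<in> A} / 2 ^ card J"
    by (simp add: S_def)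
qed

lemma depends_only_Int: "depends_only J A \<Longrightarrow> depends_only K B \<Longrightarrow> depends_only (J \<union> K) (A \<inter> B)"
  unfolding depends_only_def by (simp add: Ball_def) blast

text \<open>Serves twice: for independence of events on disjoint sets of positions, and for
  splitting a gap function into its even and odd parts.\<close>

lemma bij_betw_restrict_PiE:
  assumes "J \<inter> K = {}"
  shows "bij_betw (\<lambda>v. (restrict v J, restrict v K)) (J \<union> K \<rightarrow>\<^sub>E S) ((J \<rightarrow>\<^sub>E S) \<times> (K \<rightarrow>\<^sub>E S))"
proof (rule bij_betw_byWitness)
  let ?g = "\<lambda>(a, b) j. if j \<in> J then a j else b j"
  show "\<forall>v\<in>J \<union> K \<rightarrow>\<^sub>E S. ?g (restrict v J, restrict v K) = v"
    by (auto simp: PiE_def extensional_def restrict_def fun_eq_iff)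
  show "\<forall>ab\<in>(J \<rightarrow>\<^sub>E S) \<times> (K \<rightarrow>\<^sub>E S). (restrict (?g ab) J, restrict (?g ab) K) = ab"
    using assms by (auto simp: PiE_def extensional_def restrict_def fun_eq_iff)
  show "(\<lambda>v. (restrict v J, restrict v K)) ` (J \<union> K \<rightarrow>\<^sub>E S) \<subseteq> (J \<rightarrow>\<^sub>E S) \<times> (K \<rightarrow>\<^sub>E S)"
    by auto
  show "?g ` ((J \<rightarrow>\<^sub>E S) \<times> (K \<rightarrow>\<^sub>E S)) \<subseteq> J \<union> K \<rightarrow>\<^sub>E S"
    by (auto simp: PiE_def extensional_def Pi_def)
qed

lemma prob_Int_depends_only:
  assumes J: "finite J" "depends_only J A" and K: "finite K" "depends_only K B" and JK: "J \<inter> K = {}"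
  shows "measure word_law (A \<inter> B) = measure word_law A * measure word_law B"
proof -
  define S where "S J A = {v \<in> J \<rightarrow>\<^sub>E UNIV. v \<in> A}" for J and A :: "(int \<Rightarrow> letter) set"
  define f where "f v = (restrict v J, restrict v K)" for v :: "int \<Rightarrow> letter"
  define X where "X = (J \<union> K \<rightarrow>\<^sub>E (UNIV :: letter set))"
  have bij: "bij_betw f X ((J \<rightarrow>\<^sub>E UNIV) \<times> (K \<rightarrow>\<^sub>E UNIV))"
    using bij_betw_restrict_PiE[OF JK, of "UNIV :: letter set"] by (simp add: f_def[abs_def] X_def)
  have rA: "restrict v J \<in> A \<longleftrightarrow> v \<in> A" and rB: "restrict v K \<in> B \<longleftrightarrow> v \<in> B" for v
    using depends_onlyD[OF J(2), of v "restrict v J"] depends_onlyD[OF K(2), of v "restrict v K"] by auto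
  have S_eq: "S (J \<union> K) (A \<inter> B) = {v \<in> X. f v \<in> S J A \<times> S K B}"
    by (auto simp: S_def X_def f_def rA rB)
  have "f ` {v \<in> X. f v \<in> Y} = Y" if "Y \<subseteq> f ` X" for Y using that by blast
  moreover have "S J A \<times> S K B \<subseteq> f ` X"
    using bij_betw_imp_surj_on[OF bij] by (auto simp: S_def)
  ultimately have "f ` S (J \<union> K) (A \<inter> B) = S J A \<times> S K B" unfolding S_eq by blast
  moreover have "inj_on f (S (J \<union> K) (A \<inter> B))"
    using bij_betw_imp_inj_on[OF bij] by (rule inj_on_subset) (simp add: S_eq)
  ultimately have "card (S (J \<union> K) (A \<inter> B)) = card (S J A \<times> S K B)"
    by (metis card_image)
  then have "card (S (J \<union> K) (A \<inter> B)) = card (S J A) * card (S K B)"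
    by (simp add: card_cartesian_product)
  then show ?thesis
    using prob_depends_only(2)[OF J] prob_depends_only(2)[OF K]
      prob_depends_only(2)[OF _ depends_only_Int[OF J(2) K(2)]] J(1) K(1) JK
    by (simp add: S_def card_Un_disjoint power_add)
qed

text \<open>The set of positions on which the intersection depends is carried through the induction,
  because the product formula for the next event needs it.\<close>

lemma prob_INT_depends_only:
  assumes "finite F" "\<And>p. p \<in> F \<Longrightarrow> finite (J p)" "\<And>p. p \<in> F \<Longrightarrow> depends_only (J p) (A p)"
    and "\<And>p q. p \<in> F \<Longrightarrow> q \<in> F \<Longrightarrow> p \<noteq> q \<Longrightarrow> J p \<inter> J q = {}"
  shows "depends_only (\<Union>p\<in>F. J p) {w. \<forall>p\<in>F. w \<in> A p} \<and>
    measure word_law {w. \<forall>p\<in>F. w \<in> A p} = (\<Prod>p\<in>F. measure word_law (A p))"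
  using assms
proof (induction F rule: finite_induct)
  case empty
  then show ?case using word_law.prob_space by (simp add: depends_only_def)
next
  case (insert p F)
  have IH: "depends_only (\<Union>p\<in>F. J p) {w. \<forall>p\<in>F. w \<in> A p}"
    "measure word_law {w. \<forall>p\<in>F. w \<in> A p} = (\<Prod>p\<in>F. measure word_law (A p))"
    using insert by auto
  have eq: "{w. \<forall>q\<in>insert p F. w \<in> A q} = A p \<inter> {w. \<forall>q\<in>F. w \<in> A q}" by auto
  have "depends_only (\<Union>q\<in>insert p F. J q) {w. \<forall>q\<in>insert p F. w \<in> A q}"
    unfolding eq using depends_only_Int[of "J p" "A p", OF _ IH(1)] insert by simp
  moreover have "J p \<inter> (\<Union>q\<in>F. J q) = {}" using insert by blast
  then have "measure word_law (A p \<inter> {w. \<forall>q\<in>F. w \<in> A q}) =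
      measure word_law (A p) * measure word_law {w. \<forall>q\<in>F. w \<in> A q}"
    using insert IH by (intro prob_Int_depends_only[of "J p" _ "\<Union>q\<in>F. J q"]) auto
  ultimately show ?case unfolding eq using insert IH by simp
qed

lemma depends_only_letter: "depends_only {i} {w. w i = c}"
  by (simp add: depends_only_def)

lemma prob_letter: "measure word_law {w. w i = c} = 1/2"
proof -
  have "{v \<in> {i} \<rightarrow>\<^sub>E UNIV. v i = c} = {\<lambda>j. if j = i then c else undefined}"
    by (auto simp: PiE_def extensional_def fun_eq_iff)
  then show ?thesis
    using prob_depends_only(2)[OF _ depends_only_letter, of i c] by simp
qed

lemma depends_only_dyck: "depends_only G {w. dyck w G}"
  unfolding depends_only_def using dyck_cong[of G] by blast

lemma prob_dyck:
  assumes "finite G" "card G = 2 * n"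
  shows "measure word_law {w. dyck w G} = catalan n / 4 ^ n"
  using prob_depends_only(2)[OF assms(1) depends_only_dyck] card_dyck[OF assms] assms(2)
  by (simp add: power_mult)

text \<open>The two end letters account for the extra factor 1/4 in
  \<open>4 ^ Suc n\<close>.\<close>

lemma prob_arc_event:
  assumes "finite G" "card G = 2 * n" "a \<noteq> b" "a \<notin> G" "b \<notin> G"
  shows "depends_only ({a, b} \<union> G) {w. w a = L \<and> w b = R \<and> dyck w G}"
    and "measure word_law {w. w a = L \<and> w b = R \<and> dyck w G} = catalan n / 4 ^ Suc n"
proof -
  have eq: "{w. w a = L \<and> w b = R \<and> dyck w G} = {w. w a = L} \<inter> ({w. w b = R} \<inter> {w. dyck w G})" by auto
  have d: "depends_only ({b} \<union> G) ({w. w b = R} \<inter> {w. dyck w G})"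
    by (intro depends_only_Int depends_only_letter depends_only_dyck)
  show "depends_only ({a, b} \<union> G) {w. w a = L \<and> w b = R \<and> dyck w G}"
    unfolding eq using depends_only_Int[OF depends_only_letter[of a L] d] by (simp add: insert_commute)
  have "measure word_law ({w. w a = L} \<inter> ({w. w b = R} \<inter> {w. dyck w G})) =
      1/2 * (1/2 * (catalan n / 4 ^ n))"
    using assms
    by (subst prob_Int_depends_only[OF _ depends_only_letter _ d])
      (auto simp: prob_letter prob_dyck[OF assms(1,2)]
        prob_Int_depends_only[OF _ depends_only_letter _ depends_only_dyck])
  then show "measure word_law {w. w a = L \<and> w b = R \<and> dyck w G} = catalan n / 4 ^ Suc n"
    unfolding eq by simp
qed

section \<open>Recurrence of the walk: almost every word has a matching\<close>

lemma is_arc_if_dyck: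
  assumes "i < j" "w i = L" "w j = R" "dyck w {i<..<j}"
  shows "is_arc w i j"
  unfolding is_arc_def
proof (intro conjI allI impI)
  have 1: "word_height w {i..t} = 1 + word_height w ({i<..<j} \<inter> {..t})" if "i \<le> t" "t < j" for t
  proof -
    have "{i..t} = {i} \<union> ({i<..<j} \<inter> {..t})" using that by auto
    then show ?thesis using assms(2) word_height_union_disjoint[of "{i}" "{i<..<j} \<inter> {..t}" w] by simp
  qed
  show "word_height w {i..t} > 0" if "i \<le> t \<and> t < j" for t
    using 1[of t] that assms(4) by (smt (verit) dyck_def)
  have "word_height w {i..j} = word_height w {i..j-1} + word_height w {j..j}"
    using word_height_split[of i "j-1" j w] assms(1) by simp
  moreover have "{i<..<j} \<inter> {..j-1} = {i<..<j}" by auto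
  then have "word_height w {i..j-1} = 1 + word_height w {i<..<j}"
    using 1[of "j-1"] assms(1) by simp
  ultimately show "word_height w {i..j} = 0" using assms(3,4) by (simp add: dyck_def)
qed (rule assms(1))

lemma depends_only_is_arc: "depends_only {i..j} {w. is_arc w i j}"
proof -
  have "is_arc w i j \<longleftrightarrow> is_arc w' i j" if "\<forall>m\<in>{i..j}. w m = w' m" for w w'
    by (rule is_arc_cong) (use that in auto)
  then show ?thesis unfolding depends_only_def by blast
qed

lemma sets_is_arc [measurable]: "Measurable.pred word_law (\<lambda>w. is_arc w i j)"
  using prob_depends_only(1)[OF _ depends_only_is_arc] by (simp add: pred_def)

lemma prob_is_arc_ge:
  assumes "j = i + 2 * int n + 1"
  shows "measure word_law {w. is_arc w i j} \<ge> catalan n / 4 ^ Suc n"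
proof -
  have "measure word_law {w. w i = L \<and> w j = R \<and> dyck w {i<..<j}} = catalan n / 4 ^ Suc n"
    by (rule prob_arc_event) (use assms in auto)
  moreover have "measure word_law {w. w i = L \<and> w j = R \<and> dyck w {i<..<j}} \<le> measure word_law {w. is_arc w i j}"
    using is_arc_if_dyck assms prob_depends_only(1)[OF _ depends_only_is_arc]
    by (intro word_law.finite_measure_mono) auto
  ultimately show ?thesis by simp
qed

lemma central_binomial_Suc:
  "real ((2 * Suc N) choose Suc N) * (real N + 1) = 2 * (2 * real N + 1) * real ((2 * N) choose N)"
proof -
  have 1: "Suc N * (Suc (Suc (2 * N)) choose Suc N) = Suc (Suc (2 * N)) * (Suc (2 * N) choose N)"
    by (rule Suc_times_binomial)
  have 2: "Suc N * (Suc (2 * N) choose Suc N) = Suc (2 * N) * (2 * N choose N)"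
    by (rule Suc_times_binomial)
  have 3: "Suc (2 * N) choose N = Suc (2 * N) choose Suc N"
    using binomial_symmetric[of N "Suc (2 * N)"] by simp
  have "Suc N * (2 * Suc N choose Suc N) = 2 * (Suc N * (Suc (2 * N) choose Suc N))"
    using 1 unfolding 3 by simp
  then have "Suc N * (2 * Suc N choose Suc N) = 2 * (Suc (2 * N) * (2 * N choose N))"
    unfolding 2 .
  then have "real (Suc N * (2 * Suc N choose Suc N)) = real (2 * (Suc (2 * N) * (2 * N choose N)))"
    by (rule arg_cong)
  then show ?thesis by (simp only: of_nat_mult of_nat_Suc of_nat_numeral) (simp add: algebra_simps)
qed

text \<open>Telescoping: \<open>catalan N / 4 ^ Suc N\<close> is half the decrease of the normalized
  central binomial coefficient from \<open>N\<close> to \<open>Suc N\<close>.\<close>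

lemma sum_catalan: "(\<Sum>n<N. catalan n / 4 ^ Suc n) = 1/2 - real ((2 * N) choose N) / 4 ^ N / 2"
proof (induction N)
  case (Suc N)
  have c: "catalan N * (real N + 1) = real ((2 * N) choose N)"
    by (simp add: catalan_def)
  \<comment> \<open>Multiplied by the common denominator, the increment vanishes by
    \<open>central_binomial_Suc\<close> and the identity \<open>c\<close>.\<close>
  have "(catalan N / 4 ^ Suc N - real ((2 * N) choose N) / 4 ^ N / 2 + real ((2 * Suc N) choose Suc N) / 4 ^ Suc N / 2)
      * (8 * 4 ^ N * (real N + 1)) = 0"
    using central_binomial_Suc[of N] c by (simp add: algebra_simps add_divide_distrib del: binomial_Suc_Suc mult_Suc_right)
  then have "catalan N / 4 ^ Suc N - real ((2 * N) choose N) / 4 ^ N / 2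
      + real ((2 * Suc N) choose Suc N) / 4 ^ Suc N / 2 = 0"
    unfolding mult_eq_0_iff by (auto simp add: add_nonneg_eq_0_iff)
  then show ?case using Suc by simp
qed simp

text \<open>The left-hand side does not increase with \<open>N\<close>: consecutive values have
  ratio \<open>(2N+1)(2N+3) / (2N+2)^2\<close>, which is at most 1. It follows that the remainder in
  \<open>sum_catalan\<close> tends to 0.\<close>

lemma central_binomial_bound: "(real ((2 * N) choose N) / 4 ^ N)\<^sup>2 * (2 * real N + 1) \<le> 1"
proof (induction N)
  case (Suc N)
  define a where "a = real ((2 * N) choose N) / 4 ^ N"
  have eq: "real ((2 * Suc N) choose Suc N) / 4 ^ Suc N = a * ((2 * real N + 1) / (2 * real N + 2))"
  proof -
    have "X / (4 * q) = B / q * ((2 * n + 1) / (2 * n + 2))"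
      if "X * (n + 1) = 2 * (2 * n + 1) * B" "q > 0" "n \<ge> 0" for X B q n :: real
    proof -
      have "X * (q * (2 * n + 2)) = (B * (2 * n + 1)) * (4 * q)" using that(1) by algebra
      then have "X / (4 * q) = (B * (2 * n + 1)) / (q * (2 * n + 2))"
        using that by (intro frac_eq_eq[THEN iffD2]) auto
      then show ?thesis by simp
    qed
    from this[OF central_binomial_Suc, of "4 ^ N"] show ?thesis by (simp add: a_def)
  qed
  have "(a * ((2 * real N + 1) / (2 * real N + 2)))\<^sup>2 * (2 * real (Suc N) + 1) =
      a\<^sup>2 * (2 * real N + 1) * ((2 * real N + 1) * (2 * real N + 3) / (2 * real N + 2)\<^sup>2)"
    by (simp add: power_mult_distrib power_divide power2_eq_square algebra_simps)
  also have "\<dots> \<le> 1 * 1"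
  proof (rule mult_mono)
    have "(2 * real N + 1) * (2 * real N + 3) \<le> (2 * real N + 2)\<^sup>2"
      by (simp add: power2_eq_square algebra_simps)
    then show "(2 * real N + 1) * (2 * real N + 3) / (2 * real N + 2)\<^sup>2 \<le> 1"
      by (intro divide_le_eq_1[THEN iffD2]) auto
  qed (use Suc in \<open>auto simp: a_def\<close>)
  finally show ?case unfolding eq by simp
qed simp

lemma central_binomial_tendsto_0: "(\<lambda>N. real ((2 * N) choose N) / 4 ^ N) \<longlonglongrightarrow> 0"
proof (rule tendsto_sandwich[where f = "\<lambda>_. 0"])
  have "real ((2 * N) choose N) / 4 ^ N \<le> sqrt (1 / (2 * real N + 1))" for N
    by (rule real_le_rsqrt) (use central_binomial_bound[of N] in \<open>simp add: pos_le_divide_eq\<close>)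
  then show "\<forall>\<^sub>F N in sequentially. real ((2 * N) choose N) / 4 ^ N \<le> sqrt (1 / (2 * real N + 1))" by simp
  show "(\<lambda>N. sqrt (1 / (2 * real N + 1))) \<longlonglongrightarrow> 0" by real_asymp
qed auto

text \<open>Recurrence of the simple random walk: the disjoint events that the arc at \<open>m\<close> has length
  \<open>2 n + 1\<close> have total probability at least \<open>1/2\<close>, which is the probability of the letter \<open>c\<close>.\<close>

lemma AE_letter_matched:
  assumes sub: "\<And>n w. is_arc w (i n) (j n) \<Longrightarrow> w m = c" and ij: "\<And>n. j n = i n + 2 * int n + 1"
    and disj: "\<And>n n' w. is_arc w (i n) (j n) \<Longrightarrow> is_arc w (i n') (j n') \<Longrightarrow> n = n'"
  shows "AE w in word_law. w m = c \<longrightarrow> (\<exists>n::nat. is_arc w (i n) (j n))"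
proof -
  define B where "B = {w. \<exists>n. is_arc w (i n) (j n)}"
  have "Measurable.pred word_law (\<lambda>w. \<exists>n. is_arc w (i n) (j n))" by measurable
  then have Bs [measurable]: "B \<in> sets word_law" by (simp add: B_def pred_def)
  have Cs [measurable]: "{w. w m = c} \<in> sets word_law"
    by (rule prob_depends_only(1)[OF _ depends_only_letter]) simp
  have ge: "measure word_law B \<ge> 1/2 - real ((2 * N) choose N) / 4 ^ N / 2" for N
  proof -
    have "(\<Sum>n<N. catalan n / 4 ^ Suc n) \<le> (\<Sum>n<N. measure word_law {w. is_arc w (i n) (j n)})"
      by (intro sum_mono prob_is_arc_ge ij)
    also have "\<dots> = measure word_law (\<Union>n<N. {w. is_arc w (i n) (j n)})"
    proof (rule word_law.finite_measure_finite_Union[symmetric])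
      show "disjoint_family_on (\<lambda>n. {w. is_arc w (i n) (j n)}) {..<N}"
        using disj by (auto simp: disjoint_family_on_def)
    qed (use prob_depends_only(1)[OF _ depends_only_is_arc] in auto)
    also have "\<dots> \<le> measure word_law B"
    proof (rule word_law.finite_measure_mono[OF _ Bs])
      show "(\<Union>n<N. {w. is_arc w (i n) (j n)}) \<subseteq> B" by (auto simp: B_def)
    qed
    finally show ?thesis unfolding sum_catalan .
  qed
  have "(\<lambda>N. 1/2 - real ((2 * N) choose N) / 4 ^ N / 2) \<longlonglongrightarrow> 1/2 - 0 / 2"
    by (intro tendsto_intros central_binomial_tendsto_0) simp
  then have "1/2 - 0/2 \<le> measure word_law B"
    by (rule LIMSEQ_le_const2) (use ge in auto)
  moreover have "B \<subseteq> {w. w m = c}" using sub by (auto simp: B_def)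
  then have "measure word_law ({w. w m = c} - B) = 1/2 - measure word_law B"
    using word_law.finite_measure_Diff[OF Cs Bs] prob_letter by simp
  ultimately have "measure word_law ({w. w m = c} - B) = 0"
    using measure_nonneg[of word_law "{w. w m = c} - B"] by linarith
  then have "emeasure word_law ({w. w m = c} - B) = 0" by (simp add: word_law.emeasure_eq_measure)
  then show ?thesis
  proof (intro AE_I[of _ _ "{w. w m = c} - B"])
    show "{w. w m = c} - B \<in> sets word_law" using Bs Cs by (rule sets.Diff[rotated])
  qed (auto simp: B_def)
qed

lemma AE_matchable: "AE w in word_law. matchable w"
proof -
  have "AE w in word_law. \<forall>m. \<exists>j. is_arc w m j \<or> is_arc w j m"
    unfolding AE_all_countable
  proof
    fix m :: int
    \<comment> \<open>For an opening letter the left end is fixed at \<open>m\<close>, for a closing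
      letter the right end. Uniqueness of partners makes the events for different \<open>n\<close>
      disjoint.\<close>
    have 1: "AE w in word_law. w m = L \<longrightarrow> (\<exists>n::nat. is_arc w m (m + 2 * int n + 1))"
      by (rule AE_letter_matched) (auto dest: is_arc_letters is_arc_right_unique)
    have 2: "AE w in word_law. w m = R \<longrightarrow> (\<exists>n::nat. is_arc w (m - 2 * int n - 1) m)"
      by (rule AE_letter_matched) (auto dest: is_arc_letters is_arc_left_unique)
    from 1 2 show "AE w in word_law. \<exists>j. is_arc w m j \<or> is_arc w j m"
    proof eventually_elim
      case (elim w)
      then show ?case by (cases "w m") auto
    qed
  qed
  then show ?thesis by (simp add: matchable_def)
qed

lemma pred_matchable [measurable]: "Measurable.pred word_law matchable"
  unfolding matchable_def by measurable


section \<open>Mass transport\<close>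

abbreviation noodle_edges :: "(int \<Rightarrow> letter) \<times> (int \<Rightarrow> letter) \<Rightarrow> int set set" where
  "noodle_edges w \<equiv> word_matching (fst w) \<union> word_matching (snd w)"

lemma prob_space_noodle_law: "prob_space noodle_law"
  unfolding noodle_law_def by (rule prob_space_pair[OF prob_space_word_law prob_space_word_law])

interpretation noodle_law: prob_space noodle_law
  by (rule prob_space_noodle_law)

lemma space_noodle_law [simp]: "space noodle_law = UNIV"
  by (simp add: noodle_law_def space_pair_measure)

lemma pred_word_matching [measurable]: "Measurable.pred word_law (\<lambda>w. {u, v} \<in> word_matching w)"
proof -
  have "{u, v} \<in> word_matching w \<longleftrightarrow> matchable w \<and> (is_arc w u v \<or> is_arc w v u)" for w
    by (simp add: word_matching_eq doubleton_in_arc_set)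
  then show ?thesis by simp
qed

lemma pred_noodle_edges [measurable]: "Measurable.pred noodle_law (\<lambda>w. {u, v} \<in> noodle_edges w)"
proof -
  have [measurable]: "fst \<in> measurable noodle_law word_law" "snd \<in> measurable noodle_law word_law"
    by (simp_all add: noodle_law_def)
  show ?thesis unfolding Un_iff by measurable
qed

text \<open>Paths are treated by length, each further step being a countable union over the
  intermediate vertex.\<close>

lemma pred_component [measurable]: "Measurable.pred noodle_law (\<lambda>w. y \<in> component (noodle_edges w) x)"
proof -
  define r where "r w = {(u, v). {u, v} \<in> noodle_edges w}" for w
  have "Measurable.pred noodle_law (\<lambda>w. (x, y) \<in> r w ^^ n)" for n
  proof (induction n arbitrary: y)
    case (Suc n)
    have "(x, y) \<in> r w ^^ Suc n \<longleftrightarrow> (\<exists>z. (x, z) \<in> r w ^^ n \<and> {z, y} \<in> noodle_edges w)" for w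
      by (auto simp: r_def)
    moreover have "Measurable.pred noodle_law (\<lambda>w. \<exists>z. (x, z) \<in> r w ^^ n \<and> {z, y} \<in> noodle_edges w)"
      by (intro pred_intros_countable pred_intros_logic Suc.IH pred_noodle_edges)
    ultimately show ?case by (simp only:)
  qed simp
  moreover have "y \<in> component (noodle_edges w) x \<longleftrightarrow> (\<exists>n. (x, y) \<in> r w ^^ n)" for w
    by (simp add: component_def r_def rtrancl_power)
  ultimately show ?thesis by simp
qed

lemma pred_component_eq [measurable]: "Measurable.pred noodle_law (\<lambda>w. component (noodle_edges w) x = S)"
  unfolding set_eq_iff by measurable

text \<open>There are only countably many finite sets of integers, and all infinite components are
  merged into the single value \<open>UNIV\<close>. The result is a discrete random variable, so any
  function of it is measurable.\<close>

lemma measurable_finite_component: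
  "(\<lambda>w. if finite (noodle_component w) then g (noodle_component w) else c) \<in> borel_measurable noodle_law"
proof -
  define I where "I = insert UNIV {S :: int set. finite S}"
  define Y where "Y w = (if finite (noodle_component w) then noodle_component w else UNIV)" for w
  have cI: "countable I" unfolding I_def by (simp add: countable_Collect_finite)
  have fin: "Measurable.pred noodle_law (\<lambda>w. finite (noodle_component w))"
  proof -
    have "{w\<in>space noodle_law. finite (noodle_component w)} =
        (\<Union>S\<in>Collect finite. {w\<in>space noodle_law. component (noodle_edges w) 0 = S})"
      by (auto simp: noodle_component_def)
    also have "\<dots> \<in> sets noodle_law"
      using pred_component_eq[unfolded pred_def]
      by (intro sets.countable_UN' countable_Collect_finite) auto
    finally show ?thesis by (simp only: pred_def)
  qed
  have "Y \<in> measurable noodle_law (count_space I)"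
    unfolding measurable_count_space_eq_countable[OF cI]
  proof (intro conjI ballI)
    fix S assume "S \<in> I"
    show "Y -` {S} \<inter> space noodle_law \<in> sets noodle_law"
    proof (cases "finite S")
      case True
      have Y_eq: "Y w = S \<longleftrightarrow> noodle_component w = S" for w
        using True unfolding Y_def by (cases "finite (noodle_component w)") auto
      have "Y -` {S} \<inter> space noodle_law = {w\<in>space noodle_law. component (noodle_edges w) 0 = S}"
        using Y_eq by (simp add: vimage_def noodle_component_def Int_def conj_commute)
      then show ?thesis using pred_component_eq[of 0 S] by (simp only: pred_def)
    next
      case False
      then have "S = UNIV" using \<open>S \<in> I\<close> by (simp add: I_def)
      moreover have "Y w = UNIV \<longleftrightarrow> \<not> finite (noodle_component w)" for w
        unfolding Y_def by (cases "finite (noodle_component w)") auto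
      ultimately have "Y -` {S} \<inter> space noodle_law = {w\<in>space noodle_law. \<not> finite (noodle_component w)}"
        by (simp add: vimage_def Int_def conj_commute)
      moreover have "Measurable.pred noodle_law (\<lambda>w. \<not> finite (noodle_component w))"
        using fin by measurable
      ultimately show ?thesis by (simp only: pred_def)
    qed
  qed (auto simp: Y_def I_def)
  then have "(\<lambda>w. (\<lambda>S. if finite S then g S else c) (Y w)) \<in> borel_measurable noodle_law"
    by (rule measurable_compose) simp
  moreover have "(\<lambda>S. if finite S then g S else c) (Y w) =
      (if finite (noodle_component w) then g (noodle_component w) else c)" for w
    by (simp add: Y_def)
  ultimately show ?thesis by simp
qed

text \<open>The bound 2 gives integrability, so the real integral can be replaced by a nonnegative
  one, which commutes with series.\<close>

lemma kappa_nn_integral: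
  "ennreal kappa = (\<integral>\<^sup>+ w. (if finite (noodle_component w)
     then ennreal (2 / real (card (noodle_component w))) else 0) \<partial>noodle_law)"
proof -
  let ?f = "\<lambda>w. if finite (noodle_component w) then 2 / real (card (noodle_component w)) else 0"
  have b: "0 \<le> ?f w \<and> ?f w \<le> 2" for w
  proof -
    have "2 / real n \<le> 2" for n by (cases n) (auto simp: divide_le_eq)
    then show ?thesis by auto
  qed
  have "integrable noodle_law ?f"
    by (rule noodle_law.integrable_const_bound[where B = 2])
      (use b measurable_finite_component[of "\<lambda>S. 2 / real (card S)" 0] in auto)
  then have "(\<integral>\<^sup>+ w. ennreal (?f w) \<partial>noodle_law) = ennreal kappa"
    unfolding kappa_def using b by (intro nn_integral_eq_integral) auto
  also have "(\<integral>\<^sup>+ w. ennreal (?f w) \<partial>noodle_law) = (\<integral>\<^sup>+ w. (if finite (noodle_component w)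
     then ennreal (2 / real (card (noodle_component w))) else 0) \<partial>noodle_law)"
    by (intro nn_integral_cong) simp
  finally show ?thesis by simp
qed

section \<open>Translation invariance of the noodle\<close>

definition word_shift :: "int \<Rightarrow> (int \<Rightarrow> letter) \<Rightarrow> int \<Rightarrow> letter" where
  "word_shift m w = (\<lambda>i. w (i + m))"

lemma word_height_shift: "word_height (word_shift m w) {i..t} = word_height w {i+m..t+m}"
proof -
  have "word_height (word_shift m w) {i..t} = word_height w ((\<lambda>x. x + m) ` {i..t})"
    unfolding word_height_def by (subst sum.reindex) (auto simp: inj_on_def word_shift_def)
  then show ?thesis by simp
qed

lemma is_arc_shift: "is_arc (word_shift m w) i j \<longleftrightarrow> is_arc w (i + m) (j + m)"
proof -
  have "(\<forall>t. i \<le> t \<and> t < j \<longrightarrow> 0 < word_height w {i + m..t + m}) \<longleftrightarrow>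
      (\<forall>t. i + m \<le> t \<and> t < j + m \<longrightarrow> 0 < word_height w {i + m..t})"
    by (metis add_le_cancel_right add_less_cancel_right diff_add_cancel)
  then show ?thesis by (simp add: is_arc_def word_height_shift)
qed

lemma matchable_shift: "matchable (word_shift m w) \<longleftrightarrow> matchable w"
  unfolding matchable_def is_arc_shift by (metis diff_add_cancel)

lemma word_matching_shift: "{u, v} \<in> word_matching (word_shift m w) \<longleftrightarrow> {u + m, v + m} \<in> word_matching w"
  by (simp add: word_matching_eq doubleton_in_arc_set matchable_shift is_arc_shift)

lemma component_shift:
  "y \<in> component (noodle_edges (map_prod (word_shift m) (word_shift m) w)) x \<longleftrightarrow>
   y + m \<in> component (noodle_edges w) (x + m)"
proof
  assume "y \<in> component (noodle_edges (map_prod (word_shift m) (word_shift m) w)) x"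
  then show "y + m \<in> component (noodle_edges w) (x + m)"
    by (rule component_image) (auto simp: word_matching_shift)
next
  assume "y + m \<in> component (noodle_edges w) (x + m)"
  then have "(y + m) - m \<in> component (noodle_edges (map_prod (word_shift m) (word_shift m) w)) ((x + m) - m)"
    by (rule component_image) (auto simp: word_matching_shift)
  then show "y \<in> component (noodle_edges (map_prod (word_shift m) (word_shift m) w)) x" by simp
qed

lemma measurable_shift [measurable]: "word_shift m \<in> measurable word_law word_law"
  unfolding word_law_def word_shift_def
  by (rule measurable_PiM_single', rule measurable_component_singleton) (simp_all add: space_PiM)

lemma distr_shift: "distr word_law word_law (word_shift m) = word_law"
proof -
  let ?M = "\<lambda>_::int. measure_pmf (pmf_of_set {L, R})"
  have "distr (Pi\<^sub>M UNIV ?M) (\<Pi>\<^sub>M i\<in>UNIV. ?M (i + m)) (\<lambda>\<omega>. \<lambda>n\<in>UNIV. \<omega> (n + m)) = (\<Pi>\<^sub>M i\<in>UNIV. ?M (i + m))"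
    by (rule distr_PiM_reindex) (auto intro: measure_pmf.prob_space_axioms simp: inj_def)
  moreover have "(\<lambda>\<omega>. \<lambda>n\<in>UNIV. \<omega> (n + m)) = word_shift m"
    by (auto simp: fun_eq_iff word_shift_def)
  ultimately show ?thesis by (simp add: word_law_def)
qed

lemma distr_shift_noodle: "distr noodle_law noodle_law (map_prod (word_shift m) (word_shift m)) = noodle_law"
proof -
  have "distr word_law word_law (word_shift m) \<Otimes>\<^sub>M distr word_law word_law (word_shift m) =
      distr (word_law \<Otimes>\<^sub>M word_law) (word_law \<Otimes>\<^sub>M word_law) (\<lambda>(x, y). (word_shift m x, word_shift m y))"
    by (intro pair_measure_distr measurable_shift)
      (simp add: distr_shift word_law.sigma_finite_measure_axioms)
  moreover have "(\<lambda>(x, y). (word_shift m x, word_shift m y)) = map_prod (word_shift m) (word_shift m)" by auto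
  ultimately show ?thesis by (simp add: distr_shift noodle_law_def)
qed

lemma noodle_component_refl: "0 \<in> noodle_component w"
  by (simp add: noodle_component_def component_refl)

text \<open>The translation moves the leftmost site \<open>- int m\<close> to the origin and the
  origin to \<open>int m\<close>. The sign is negative because \<open>word_shift\<close> reads the
  word at \<open>i + m\<close>.\<close>

lemma shifted_leftmost:
  fixes m :: nat
  defines "T \<equiv> map_prod (word_shift (- int m)) (word_shift (- int m))"
  shows "finite (noodle_component w) \<and> Min (noodle_component w) = - int m \<longleftrightarrow>
      finite (noodle_component (T w)) \<and> Min (noodle_component (T w)) = 0 \<and> int m \<in> noodle_component (T w)"
    and "finite (noodle_component w) \<and> Min (noodle_component w) = - int m \<Longrightarrow>
      card (noodle_component (T w)) = card (noodle_component w)"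
proof -
  define X where "X = noodle_component w"
  define X' where "X' = noodle_component (T w)"
  have X': "y \<in> X' \<longleftrightarrow> y - int m \<in> component (noodle_edges w) (- int m)" for y
    unfolding X'_def noodle_component_def T_def component_shift by simp
  have eq: "X' = (\<lambda>y. y + int m) ` X" if "- int m \<in> X"
  proof -
    have "component (noodle_edges w) (- int m) = X"
      using component_eq[OF that[unfolded X_def noodle_component_def]]
      by (simp add: X_def noodle_component_def)
    then have mem: "y \<in> X' \<longleftrightarrow> y - int m \<in> X" for y using X'[of y] by simp
    show ?thesis
    proof (intro equalityI subsetI)
      fix y assume "y \<in> X'"
      then show "y \<in> (\<lambda>y. y + int m) ` X" using mem[of y] by (intro image_eqI[of _ _ "y - int m"]) auto
    next
      fix y assume "y \<in> (\<lambda>y. y + int m) ` X"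
      then obtain x where "x \<in> X" "y = x + int m" by blast
      then show "y \<in> X'" using mem[of y] by simp
    qed
  qed
  have mono: "mono (\<lambda>y. y + int m)" by (simp add: mono_def)
  have 1: "finite X' \<and> Min X' = 0 \<and> int m \<in> X'" "card X' = card X" if "finite X" "Min X = - int m"
  proof -
    have ne: "X \<noteq> {}" using noodle_component_refl[of w] by (auto simp: X_def)
    have "- int m \<in> X" using Min_in[OF that(1) ne] that(2) by simp
    note e = eq[OF this]
    have "0 \<in> X" using noodle_component_refl by (simp add: X_def)
    then have "int m \<in> X'" unfolding e by force
    then show "finite X' \<and> Min X' = 0 \<and> int m \<in> X'"
      using that mono_Min_commute[OF mono that(1) ne] unfolding e by simp
    show "card X' = card X" unfolding e by (rule card_image) (simp add: inj_on_def)
  qed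
  have 2: "finite X \<and> Min X = - int m" if "finite X'" "Min X' = 0" "int m \<in> X'"
  proof -
    have "0 \<in> component (noodle_edges w) (- int m)" using X'[of "int m"] that by simp
    then have "- int m \<in> X" unfolding X_def noodle_component_def by (rule component_sym)
    note e = eq[OF this]
    have ne: "X \<noteq> {}" using \<open>- int m \<in> X\<close> by auto
    have "finite X" using that(1) unfolding e by (rule finite_imageD) (simp add: inj_on_def)
    then show ?thesis using that(2) mono_Min_commute[OF mono _ ne] unfolding e by simp
  qed
  show "finite (noodle_component w) \<and> Min (noodle_component w) = - int m \<longleftrightarrow>
      finite (noodle_component (T w)) \<and> Min (noodle_component (T w)) = 0 \<and> int m \<in> noodle_component (T w)"
    using 1 2 unfolding X_def X'_def by blast
  show "finite (noodle_component w) \<and> Min (noodle_component w) = - int m \<Longrightarrow>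
      card (noodle_component (T w)) = card (noodle_component w)"
    using 1 unfolding X_def X'_def by blast
qed

text \<open>The total mass received by the leftmost site. As the minimum is 0, a sum over
  \<open>nat\<close> reaches all members.\<close>

lemma suminf_indicator_members:
  assumes "finite S" "Min S = 0" "S \<noteq> {}"
  shows "(\<Sum>m. if int m \<in> S then ennreal (2 / real (card S)) else 0) = 2"
proof -
  have nonneg: "0 \<le> x" if "x \<in> S" for x using assms that Min_le by metis
  have inj: "inj_on nat S" using nonneg by (intro inj_onI) (metis eq_nat_nat_iff)
  have iff: "int m \<in> S \<longleftrightarrow> m \<in> nat ` S" for m
    using nonneg by (force simp: image_iff)
  have "(\<Sum>m. if int m \<in> S then ennreal (2 / real (card S)) else 0) =
      (\<Sum>m\<in>nat ` S. if int m \<in> S then ennreal (2 / real (card S)) else 0)"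
    by (rule suminf_finite) (use assms iff in auto)
  also have "\<dots> = (\<Sum>m\<in>nat ` S. ennreal (2 / real (card S)))"
    by (rule sum.cong) (use iff in auto)
  also have "\<dots> = of_nat (card S) * ennreal (2 / real (card S))"
    by (simp add: card_image[OF inj])
  also have "\<dots> = ennreal (real (card S) * (2 / real (card S)))"
    unfolding ennreal_of_nat_eq_real_of_nat by (rule ennreal_mult[symmetric]) auto
  also have "real (card S) * (2 / real (card S)) = 2" using assms by simp
  finally show ?thesis by simp
qed

lemma sets_leftmost:
  "{w. finite (noodle_component w) \<and> Min (noodle_component w) = 0} \<in> sets noodle_law"
proof -
  let ?f = "\<lambda>w. if finite (noodle_component w) then (if Min (noodle_component w) = 0 then 1 else 0) else (0::real)"
  have "?f \<in> borel_measurable noodle_law" by (rule measurable_finite_component)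
  from measurable_sets[OF this, of "{1}"] have "?f -` {1} \<in> sets noodle_law" by simp
  also have "?f -` {1} = {w. finite (noodle_component w) \<and> Min (noodle_component w) = 0}"
    by (auto split: if_splits)
  finally show ?thesis .
qed

lemma ennreal_kappa_leftmost:
  "ennreal kappa = 2 * emeasure noodle_law {w. finite (noodle_component w) \<and> Min (noodle_component w) = 0}"
proof -
  let ?X = noodle_component
  \<comment> \<open>\<open>F m\<close> is the mass that the origin sends to a leftmost site at
    distance \<open>m\<close>; \<open>H m\<close> is the mass that the origin, being leftmost,
    receives from \<open>int m\<close>. The shift turns one into the other.\<close>
  define F where "F m w = (if finite (?X w) then
      (if Min (?X w) = - int m then ennreal (2 / real (card (?X w))) else 0) else 0)" for m w
  define H where "H m w = (if finite (?X w) then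
      (if Min (?X w) = 0 \<and> int m \<in> ?X w then ennreal (2 / real (card (?X w))) else 0) else 0)" for m w
  have F [measurable]: "F m \<in> borel_measurable noodle_law" for m
    unfolding F_def by (rule measurable_finite_component)
  have H [measurable]: "H m \<in> borel_measurable noodle_law" for m
    unfolding H_def by (rule measurable_finite_component)
  have T [measurable]: "map_prod (word_shift m) (word_shift m) \<in> measurable noodle_law noodle_law" for m
  proof -
    have "map_prod (word_shift m) (word_shift m) = (\<lambda>w. (word_shift m (fst w), word_shift m (snd w)))" by auto
    then show ?thesis unfolding noodle_law_def by simp
  qed
  have "ennreal kappa = (\<integral>\<^sup>+ w. (\<Sum>m. F m w) \<partial>noodle_law)"
    unfolding kappa_nn_integral
  proof (rule nn_integral_cong)
    fix w
    show "(if finite (?X w) then ennreal (2 / real (card (?X w))) else 0) = (\<Sum>m. F m w)"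
    proof (cases "finite (?X w)")
      case True
      have "Min (?X w) \<le> 0" using True noodle_component_refl by simp
      then have "Min (?X w) = - int m \<longleftrightarrow> m = nat (- Min (?X w))" for m by auto
      then have "(\<Sum>m. F m w) = (\<Sum>m\<in>{nat (- Min (?X w))}. F m w)"
        by (intro suminf_finite) (auto simp: F_def)
      then show ?thesis using True \<open>Min (?X w) \<le> 0\<close> by (simp add: F_def)
    qed (simp add: F_def)
  qed
  also have "\<dots> = (\<Sum>m. \<integral>\<^sup>+ w. F m w \<partial>noodle_law)"
    by (rule nn_integral_suminf) simp
  also have "\<dots> = (\<Sum>m. \<integral>\<^sup>+ w. H m w \<partial>noodle_law)"
  proof (rule suminf_cong)
    fix m
    let ?T = "map_prod (word_shift (- int m)) (word_shift (- int m))"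
    have "F m w = H m (?T w)" for w
      using shifted_leftmost[of w m] unfolding F_def H_def by auto
    then have "(\<integral>\<^sup>+ w. F m w \<partial>noodle_law) = (\<integral>\<^sup>+ w. H m (?T w) \<partial>noodle_law)" by simp
    also have "\<dots> = (\<integral>\<^sup>+ w. H m w \<partial>distr noodle_law noodle_law ?T)"
      by (rule nn_integral_distr[symmetric]) simp_all
    also have "\<dots> = (\<integral>\<^sup>+ w. H m w \<partial>noodle_law)" by (simp add: distr_shift_noodle)
    finally show "(\<integral>\<^sup>+ w. F m w \<partial>noodle_law) = (\<integral>\<^sup>+ w. H m w \<partial>noodle_law)" .
  qed
  also have "\<dots> = (\<integral>\<^sup>+ w. (\<Sum>m. H m w) \<partial>noodle_law)"
    by (rule nn_integral_suminf[symmetric]) simp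
  also have "\<dots> = (\<integral>\<^sup>+ w. 2 * indicator {w. finite (?X w) \<and> Min (?X w) = 0} w \<partial>noodle_law)"
  proof (rule nn_integral_cong)
    fix w
    show "(\<Sum>m. H m w) = 2 * indicator {w. finite (?X w) \<and> Min (?X w) = 0} w"
    proof (cases "finite (?X w) \<and> Min (?X w) = 0")
      case True
      have "?X w \<noteq> {}" using noodle_component_refl by blast
      then show ?thesis using True suminf_indicator_members[of "?X w"] by (simp add: H_def)
    next
      case False
      then have "H m w = 0" for m by (auto simp: H_def)
      then show ?thesis using False by simp
    qed
  qed
  also have "\<dots> = 2 * emeasure noodle_law {w. finite (?X w) \<and> Min (?X w) = 0}"
    by (rule nn_integral_cmult_indicator) (rule sets_leftmost)
  finally show ?thesis .
qed


section \<open>Summation over meanders and gaps\<close>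

text \<open>The factor 1/4 of the two end letters is left out, so that the weight agrees with
  \<open>face_weight\<close>.\<close>

definition arc_weight :: "(nat \<Rightarrow> nat) \<Rightarrow> nat set set \<Rightarrow> nat set \<Rightarrow> real" where
  "arc_weight l U p = (let n = (\<Sum>i\<in>arc_indices U p. l i) in catalan n / 4 ^ n)"

definition arc_event :: "(nat \<Rightarrow> nat) \<Rightarrow> nat set set \<Rightarrow> (int \<Rightarrow> letter) set" where
  "arc_event l U = {w. \<forall>p\<in>U. w (site l (Min p)) = L \<and> w (site l (Max p)) = R \<and> dyck w (gaps l U p)}"

lemma catalan_nonneg: "catalan n \<ge> 0"
  by (simp add: catalan_def)

lemma arc_weight_nonneg: "arc_weight l U p \<ge> 0"
  by (simp add: arc_weight_def Let_def catalan_nonneg)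

lemma finite_noncrossing_matching: "noncrossing_matching V U \<Longrightarrow> finite V \<Longrightarrow> finite U"
  using finite_elements by (auto simp: noncrossing_matching_def)

lemma card_noncrossing_matching:
  assumes "noncrossing_matching {0..<2*k} U"
  shows "card U = k"
proof -
  have "2 * card U = card (\<Union>U)"
  proof (rule card_partition)
    show "p \<inter> q = {}" if "p \<in> U" "q \<in> U" "p \<noteq> q" for p q
      using noncrossing_matching_unique[OF assms that(1,2)] that(3) by blast
  qed (use assms finite_noncrossing_matching[OF assms] in
      \<open>auto simp: noncrossing_matching_def partition_on_def\<close>)
  also have "\<Union>U = {0..<2*k}" using assms by (simp add: noncrossing_matching_def partition_on_def)
  finally show ?thesis by simp
qed

lemma prob_arc_event_matching:
  assumes U: "noncrossing_matching {0..<2*k} U"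
  shows "arc_event l U \<in> sets word_law"
    and "measure word_law (arc_event l U) = (1/4) ^ k * (\<Prod>p\<in>U. arc_weight l U p)"
proof -
  interpret finite_noncrossing "{0..<2*k}" U by unfold_locales (rule U)
  have fin: "finite U" using finite_noncrossing_matching[OF U] by simp
  define A where "A p = {w. w (site l (Min p)) = L \<and> w (site l (Max p)) = R \<and> dyck w (gaps l U p)}" for p
  have eq: "arc_event l U = {w. \<forall>p\<in>U. w \<in> A p}" by (simp add: arc_event_def A_def)
  have dep: "depends_only (block l U p) (A p)" if "p \<in> U" for p
    unfolding A_def block_def using Min_less_Max[OF that]
    by (intro prob_arc_event(1)[OF finite_gaps card_gaps]) (auto simp: site_notin_gaps)
  have prob: "measure word_law (A p) = 1/4 * arc_weight l U p" if "p \<in> U" for p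
    unfolding A_def using Min_less_Max[OF that]
    by (subst prob_arc_event(2)[OF finite_gaps card_gaps]) (auto simp: site_notin_gaps arc_weight_def Let_def)
  have *: "depends_only (\<Union>p\<in>U. block l U p) {w. \<forall>p\<in>U. w \<in> A p} \<and>
    measure word_law {w. \<forall>p\<in>U. w \<in> A p} = (\<Prod>p\<in>U. measure word_law (A p))"
    by (rule prob_INT_depends_only[OF fin finite_block dep block_disjoint])
  show "arc_event l U \<in> sets word_law"
    unfolding eq using * fin finite_block by (intro prob_depends_only(1)[of "\<Union>p\<in>U. block l U p"]) auto
  have "measure word_law (arc_event l U) = (\<Prod>p\<in>U. 1/4 * arc_weight l U p)"
    unfolding eq using * prob by simp
  also have "\<dots> = (1/4) ^ k * (\<Prod>p\<in>U. arc_weight l U p)"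
    by (simp only: prod.distrib prod_constant card_noncrossing_matching[OF U])
  finally show "measure word_law (arc_event l U) = (1/4) ^ k * (\<Prod>p\<in>U. arc_weight l U p)" .
qed

text \<open>The two Dyck criteria for arcs give one direction each. A property of the infinite
  matching is thereby replaced by a condition on finitely many letters.\<close>

lemma embeds_iff_arc_event:
  assumes w: "matchable w" and U: "noncrossing_matching {0..<2*k} U"
  shows "embeds (site l) U (arc_set w) \<longleftrightarrow> w \<in> arc_event l U"
proof -
  interpret finite_noncrossing "{0..<2*k}" U by unfold_locales (rule U)
  have fin: "finite U" using finite_noncrossing_matching[OF U] by simp
  have V: "\<Union>U = {0..<2*k}" using U by (simp add: noncrossing_matching_def partition_on_def)
  have emb: "embeds (site l) U (arc_set w) \<longleftrightarrow> (\<forall>p\<in>U. is_arc w (site l (Min p)) (site l (Max p)))"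
    unfolding embeds_def
  proof (rule ball_cong)
    fix p assume p: "p \<in> U"
    have "site l ` p = {site l (Min p), site l (Max p)}" by (subst arc_eq[OF p]) simp
    moreover have "\<not> is_arc w (site l (Max p)) (site l (Min p))"
      using is_arc_less[of w "site l (Max p)" "site l (Min p)"] Min_less_Max[OF p] by auto
    ultimately show "site l ` p \<in> arc_set w \<longleftrightarrow> is_arc w (site l (Min p)) (site l (Max p))"
      by (simp add: doubleton_in_arc_set)
  qed simp
  show ?thesis
    unfolding emb
  proof
    assume arcs: "\<forall>p\<in>U. is_arc w (site l (Min p)) (site l (Max p))"
    have "w (site l (Min p)) = L \<and> w (site l (Max p)) = R \<and> dyck w (gaps l U p)" if "p \<in> U" for p
      using is_arc_letters[OF arcs[rule_format, OF that]] dyck_gaps_if_is_arc[OF w V that] arcs by simp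
    then show "w \<in> arc_event l U" by (simp add: arc_event_def)
  next
    assume "w \<in> arc_event l U"
    then show "\<forall>p\<in>U. is_arc w (site l (Min p)) (site l (Max p))"
      by (intro ballI is_arc_if_dyck_gaps[OF fin V]) (simp_all add: arc_event_def)
  qed
qed

text \<open>An arc leaving \<open>{Min p<..i}\<close> to the right would be nested in
  \<open>p\<close> and pass over \<open>i\<close>, so \<open>i\<close> would not be an index of
  \<open>p\<close>. Hence this interval is a union of pairs and has even length.\<close>

lemma arc_indices_parity:
  assumes U: "noncrossing_matching {0..<2*k} U" and p: "p \<in> U" and i: "i \<in> arc_indices U p"
  shows "even i \<longleftrightarrow> even (Min p)"
proof -
  interpret finite_noncrossing "{0..<2*k}" U by unfold_locales (rule U)
  have ip: "Min p \<le> i" "i < Max p" using i by (auto simp: arc_indices_def)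
  have pU: "{Min p, Max p} \<in> U" using arc_eq[OF p] p by metis
  have pk: "Max p < 2*k" using noncrossing_matching_pair(3)[OF U pU] by simp
  have "even (card {Min p<..i})"
  proof (rule noncrossing_matching_even_card[OF U])
    fix m n assume mn: "{m, n} \<in> U" "m \<in> {Min p<..i}"
    have "Min p < n" "n < Max p"
      using noncrossing_matching_between[OF U pU mn(1)] mn(2) ip by auto
    moreover have "n \<le> i"
    proof (rule ccontr)
      assume "\<not> n \<le> i"
      moreover have "Min {m, n} = min m n" "Max {m, n} = max m n" by simp_all
      ultimately show False
        using i mn \<open>n < Max p\<close> unfolding arc_indices_def
        by (auto simp: min_def max_def split: if_splits)
    qed
    ultimately show "n \<in> {Min p<..i}" by simp
  qed (use ip pk in auto)
  then show ?thesis using ip by simp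
qed

lemma face_weight_arc_region:
  assumes "s = 1 \<or> s = -1" "noncrossing_matching {0..<2*k} U" "p \<in> U"
  shows "face_weight k l (arc_region s U p) = arc_weight l U p"
proof -
  have "(2::real) powi (- 2 * int n) = 1 / 4 ^ n" for n
  proof -
    have "(2::real) powi (- 2 * int n) = inverse (2 powi (int (2 * n)))"
      by (simp flip: power_int_minus)
    also have "\<dots> = inverse (2 ^ (2 * n))" by (simp only: power_int_of_nat)
    finally show ?thesis by (simp add: power_mult inverse_eq_divide)
  qed
  then show ?thesis
    by (simp add: face_weight_def arc_weight_def face_indices_arc_region[OF assms])
qed

text \<open>An empty index set would satisfy both parity conditions vacuously; the index
  \<open>Min p\<close> excludes this and makes the two classes disjoint.\<close>

lemma even_odd_faces:
  assumes U: "noncrossing_matching {0..<2*k} U" and D: "noncrossing_matching {0..<2*k} D"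
  shows "even_faces k (U, D) \<union> odd_faces k (U, D) = faces (U, D)"
    and "even_faces k (U, D) \<inter> odd_faces k (U, D) = {}"
proof -
  have *: "\<exists>i\<in>face_indices k F. \<forall>j\<in>face_indices k F. even j \<longleftrightarrow> even i" if "F \<in> faces (U, D)" for F
  proof -
    have one: "\<exists>i\<in>face_indices k F. \<forall>j\<in>face_indices k F. even j \<longleftrightarrow> even i"
      if F: "p \<in> V" "F = arc_region s V p" and s: "s = 1 \<or> s = -1" and V: "noncrossing_matching {0..<2*k} V" for s V p
    proof -
      have "Min p < Max p" using noncrossing_matchingE[OF V F(1)] by metis
      then have "Min p \<in> arc_indices V p" by (rule arc_indices_Min)
      moreover have "\<forall>j\<in>arc_indices V p. even j \<longleftrightarrow> even (Min p)"
        using arc_indices_parity[OF V F(1)] by blast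
      ultimately show ?thesis unfolding F(2) face_indices_arc_region[OF s V F(1)] by blast
    qed
    from that consider p where "p \<in> U" "F = arc_region 1 U p" | p where "p \<in> D" "F = arc_region (-1) D p"
      unfolding faces_eq_arc_regions[OF U D] by blast
    then show ?thesis using one[of _ U 1] one[of _ D "-1"] U D by cases auto
  qed
  have "F \<in> even_faces k (U, D) \<or> F \<in> odd_faces k (U, D)" if F: "F \<in> faces (U, D)" for F
  proof -
    obtain i where "i \<in> face_indices k F" "\<forall>j\<in>face_indices k F. even j \<longleftrightarrow> even i" using *[OF F] ..
    then show ?thesis using F by (cases "even i") (auto simp: even_faces_def odd_faces_def)
  qed
  then show "even_faces k (U, D) \<union> odd_faces k (U, D) = faces (U, D)"
    by (auto simp: even_faces_def odd_faces_def)
  have False if F: "F \<in> even_faces k (U, D)" "F \<in> odd_faces k (U, D)" for F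
  proof -
    have "F \<in> faces (U, D)" using F(1) by (simp add: even_faces_def)
    from *[OF this] obtain i where "i \<in> face_indices k F" by blast
    then show False using F by (auto simp: even_faces_def odd_faces_def)
  qed
  then show "even_faces k (U, D) \<inter> odd_faces k (U, D) = {}" by blast
qed

text \<open>The same product is grouped once by parity and once by side of the axis. Faces of
  different sides lie in opposite open half planes, and on each side distinct arcs have distinct
  faces.\<close>

lemma prod_faces:
  assumes U: "noncrossing_matching {0..<2*k} U" and D: "noncrossing_matching {0..<2*k} D"
  shows "(\<Prod>F\<in>even_faces k (U, D). face_weight k l F) * (\<Prod>F\<in>odd_faces k (U, D). face_weight k l F) =
    (\<Prod>p\<in>U. arc_weight l U p) * (\<Prod>p\<in>D. arc_weight l D p)"
proof -
  have fin: "finite U" "finite D" using finite_noncrossing_matching U D by auto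
  have finF: "finite (faces (U, D))" unfolding faces_eq_arc_regions[OF U D] using fin by simp
  have "arc_region 1 U ` U \<inter> arc_region (-1) D ` D = {}"
  proof -
    have "arc_region 1 U p \<noteq> {}" if "p \<in> U" for p
      using arc_region_in_components(1)[of 1 k U p "- drawing (U, D)"] U that drawing_side(1,3)
        in_components_nonempty by simp
    moreover have "arc_region 1 U p \<inter> arc_region (-1) D q = {}" for p q by (auto simp: arc_region_def)
    ultimately show ?thesis by force
  qed
  then have "(\<Prod>F\<in>faces (U, D). face_weight k l F) =
      (\<Prod>F\<in>arc_region 1 U ` U. face_weight k l F) * (\<Prod>F\<in>arc_region (-1) D ` D. face_weight k l F)"
    unfolding faces_eq_arc_regions[OF U D] using fin by (intro prod.union_disjoint) auto
  also have "(\<Prod>F\<in>arc_region 1 U ` U. face_weight k l F) = (\<Prod>p\<in>U. arc_weight l U p)"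
    using inj_on_arc_region[of 1 k U] U face_weight_arc_region[of 1 k U]
    by (subst prod.reindex) auto
  also have "(\<Prod>F\<in>arc_region (-1) D ` D. face_weight k l F) = (\<Prod>p\<in>D. arc_weight l D p)"
    using inj_on_arc_region[of "-1" k D] D face_weight_arc_region[of "-1" k D]
    by (subst prod.reindex) auto
  also have "(\<Prod>F\<in>faces (U, D). face_weight k l F) =
      (\<Prod>F\<in>even_faces k (U, D). face_weight k l F) * (\<Prod>F\<in>odd_faces k (U, D). face_weight k l F)"
    unfolding even_odd_faces(1)[OF U D, symmetric]
    using finF even_odd_faces[OF U D] by (intro prod.union_disjoint) (metis finite_Un)+
  finally show ?thesis .
qed

text \<open>In \<open>ennreal\<close> the unordered sum is the supremum over finite subsets, and an
  enumeration of \<open>I\<close> exhausts the integral by such sums. This links the sums of the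
  theorem to the integrals that express countable additivity.\<close>

lemma infsum_eq_nn_integral_count_space:
  fixes f :: "'a \<Rightarrow> ennreal"
  assumes "countable I"
  shows "infsum f I = (\<integral>\<^sup>+ x. f x \<partial>count_space I)"
proof (rule antisym)
  have sup: "infsum f I = (SUP F\<in>{F. finite F \<and> F \<subseteq> I}. sum f F)"
    by (rule nonneg_infsum_complete) simp
  show "infsum f I \<le> (\<integral>\<^sup>+ x. f x \<partial>count_space I)"
    unfolding sup
  proof (rule SUP_least)
    fix F assume F: "F \<in> {F. finite F \<and> F \<subseteq> I}"
    have "sum f F = (\<integral>\<^sup>+ x. f x * indicator F x \<partial>count_space I)"
      using F by (subst nn_integral_count_space'[of F]) (auto intro!: sum.cong)
    also have "\<dots> \<le> (\<integral>\<^sup>+ x. f x \<partial>count_space I)"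
      by (intro nn_integral_mono) (simp add: indicator_def)
    finally show "sum f F \<le> (\<integral>\<^sup>+ x. f x \<partial>count_space I)" .
  qed
  show "(\<integral>\<^sup>+ x. f x \<partial>count_space I) \<le> infsum f I"
  proof (cases "finite I")
    case True
    then show ?thesis by (simp add: nn_integral_count_space_finite)
  next
    case False
    define e where "e = from_nat_into I"
    have e: "bij_betw e UNIV I" unfolding e_def by (rule bij_betw_from_nat_into[OF assms False])
    have "(\<integral>\<^sup>+ x. f x \<partial>count_space I) = (\<integral>\<^sup>+ n. f (e n) \<partial>count_space UNIV)"
      by (rule nn_integral_bij_count_space[OF e, symmetric])
    also have "\<dots> = (\<Sum>n. f (e n))" by (rule nn_integral_count_space_nat)
    also have "\<dots> = (SUP n. \<Sum>i<n. f (e i))" by (rule suminf_eq_SUP)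
    also have "\<dots> \<le> infsum f I"
    proof (rule SUP_least)
      fix n
      have inj: "inj_on e {..<n}" using e by (auto simp: bij_betw_def intro: inj_on_subset)
      have "(\<Sum>i<n. f (e i)) = sum f (e ` {..<n})" by (simp add: sum.reindex[OF inj])
      also have "\<dots> \<le> infsum f I"
        unfolding sup using e by (intro SUP_upper) (auto simp: bij_betw_def)
      finally show "(\<Sum>i<n. f (e i)) \<le> infsum f I" .
    qed
    finally show ?thesis .
  qed
qed

text \<open>Tonelli for counting measure; \<open>A\<close> and \<open>B\<close> are absorbed into
  indicators so that the integrals run over whole types.\<close>

lemma nn_integral_count_space_times:
  fixes f :: "'a \<Rightarrow> ennreal" and g :: "'b \<Rightarrow> ennreal"
  shows "(\<integral>\<^sup>+ (x, y). f x * g y \<partial>count_space (A \<times> B)) =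
    (\<integral>\<^sup>+ x. f x \<partial>count_space A) * (\<integral>\<^sup>+ y. g y \<partial>count_space B)"
proof -
  define f' where "f' x = f x * indicator A x" for x
  define g' where "g' y = g y * indicator B y" for y
  have "(\<integral>\<^sup>+ (x, y). f x * g y \<partial>count_space (A \<times> B)) = (\<integral>\<^sup>+ z. f' (fst z) * g' (snd z) \<partial>count_space UNIV)"
    by (subst nn_integral_count_space_indicator)
      (auto intro!: nn_integral_cong simp: f'_def g'_def indicator_def split: prod.splits)
  also have "\<dots> = (\<integral>\<^sup>+ x. (\<integral>\<^sup>+ y. f' x * g' y \<partial>count_space UNIV) \<partial>count_space UNIV)"
    using nn_integral_fst_count_space[of "\<lambda>z. f' (fst z) * g' (snd z)"] by simp
  also have "\<dots> = (\<integral>\<^sup>+ x. f' x * (\<integral>\<^sup>+ y. g' y \<partial>count_space UNIV) \<partial>count_space UNIV)"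
    by (simp add: nn_integral_cmult)
  also have "\<dots> = (\<integral>\<^sup>+ x. f' x \<partial>count_space UNIV) * (\<integral>\<^sup>+ y. g' y \<partial>count_space UNIV)"
    by (simp add: nn_integral_multc)
  finally show ?thesis unfolding f'_def g'_def by (simp add: nn_integral_count_space_indicator)
qed

lemma face_weight_cong:
  "(\<And>i. i \<in> face_indices k F \<Longrightarrow> l i = l' i) \<Longrightarrow> face_weight k l F = face_weight k l' F"
  unfolding face_weight_def by (simp cong: sum.cong)

lemma face_weight_nonneg: "face_weight k l F \<ge> 0"
  unfolding face_weight_def Let_def by (intro mult_nonneg_nonneg catalan_nonneg zero_le_power_int) simp

text \<open>The weight of an even face reads \<open>l\<close> only at even indices, that of an odd
  face only at odd ones, so the integrand is a product in separate variables. For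
  \<open>k = 1\<close> the odd index set is empty and the second sum has a single term.\<close>

lemma nn_integral_gaps_split:
  "(\<integral>\<^sup>+ l. ennreal ((\<Prod>F\<in>even_faces k C. face_weight k l F) * (\<Prod>F\<in>odd_faces k C. face_weight k l F))
      \<partial>count_space ({0..2*k-2} \<rightarrow>\<^sub>E UNIV)) =
   (\<Sum>\<^sub>\<infinity>l\<in>{i\<in>{0..2*k-2}. even i} \<rightarrow>\<^sub>E (UNIV :: nat set). ennreal (\<Prod>F\<in>even_faces k C. face_weight k l F)) *
   (\<Sum>\<^sub>\<infinity>l\<in>{i\<in>{0..2*k-2}. odd i} \<rightarrow>\<^sub>E (UNIV :: nat set). ennreal (\<Prod>F\<in>odd_faces k C. face_weight k l F))"
proof -
  define E where "E = {i\<in>{0..2*k-2}. even i}"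
  define O' where "O' = {i\<in>{0..2*k-2}. odd i}"
  define f where "f l = ennreal (\<Prod>F\<in>even_faces k C. face_weight k l F)" for l
  define g where "g l = ennreal (\<Prod>F\<in>odd_faces k C. face_weight k l F)" for l
  have EO: "{0..2*k-2} = E \<union> O'" "E \<inter> O' = {}" by (auto simp: E_def O'_def)
  have fin: "finite E" "finite O'" by (auto simp: E_def O'_def)
  have "f (restrict l E) = f l" for l
    unfolding f_def
    by (rule arg_cong[where f = ennreal], intro prod.cong face_weight_cong)
      (auto simp: E_def even_faces_def face_indices_def)
  moreover have "g (restrict l O') = g l" for l
    unfolding g_def
    by (rule arg_cong[where f = ennreal], intro prod.cong face_weight_cong)
      (auto simp: O'_def odd_faces_def face_indices_def)
  ultimately have eq: "ennreal ((\<Prod>F\<in>even_faces k C. face_weight k l F) * (\<Prod>F\<in>odd_faces k C. face_weight k l F)) =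
      f (restrict l E) * g (restrict l O')" for l
    unfolding f_def g_def by (simp add: ennreal_mult prod_nonneg face_weight_nonneg)
  have "(\<integral>\<^sup>+ l. f (restrict l E) * g (restrict l O') \<partial>count_space (E \<union> O' \<rightarrow>\<^sub>E UNIV)) =
      (\<integral>\<^sup>+ l. (\<lambda>(a, b). f a * g b) (restrict l E, restrict l O') \<partial>count_space (E \<union> O' \<rightarrow>\<^sub>E UNIV))"
    by simp
  also have "\<dots> = (\<integral>\<^sup>+ (a, b). f a * g b \<partial>count_space ((E \<rightarrow>\<^sub>E UNIV) \<times> (O' \<rightarrow>\<^sub>E UNIV)))"
    by (rule nn_integral_bij_count_space[OF bij_betw_restrict_PiE[OF EO(2)]])
  also have "\<dots> = (\<integral>\<^sup>+ l. f l \<partial>count_space (E \<rightarrow>\<^sub>E UNIV)) * (\<integral>\<^sup>+ l. g l \<partial>count_space (O' \<rightarrow>\<^sub>E UNIV))"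
    by (rule nn_integral_count_space_times)
  also have "\<dots> = infsum f (E \<rightarrow>\<^sub>E UNIV) * infsum g (O' \<rightarrow>\<^sub>E UNIV)"
    using fin by (simp add: infsum_eq_nn_integral_count_space countable_PiE)
  finally have split: "(\<integral>\<^sup>+ l. f (restrict l E) * g (restrict l O') \<partial>count_space ({0..2*k-2} \<rightarrow>\<^sub>E UNIV)) =
      infsum f (E \<rightarrow>\<^sub>E UNIV) * infsum g (O' \<rightarrow>\<^sub>E UNIV)"
    unfolding EO(1) .
  show ?thesis unfolding eq split by (simp only: f_def[abs_def] g_def[abs_def] E_def O'_def)
qed

section \<open>The leftmost event as a disjoint union over meanders and gaps\<close>

definition realized :: "nat \<Rightarrow> nat set set \<times> nat set set \<Rightarrow> (nat \<Rightarrow> nat) \<Rightarrow> ((int \<Rightarrow> letter) \<times> (int \<Rightarrow> letter)) set" where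
  "realized k C l = {w. matchable (fst w) \<and> matchable (snd w)} \<inter> (arc_event l (fst C) \<times> arc_event l (snd C))"

lemma AE_noodle_matchable: "AE w in noodle_law. matchable (fst w) \<and> matchable (snd w)"
proof -
  interpret pair_sigma_finite word_law word_law
    by (intro pair_sigma_finite.intro word_law.sigma_finite_measure_axioms)
  show ?thesis
    unfolding noodle_law_def
  proof (rule AE_pair_measure)
    show "{w \<in> space (word_law \<Otimes>\<^sub>M word_law). matchable (fst w) \<and> matchable (snd w)}
        \<in> sets (word_law \<Otimes>\<^sub>M word_law)" by measurable
    show "AE x in word_law. AE y in word_law. matchable (fst (x, y)) \<and> matchable (snd (x, y))"
      using AE_matchable by (rule AE_mp) (use AE_matchable in auto)
  qed
qed

lemma sets_noodle_matchable: "{w. matchable (fst w) \<and> matchable (snd w)} \<in> sets noodle_law"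
proof -
  have "Measurable.pred (word_law \<Otimes>\<^sub>M word_law) (\<lambda>w. matchable (fst w) \<and> matchable (snd w))" by measurable
  then show ?thesis by (simp add: noodle_law_def pred_def space_pair_measure)
qed

lemma meandersD:
  assumes "C \<in> meanders k"
  shows "noncrossing_matching {0..<2*k} (fst C)" "noncrossing_matching {0..<2*k} (snd C)"
  using assms by (auto simp: meanders_def meandric_systems_def)

lemma finite_meanders: "finite (meanders k)"
proof (rule finite_subset)
  show "meanders k \<subseteq> Pow (Pow {0..<2*k}) \<times> Pow (Pow {0..<2*k})"
    by (auto simp: meanders_def meandric_systems_def noncrossing_matching_def partition_on_def)
qed simp

text \<open>The upper and the lower word are independent, and up to a null set the event is a
  product. Each of the two matchings has \<open>k\<close> arcs with factor 1/4, whence the exponent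
  \<open>2 * k\<close>.\<close>

lemma emeasure_realized:
  assumes C: "C \<in> meanders k"
  shows "realized k C l \<in> sets noodle_law"
    and "emeasure noodle_law (realized k C l) = ennreal ((1/4) ^ (2 * k)) *
      ennreal ((\<Prod>F\<in>even_faces k C. face_weight k l F) * (\<Prod>F\<in>odd_faces k C. face_weight k l F))"
proof -
  obtain U D where C_eq: "C = (U, D)" by (cases C)
  have U: "noncrossing_matching {0..<2*k} U" and D: "noncrossing_matching {0..<2*k} D"
    using meandersD[OF C] by (auto simp: C_eq)
  note PU = prob_arc_event_matching[OF U, of l]
  note PD = prob_arc_event_matching[OF D, of l]
  have s: "arc_event l U \<times> arc_event l D \<in> sets noodle_law"
    unfolding noodle_law_def using PU(1) PD(1) by (rule pair_measureI)
  show s': "realized k C l \<in> sets noodle_law"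
    unfolding realized_def C_eq using s sets_noodle_matchable by (auto intro: sets.Int)
  have "emeasure noodle_law (realized k C l) = emeasure noodle_law (arc_event l U \<times> arc_event l D)"
    using AE_noodle_matchable s s' by (intro emeasure_eq_AE) (auto simp: realized_def C_eq)
  also have "\<dots> = emeasure word_law (arc_event l U) * emeasure word_law (arc_event l D)"
    unfolding noodle_law_def using PU(1) PD(1) by (rule word_law.emeasure_pair_measure_Times)
  also have "\<dots> = ennreal (((1/4) ^ k * (\<Prod>p\<in>U. arc_weight l U p)) * ((1/4) ^ k * (\<Prod>p\<in>D. arc_weight l D p)))"
    unfolding word_law.emeasure_eq_measure PU(2) PD(2)
    by (intro ennreal_mult[symmetric] mult_nonneg_nonneg prod_nonneg ballI arc_weight_nonneg) auto
  also have "((1/4) ^ k * (\<Prod>p\<in>U. arc_weight l U p)) * ((1/4) ^ k * (\<Prod>p\<in>D. arc_weight l D p)) =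
      (1/4) ^ (2 * k) * ((\<Prod>F\<in>even_faces k (U, D). face_weight k l F) * (\<Prod>F\<in>odd_faces k (U, D). face_weight k l F))"
    unfolding prod_faces[OF U D] by (simp add: mult_2 power_add)
  also have "ennreal \<dots> = ennreal ((1/4) ^ (2 * k)) *
      ennreal ((\<Prod>F\<in>even_faces k C. face_weight k l F) * (\<Prod>F\<in>odd_faces k C. face_weight k l F))"
    unfolding C_eq by (intro ennreal_mult mult_nonneg_nonneg prod_nonneg ballI face_weight_nonneg) auto
  finally show "emeasure noodle_law (realized k C l) = ennreal ((1/4) ^ (2 * k)) *
      ennreal ((\<Prod>F\<in>even_faces k C. face_weight k l F) * (\<Prod>F\<in>odd_faces k C. face_weight k l F))" .
qed

lemma realized_embeds:
  assumes "w \<in> realized k C l" "C \<in> meanders k"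
  shows "noncrossing_matching UNIV (word_matching (fst w))" "noncrossing_matching UNIV (word_matching (snd w))"
    "embeds (site l) (fst C) (word_matching (fst w))" "embeds (site l) (snd C) (word_matching (snd w))"
proof -
  have m: "matchable (fst w)" "matchable (snd w)" using assms(1) by (auto simp: realized_def)
  show "noncrossing_matching UNIV (word_matching (fst w))" "noncrossing_matching UNIV (word_matching (snd w))"
    using m matches_word_arc_set by (auto simp: word_matching_eq matches_word_def)
  show "embeds (site l) (fst C) (word_matching (fst w))" "embeds (site l) (snd C) (word_matching (snd w))"
    using assms(1) embeds_iff_arc_event[OF m(1) meandersD(1)[OF assms(2)]]
      embeds_iff_arc_event[OF m(2) meandersD(2)[OF assms(2)]] m
    by (auto simp: word_matching_eq realized_def)
qed

lemma noodle_component_realized: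
  assumes "w \<in> realized k C l" "C \<in> meanders k" "0 < k"
  shows "noodle_component w = site l ` {0..<2*k}"
  using component_embedded_meander[of "fst C" "snd C" k "site l"] realized_embeds[OF assms(1,2)]
    assms(2,3) inj_site[of l] by (simp add: noodle_component_def)

text \<open>The component determines everything: its size gives \<open>k\<close>, its positions give
  \<open>l\<close>, and then the two matchings on it give \<open>C\<close>.\<close>

lemma realized_unique:
  assumes w: "w \<in> realized k C l" "w \<in> realized k' C' l'" and C: "C \<in> meanders k" "C' \<in> meanders k'"
    and k: "0 < k" "0 < k'" and l: "l \<in> {0..2*k-2} \<rightarrow>\<^sub>E UNIV" "l' \<in> {0..2*k'-2} \<rightarrow>\<^sub>E UNIV"
  shows "k = k'" "C = C'" "l = l'"
proof -
  have eq: "site l ` {0..<2*k} = site l' ` {0..<2*k'}"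
    using noodle_component_realized[OF w(1) C(1) k(1)] noodle_component_realized[OF w(2) C(2) k(2)] by simp
  have "card (site l ` {0..<2*k}) = 2 * k" for l k
    by (subst card_image) (auto intro: inj_on_subset[OF inj_site])
  then show kk: "k = k'" using eq by (metis mult_left_cancel zero_neq_numeral)
  show ll: "l = l'"
    by (rule site_image_unique[OF l(1) _ k(1)]) (use l eq kk in auto)
  note e = realized_embeds[OF w(1) C(1)] and e' = realized_embeds[OF w(2) C(2)]
  note n = meandersD[OF C(1)] and n' = meandersD[OF C(2), folded kk]
  have "fst C = fst C'"
    using embeds_unique[OF e(3) e'(3)[folded ll] inj_site e(1) n(1) n'(1)]
      embeds_unique[OF e'(3)[folded ll] e(3) inj_site e(1) n'(1) n(1)] by simp
  moreover have "snd C = snd C'"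
    using embeds_unique[OF e(4) e'(4)[folded ll] inj_site e(2) n(2) n'(2)]
      embeds_unique[OF e'(4)[folded ll] e(4) inj_site e(2) n'(2) n(2)] by simp
  ultimately show "C = C'" by (rule prod_eqI)
qed

text \<open>The restriction to matchable words matters: if both words lack a matching, the component
  of the origin is \<open>{0}\<close>, finite with minimum 0, although no meander is
  realized.\<close>

lemma leftmost_eq_realized:
  "{w. finite (noodle_component w) \<and> Min (noodle_component w) = 0} \<inter> {w. matchable (fst w) \<and> matchable (snd w)} =
    (\<Union>k\<in>{1..}. \<Union>C\<in>meanders k. \<Union>l\<in>{0..2*k-2} \<rightarrow>\<^sub>E UNIV. realized k C l)"
proof (intro equalityI subsetI)
  fix w assume "w \<in> {w. finite (noodle_component w) \<and> Min (noodle_component w) = 0} \<inter>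
      {w. matchable (fst w) \<and> matchable (snd w)}"
  then have fin: "finite (noodle_component w)" "Min (noodle_component w) = 0"
    and m: "matchable (fst w)" "matchable (snd w)" by auto
  have nm: "noncrossing_matching UNIV (word_matching (fst w))" "noncrossing_matching UNIV (word_matching (snd w))"
    using m matches_word_arc_set by (auto simp: word_matching_eq matches_word_def)
  have fin': "finite (component (noodle_edges w) 0)" "Min (component (noodle_edges w) 0) = 0"
    using fin by (simp_all only: noodle_component_def)
  obtain k l U D where klUD: "0 < k" "(U, D) \<in> meanders k" "l \<in> {0..2*k-2} \<rightarrow>\<^sub>E UNIV"
    "embeds (site l) U (word_matching (fst w))" "embeds (site l) D (word_matching (snd w))"
    by (rule finite_component_is_meander[OF nm fin'])
  have "w \<in> realized k (U, D) l"
    using klUD embeds_iff_arc_event[OF m(1)] embeds_iff_arc_event[OF m(2)] meandersD[OF klUD(2)] m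
    by (cases w) (auto simp: realized_def word_matching_eq)
  then show "w \<in> (\<Union>k\<in>{1..}. \<Union>C\<in>meanders k. \<Union>l\<in>{0..2*k-2} \<rightarrow>\<^sub>E UNIV. realized k C l)"
    using klUD(1-3) by (intro UN_I[of k] UN_I[of "(U, D)"] UN_I[of l]) auto
next
  fix w assume "w \<in> (\<Union>k\<in>{1..}. \<Union>C\<in>meanders k. \<Union>l\<in>{0..2*k-2} \<rightarrow>\<^sub>E UNIV. realized k C l)"
  then obtain k C l where h: "0 < k" "C \<in> meanders k" "w \<in> realized k C l"
    by (auto simp: Suc_le_eq)
  have X: "noodle_component w = site l ` {0..<2*k}" by (rule noodle_component_realized[OF h(3,2,1)])
  have "Min (noodle_component w) = 0"
  proof (rule Min_eqI)
    show "0 \<le> y" if y: "y \<in> noodle_component w" for y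
    proof -
      obtain i where "y = site l i" using y X by auto
      then show ?thesis using site_le_iff[of l 0 i] by simp
    qed
  qed (use X noodle_component_refl[of w] in simp_all)
  then show "w \<in> {w. finite (noodle_component w) \<and> Min (noodle_component w) = 0} \<inter>
      {w. matchable (fst w) \<and> matchable (snd w)}"
    using h(3) X by (auto simp: realized_def)
qed

text \<open>Additivity is used on three levels, for the sizes, the finitely many meanders of a size
  and the gaps; \<open>realized_unique\<close> supplies disjointness on each.\<close>

lemma emeasure_leftmost:
  "emeasure noodle_law {w. finite (noodle_component w) \<and> Min (noodle_component w) = 0} =
    (\<integral>\<^sup>+ k. (\<Sum>C\<in>meanders k. \<integral>\<^sup>+ l. emeasure noodle_law (realized k C l) \<partial>count_space ({0..2*k-2} \<rightarrow>\<^sub>E UNIV))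
      \<partial>count_space {1..})" (is "emeasure _ ?X = _")
proof -
  let ?L = "\<lambda>k::nat. {0..2*k-2} \<rightarrow>\<^sub>E (UNIV :: nat set)"
  let ?G = "{w. matchable (fst w) \<and> matchable (snd w)}"
  define Y where "Y k C = (\<Union>l\<in>?L k. realized k C l)" for k C
  define Z where "Z k = (\<Union>C\<in>meanders k. Y k C)" for k
  have cL: "countable (?L k)" for k by (rule countable_PiE) auto
  have Ys: "Y k C \<in> sets noodle_law" if "C \<in> meanders k" for k C
    unfolding Y_def using emeasure_realized(1)[OF that] cL by (intro sets.countable_UN') auto
  have Zs: "Z k \<in> sets noodle_law" for k
    unfolding Z_def using Ys finite_meanders by (intro sets.finite_UN) auto
  have "emeasure noodle_law ?X = emeasure noodle_law (?X \<inter> ?G)"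
    using AE_noodle_matchable sets_leftmost sets_noodle_matchable
    by (intro emeasure_eq_AE) auto
  also have "?X \<inter> ?G = (\<Union>k\<in>{1..}. Z k)"
    unfolding leftmost_eq_realized Z_def Y_def ..
  also have "emeasure noodle_law \<dots> = (\<integral>\<^sup>+ k. emeasure noodle_law (Z k) \<partial>count_space {1..})"
  proof (rule emeasure_UN_countable)
    show "disjoint_family_on Z {1..}"
      unfolding disjoint_family_on_def
    proof (intro ballI impI, rule ccontr)
      fix k k' assume k: "k \<in> {1..}" "k' \<in> {1..}" "k \<noteq> k'" "Z k \<inter> Z k' \<noteq> {}"
      then obtain w C C' l l' where "w \<in> realized k C l" "w \<in> realized k' C' l'" "C \<in> meanders k" "C' \<in> meanders k'"
        "l \<in> ?L k" "l' \<in> ?L k'" unfolding Z_def Y_def by blast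
      then show False using realized_unique(1)[of w k C l k' C' l'] k by auto
    qed
  qed (use Zs in auto)
  also have "\<dots> = (\<integral>\<^sup>+ k. (\<Sum>C\<in>meanders k. \<integral>\<^sup>+ l. emeasure noodle_law (realized k C l) \<partial>count_space (?L k)) \<partial>count_space {1..})"
  proof (rule nn_integral_cong)
    fix k assume "k \<in> space (count_space {1::nat..})"
    then have k: "0 < k" by auto
    have "emeasure noodle_law (Z k) = (\<Sum>C\<in>meanders k. emeasure noodle_law (Y k C))"
      unfolding Z_def
    proof (rule sum_emeasure[symmetric])
      show "disjoint_family_on (Y k) (meanders k)"
        unfolding disjoint_family_on_def
      proof (intro ballI impI, rule ccontr)
        fix C C' assume C: "C \<in> meanders k" "C' \<in> meanders k" "C \<noteq> C'" "Y k C \<inter> Y k C' \<noteq> {}"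
        then obtain w l l' where "w \<in> realized k C l" "w \<in> realized k C' l'" "l \<in> ?L k" "l' \<in> ?L k"
          unfolding Y_def by blast
        then show False using realized_unique(2)[of w k C l k C' l'] k C by auto
      qed
    qed (use Ys finite_meanders in auto)
    also have "\<dots> = (\<Sum>C\<in>meanders k. \<integral>\<^sup>+ l. emeasure noodle_law (realized k C l) \<partial>count_space (?L k))"
    proof (rule sum.cong)
      fix C assume C: "C \<in> meanders k"
      show "emeasure noodle_law (Y k C) = (\<integral>\<^sup>+ l. emeasure noodle_law (realized k C l) \<partial>count_space (?L k))"
        unfolding Y_def
      proof (rule emeasure_UN_countable)
        show "disjoint_family_on (realized k C) (?L k)"
          unfolding disjoint_family_on_def
        proof (intro ballI impI, rule ccontr)
          fix l l' assume l: "l \<in> ?L k" "l' \<in> ?L k" "l \<noteq> l'" "realized k C l \<inter> realized k C l' \<noteq> {}"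
          then obtain w where "w \<in> realized k C l" "w \<in> realized k C l'" by blast
          then show False using realized_unique(3)[of w k C l k C l'] k C l by auto
        qed
      qed (use emeasure_realized(1)[OF C] cL in auto)
    qed simp
    finally show "emeasure noodle_law (Z k) =
      (\<Sum>C\<in>meanders k. \<integral>\<^sup>+ l. emeasure noodle_law (realized k C l) \<partial>count_space (?L k))" .
  qed
  finally show ?thesis .
qed

text \<open>Both sides live in \<open>ennreal\<close>, where all the sums exist. As
  \<open>kappa\<close> is a nonnegative real number, the identity includes the finiteness of the
  series.\<close>

theorem mainTheorem4:
  shows "ennreal kappa =
    (\<Sum>\<^sub>\<infinity>k\<in>{1::nat..}. ennreal (2 powi (- 4 * int k + 1)) *
      (\<Sum>C\<in>meanders k.
        (\<Sum>\<^sub>\<infinity>l\<in>{i\<in>{0..2*k-2}. even i} \<rightarrow>\<^sub>E (UNIV :: nat set).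
            ennreal (\<Prod>F\<in>even_faces k C. face_weight k l F)) *
        (\<Sum>\<^sub>\<infinity>l\<in>{i\<in>{0..2*k-2}. odd i} \<rightarrow>\<^sub>E (UNIV :: nat set).
            ennreal (\<Prod>F\<in>odd_faces k C. face_weight k l F))))"
proof -
  define S where "S k C = (\<Sum>\<^sub>\<infinity>l\<in>{i\<in>{0..2*k-2}. even i} \<rightarrow>\<^sub>E (UNIV :: nat set).
            ennreal (\<Prod>F\<in>even_faces k C. face_weight k l F)) *
        (\<Sum>\<^sub>\<infinity>l\<in>{i\<in>{0..2*k-2}. odd i} \<rightarrow>\<^sub>E (UNIV :: nat set).
            ennreal (\<Prod>F\<in>odd_faces k C. face_weight k l F))" for k C
  have inner: "(\<integral>\<^sup>+ l. emeasure noodle_law (realized k C l) \<partial>count_space ({0..2*k-2} \<rightarrow>\<^sub>E UNIV)) =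
      ennreal ((1/4) ^ (2 * k)) * S k C" if "C \<in> meanders k" for k C
    unfolding S_def nn_integral_gaps_split[symmetric] emeasure_realized(2)[OF that]
    by (rule nn_integral_cmult) simp
  \<comment> \<open>The factor 2 is the mass received by a leftmost site, and
    \<open>(1/4) ^ (2 * k)\<close> stems from the end letters of the \<open>2 * k\<close>
    arcs.\<close>
  have pw: "2 * ennreal ((1/4) ^ (2 * k)) = ennreal (2 powi (- 4 * int k + 1))" for k
  proof -
    have "(2::real) powi (- 4 * int k + 1) = 2 * 2 powi (- 4 * int k)"
      by (subst power_int_add) auto
    also have "(2::real) powi (- 4 * int k) = inverse (2 powi int (4 * k))"
      by (simp flip: power_int_minus)
    also have "\<dots> = (1/4) ^ (2 * k)"
      by (simp only: power_int_of_nat) (simp add: power_mult power_one_over inverse_eq_divide)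
    finally show ?thesis by (simp add: ennreal_mult)
  qed
  have "ennreal kappa = 2 * (\<integral>\<^sup>+ k. (\<Sum>C\<in>meanders k. ennreal ((1/4) ^ (2 * k)) * S k C) \<partial>count_space {1..})"
    unfolding ennreal_kappa_leftmost emeasure_leftmost by (simp add: inner)
  also have "\<dots> = (\<integral>\<^sup>+ k. 2 * (\<Sum>C\<in>meanders k. ennreal ((1/4) ^ (2 * k)) * S k C) \<partial>count_space {1..})"
    by (rule nn_integral_cmult[symmetric]) simp
  also have "\<dots> = (\<integral>\<^sup>+ k. ennreal (2 powi (- 4 * int k + 1)) * (\<Sum>C\<in>meanders k. S k C) \<partial>count_space {1..})"
    unfolding sum_distrib_left[symmetric] mult.assoc[symmetric] pw ..
  also have "\<dots> = (\<Sum>\<^sub>\<infinity>k\<in>{1..}. ennreal (2 powi (- 4 * int k + 1)) * (\<Sum>C\<in>meanders k. S k C))"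
    by (rule infsum_eq_nn_integral_count_space[symmetric]) simp
  finally show ?thesis unfolding S_def .
qed

end
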